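(* Let $0<\alpha<1$, $T>0$, $0<\nu<\mu$, $Y=(0,\ell_1)$ with $\ell_1>0$, and let $\Omega\subset\mathbb{R}$ be a bounded open interval. Let $x_0\in\Omega$ and $t_1\in(0,T)$ be arbitrarily chosen, and let $u_0\in H^2(\Omega)\cap H_0^1(\Omega)$. Let $a_1,a_2\in L^\infty(Y)$ be $Y$-periodic with $\nu\le a_k\le\mu$ on $\overline Y$ ($k=1,2$) and $a_1(y)\ge a_2(y)$ for $y\in\overline Y$, let $a_k^0=1/\mathcal{M}_Y(1/a_k)$, and let $u_k^0$ be the weak solution of the homogenized problem $$\partial_t^\alpha u_k^0-\partial_x(a_k^0\partial_xu_k^0)=0\ \text{in }\Omega\times(0,T),\quad u_k^0=0\ \text{on }\partial\Omega\times(0,T),\quad u_k^0(\cdot,0)=u_0\ \text{in }\Omega.$$ Assume that there exists $n_0\in\mathbb{N}$ such that $P_{n_0}u_0(x_0)\ne0$. If $u_1^0(x_0,t)=u_2^0(x_0,t)$ for $0<t<t_1$, then $a_1=a_2$ a.e. on $Y$.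
   Context: $\mathcal{M}_Y(g)=\frac1{|Y|}\int_Yg\,dy$; $Y$-periodic means $\ell_1$-periodic on $\mathbb{R}$. The problem for $u_k^0$ is the homogenization limit, as $\varepsilon\to0$, of the problems with coefficient $a_k(x/\varepsilon)$ and initial values converging weakly in $L^2(\Omega)$ to $u_0$. Eigenprojections: let $0<\lambda_1<\lambda_2<\cdots\to\infty$ be the eigenvalues of $-\Delta=-\frac{d^2}{dx^2}$ in $L^2(\Omega)$ with domain $H^2(\Omega)\cap H_0^1(\Omega)$; $P_n$ is the $L^2(\Omega)$-orthogonal projection onto $\ker(-\Delta-\lambda_n)$. Fractional derivative: for a Hilbert space $X$ and $\beta>0$, $J^\beta v(t)=\frac1{\Gamma(\beta)}\int_0^t(t-s)^{\beta-1}v(s)\,ds$. $H^\alpha(0,T;X)$ is the Sobolev–Slobodeckij space; $H_\alpha(0,T;X)$ is $H^\alpha(0,T;X)$ if $\alpha<\frac12$; $\{u\in H^{1/2}(0,T;X):\int_0^T\|u(t)\|_X^2t^{-1}dt<\infty\}$ if $\alpha=\frac12$; $\{u\in H^\alpha(0,T;X):u(0)=0\}$ if $\alpha>\frac12$. The map $J^\alpha:L^2(0,T;X)\to H_\alpha(0,T;X)$ is an isomorphism and $\partial_t^\alpha:=(J^\alpha)^{-1}$ (generalized Caputo derivative). Weak solution: $u_k^0$ is the unique function in $L^2(0,T;H_0^1(\Omega))$ with $u_k^0-u_0\in H_\alpha(0,T;H^{-1}(\Omega))$ such that for a.e. $t$ and all $\Phi\in H_0^1(\Omega)$, $\langle\partial_t^\alpha(u_k^0-u_0),\Phi\rangle_{H^{-1},H_0^1}+a_k^0(\partial_xu_k^0,\partial_x\Phi)_{L^2(\Omega)}=0$.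 For $t>0$, $u_k^0(\cdot,t)\in H^2(\Omega)\subset C(\overline\Omega)$, so point values are those of the continuous representative. *)

theory Defs
  imports "HOL-Analysis.Analysis"
begin

section \<open>Scalar function spaces on a subset of the real line\<close>

text \<open>Elements of the spaces below are representatives, that is, total functions on the real
  line of which only the values in \<open>S\<close>, up to null sets, matter.\<close>

definition L2 :: "real set \<Rightarrow> (real \<Rightarrow> real) set" where
  "L2 S = {f \<in> borel_measurable (lebesgue_on S). integrable (lebesgue_on S) (\<lambda>x. (f x)\<^sup>2)}"

definition L2_inner :: "real set \<Rightarrow> (real \<Rightarrow> real) \<Rightarrow> (real \<Rightarrow> real) \<Rightarrow> real" where
  "L2_inner S f g = (LINT x|lebesgue_on S. f x * g x)"

definition L_infty :: "real set \<Rightarrow> (real \<Rightarrow> real) set" where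
  "L_infty S = {f \<in> borel_measurable (lebesgue_on S). \<exists>C. AE x in lebesgue_on S. \<bar>f x\<bar> \<le> C}"

definition mean_value :: "real set \<Rightarrow> (real \<Rightarrow> real) \<Rightarrow> real" where
  "mean_value S g = (LINT y|lebesgue_on S. g y) / measure lebesgue S"

definition hom_coeff :: "real set \<Rightarrow> (real \<Rightarrow> real) \<Rightarrow> real" where
  "hom_coeff S a = 1 / mean_value S (\<lambda>y. 1 / a y)"

text \<open>Smooth functions on the line whose support is a compact subset of \<open>S\<close>.\<close>

definition test_functions :: "real set \<Rightarrow> (real \<Rightarrow> real) set" where
  "test_functions S =
     {\<phi>. (\<forall>n. (deriv ^^ n) \<phi> differentiable_on UNIV) \<and>
         (\<exists>K. compact K \<and> K \<subseteq> S \<and> (\<forall>x. x \<notin> K \<longrightarrow> \<phi> x = 0))}"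

definition is_weak_deriv :: "real set \<Rightarrow> (real \<Rightarrow> real) \<Rightarrow> (real \<Rightarrow> real) \<Rightarrow> bool" where
  "is_weak_deriv S v w \<longleftrightarrow>
     (\<forall>\<phi>\<in>test_functions S. L2_inner S v (deriv \<phi>) = - L2_inner S w \<phi>)"

definition H1 :: "real set \<Rightarrow> (real \<Rightarrow> real) set" where
  "H1 S = {v \<in> L2 S. \<exists>w\<in>L2 S. is_weak_deriv S v w}"

text \<open>The weak derivative in \<open>L2 S\<close> of a function in \<open>H1 S\<close>; for open \<open>S\<close> it is determined
  almost everywhere on \<open>S\<close>.\<close>

definition wderiv :: "real set \<Rightarrow> (real \<Rightarrow> real) \<Rightarrow> (real \<Rightarrow> real)" where
  "wderiv S v = (SOME w. w \<in> L2 S \<and> is_weak_deriv S v w)"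

definition H1_norm :: "real set \<Rightarrow> (real \<Rightarrow> real) \<Rightarrow> real" where
  "H1_norm S v = sqrt (L2_inner S v v + L2_inner S (wderiv S v) (wderiv S v))"

definition H2 :: "real set \<Rightarrow> (real \<Rightarrow> real) set" where
  "H2 S = {v \<in> H1 S. wderiv S v \<in> H1 S}"

text \<open>\<open>H01 S\<close> is the closure of the test functions in \<open>H1 S\<close>.\<close>

definition H01 :: "real set \<Rightarrow> (real \<Rightarrow> real) set" where
  "H01 S = {v \<in> H1 S. \<exists>\<phi>. (\<forall>n. \<phi> n \<in> test_functions S) \<and>
                            (\<lambda>n. H1_norm S (\<lambda>x. \<phi> n x - v x)) \<longlonglongrightarrow> 0}"

text \<open>\<open>Hm1 S\<close> is the dual space of \<open>H01 S\<close>, with the dual norm. Only the values of a functional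
  on \<open>H01 S\<close> matter, and the duality pairing of \<open>F\<close> and \<open>\<Phi>\<close> is the application \<open>F \<Phi>\<close>.\<close>

definition Hm1 :: "real set \<Rightarrow> ((real \<Rightarrow> real) \<Rightarrow> real) set" where
  "Hm1 S = {F. (\<forall>\<Phi>\<in>H01 S. \<forall>\<Psi>\<in>H01 S. F (\<lambda>x. \<Phi> x + \<Psi> x) = F \<Phi> + F \<Psi>) \<and>
               (\<forall>\<Phi>\<in>H01 S. \<forall>c. F (\<lambda>x. c * \<Phi> x) = c * F \<Phi>) \<and>
               (\<exists>C. \<forall>\<Phi>\<in>H01 S. \<bar>F \<Phi>\<bar> \<le> C * H1_norm S \<Phi>)}"

definition Hm1_norm :: "real set \<Rightarrow> ((real \<Rightarrow> real) \<Rightarrow> real) \<Rightarrow> real" where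
  "Hm1_norm S F = (SUP \<Phi>\<in>{\<Phi> \<in> H01 S. H1_norm S \<Phi> \<le> 1}. \<bar>F \<Phi>\<bar>)"

text \<open>The value at \<open>x\<close> of the representative of \<open>v\<close> that is continuous on the closure of \<open>S\<close>.\<close>

definition point_value :: "real set \<Rightarrow> (real \<Rightarrow> real) \<Rightarrow> real \<Rightarrow> real" where
  "point_value S v x =
     (THE y. \<exists>g. continuous_on (closure S) g \<and> (AE z in lebesgue_on S. g z = v z) \<and> y = g x)"

section \<open>The Dirichlet Laplacian\<close>

definition eigenspace :: "real set \<Rightarrow> real \<Rightarrow> (real \<Rightarrow> real) set" where
  "eigenspace S lam =
     {v \<in> H2 S \<inter> H01 S. AE x in lebesgue_on S. - wderiv S (wderiv S v) x = lam * v x}"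

definition eigenvalues :: "real set \<Rightarrow> real set" where
  "eigenvalues S = {lam. \<exists>v\<in>eigenspace S lam. \<not> (AE x in lebesgue_on S. v x = 0)}"

text \<open>The \<open>L2 S\<close>-orthogonal projection onto the eigenspace, determined almost everywhere.\<close>

definition eigenprojection :: "real set \<Rightarrow> real \<Rightarrow> (real \<Rightarrow> real) \<Rightarrow> (real \<Rightarrow> real)" where
  "eigenprojection S lam v =
     (SOME w. w \<in> eigenspace S lam \<and>
              (\<forall>z\<in>eigenspace S lam. L2_inner S (\<lambda>x. v x - w x) z = 0))"

section \<open>Spaces of vector-valued functions of time\<close>

text \<open>In this section a Hilbert space is given by a set \<open>X\<close> of real-valued functions, with the
  pointwise vector operations, and a map \<open>N\<close> that is a seminorm on \<open>X\<close>, elements at distance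
  \<open>0\<close> being identified. It is used with \<open>H01 S\<close>, \<open>H1_norm S\<close> and with \<open>Hm1 S\<close>, \<open>Hm1_norm S\<close>.
  These depend on \<open>S\<close>, so the type-based Bochner integral of the library does not apply to them.\<close>

definition simple_into :: "'t measure \<Rightarrow> ('a \<Rightarrow> real) set \<Rightarrow> ('t \<Rightarrow> 'a \<Rightarrow> real) \<Rightarrow> bool" where
  "simple_into M X s \<longleftrightarrow> simple_function M s \<and> s ` space M \<subseteq> X"

definition strongly_measurable ::
    "'t measure \<Rightarrow> ('a \<Rightarrow> real) set \<Rightarrow> (('a \<Rightarrow> real) \<Rightarrow> real) \<Rightarrow> ('t \<Rightarrow> 'a \<Rightarrow> real) \<Rightarrow> bool" where
  "strongly_measurable M X N f \<longleftrightarrow>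
     (AE t in M. f t \<in> X) \<and>
     (\<exists>s. (\<forall>n. simple_into M X (s n)) \<and> (AE t in M. (\<lambda>n. N (f t - s n t)) \<longlonglongrightarrow> 0))"

text \<open>The Bochner integral for a finite measure \<open>M\<close>. For a simple function \<open>s\<close>, the function
  \<open>\<lambda>x. LINT t|M. s t x\<close> is the finite sum of its values weighted by the measures of their
  preimages.\<close>

definition has_bochner_integral_in ::
    "'t measure \<Rightarrow> ('a \<Rightarrow> real) set \<Rightarrow> (('a \<Rightarrow> real) \<Rightarrow> real) \<Rightarrow> ('t \<Rightarrow> 'a \<Rightarrow> real) \<Rightarrow>
     ('a \<Rightarrow> real) \<Rightarrow> bool" where
  "has_bochner_integral_in M X N f y \<longleftrightarrow>
     strongly_measurable M X N f \<and> y \<in> X \<and>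
     (\<exists>s. (\<forall>n. simple_into M X (s n)) \<and>
          (\<lambda>n. \<integral>\<^sup>+t. ennreal (N (f t - s n t)) \<partial>M) \<longlonglongrightarrow> 0 \<and>
          (\<lambda>n. N ((\<lambda>x. LINT t|M. s n t x) - y)) \<longlonglongrightarrow> 0)"

definition bochner_L2 ::
    "real \<Rightarrow> ('a \<Rightarrow> real) set \<Rightarrow> (('a \<Rightarrow> real) \<Rightarrow> real) \<Rightarrow> (real \<Rightarrow> 'a \<Rightarrow> real) set" where
  "bochner_L2 T X N =
     {v. strongly_measurable (lebesgue_on {0<..<T}) X N v \<and>
         integrable (lebesgue_on {0<..<T}) (\<lambda>t. (N (v t))\<^sup>2)}"

text \<open>The Sobolev--Slobodeckij space of order \<open>\<alpha>\<close>, for \<open>0 < \<alpha> < 1\<close>. The double integral is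
  iterated because a change of \<open>v\<close> on a Lebesgue null set may destroy measurability with respect
  to the product of the two Lebesgue algebras, which is not complete.\<close>

definition H_Slobodeckij ::
    "real \<Rightarrow> real \<Rightarrow> ('a \<Rightarrow> real) set \<Rightarrow> (('a \<Rightarrow> real) \<Rightarrow> real) \<Rightarrow> (real \<Rightarrow> 'a \<Rightarrow> real) set" where
  "H_Slobodeckij \<alpha> T X N =
     {v \<in> bochner_L2 T X N.
        (\<integral>\<^sup>+t. (\<integral>\<^sup>+s. ennreal ((N (v t - v s))\<^sup>2 / \<bar>t - s\<bar> powr (1 + 2 * \<alpha>))
                 \<partial>lebesgue_on {0<..<T}) \<partial>lebesgue_on {0<..<T}) < \<infinity>}"

text \<open>In the last case the value at \<open>0\<close> is that of the representative that is continuous on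
  \<open>{0..T}\<close> with values in \<open>X\<close>.\<close>

definition H_lower ::
    "real \<Rightarrow> real \<Rightarrow> ('a \<Rightarrow> real) set \<Rightarrow> (('a \<Rightarrow> real) \<Rightarrow> real) \<Rightarrow> (real \<Rightarrow> 'a \<Rightarrow> real) set" where
  "H_lower \<alpha> T X N =
     (if \<alpha> < 1 / 2 then H_Slobodeckij \<alpha> T X N
      else if \<alpha> = 1 / 2 then
        {v \<in> H_Slobodeckij \<alpha> T X N.
           (\<integral>\<^sup>+t. ennreal ((N (v t))\<^sup>2 / t) \<partial>lebesgue_on {0<..<T}) < \<infinity>}
      else
        {v \<in> H_Slobodeckij \<alpha> T X N.
           \<exists>g. (\<forall>t\<in>{0..T}. g t \<in> X \<and> ((\<lambda>s. N (g s - g t)) \<longlongrightarrow> 0) (at t within {0..T})) \<and>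
               (AE t in lebesgue_on {0<..<T}. N (v t - g t) = 0) \<and> N (g 0) = 0})"

text \<open>\<open>v = J\<^sup>\<beta> w\<close> on \<open>(0, T)\<close>, as an identity of functions defined almost everywhere.\<close>

definition has_frac_integral ::
    "real \<Rightarrow> real \<Rightarrow> ('a \<Rightarrow> real) set \<Rightarrow> (('a \<Rightarrow> real) \<Rightarrow> real) \<Rightarrow> (real \<Rightarrow> 'a \<Rightarrow> real) \<Rightarrow>
     (real \<Rightarrow> 'a \<Rightarrow> real) \<Rightarrow> bool" where
  "has_frac_integral \<beta> T X N w v \<longleftrightarrow>
     (AE t in lebesgue_on {0<..<T}.
        has_bochner_integral_in (lebesgue_on {0<..<t}) X N
          (\<lambda>s x. (1 / Gamma \<beta>) * (t - s) powr (\<beta> - 1) * w s x) (v t))"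

text \<open>The generalized Caputo derivative of order \<open>\<alpha>\<close> is the inverse of the isomorphism
  \<open>J\<^sup>\<alpha>\<close> from the square integrable functions onto \<open>H_lower\<close>: the derivative of \<open>v\<close> is the
  unique \<open>w\<close> with \<open>J\<^sup>\<alpha> w = v\<close>.\<close>

definition has_caputo_derivative ::
    "real \<Rightarrow> real \<Rightarrow> ('a \<Rightarrow> real) set \<Rightarrow> (('a \<Rightarrow> real) \<Rightarrow> real) \<Rightarrow> (real \<Rightarrow> 'a \<Rightarrow> real) \<Rightarrow>
     (real \<Rightarrow> 'a \<Rightarrow> real) \<Rightarrow> bool" where
  "has_caputo_derivative \<alpha> T X N v w \<longleftrightarrow>
     v \<in> H_lower \<alpha> T X N \<and> w \<in> bochner_L2 T X N \<and> has_frac_integral \<alpha> T X N w v"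

section \<open>Weak solutions\<close>

text \<open>Here \<open>u t\<close> is the spatial profile at time \<open>t\<close>. A function in \<open>L2 S\<close> is regarded as an
  element of \<open>Hm1 S\<close> through \<open>L2_inner S\<close>.\<close>

definition weak_solution ::
    "real \<Rightarrow> real \<Rightarrow> real set \<Rightarrow> real \<Rightarrow> (real \<Rightarrow> real) \<Rightarrow> (real \<Rightarrow> real \<Rightarrow> real) \<Rightarrow> bool" where
  "weak_solution \<alpha> T S a u0 u \<longleftrightarrow>
     u \<in> bochner_L2 T (H01 S) (H1_norm S) \<and>
     (\<exists>w. has_caputo_derivative \<alpha> T (Hm1 S) (Hm1_norm S)
            (\<lambda>t. L2_inner S (\<lambda>x. u t x - u0 x)) w \<and>
          (AE t in lebesgue_on {0<..<T}. \<forall>\<Phi>\<in>H01 S.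
             w t \<Phi> + a * L2_inner S (wderiv S (u t)) (wderiv S \<Phi>) = 0))"

end

theory Submission
  imports Defs "HOL-Complex_Analysis.Complex_Analysis"
begin

text \<open>Testing the equation with the Dirichlet eigenfunctions \<open>\<phi>\<^sub>n\<close> of \<open>\<Omega>\<close> gives
  \<open>u\<^sub>k\<^sup>0(x\<^sub>0, t) = F (a\<^sub>k\<^sup>0 t\<^sup>\<alpha>)\<close> with \<open>F z = \<Sum>n. b\<^sub>n E\<^sub>\<alpha>(- \<lambda>\<^sub>n z)\<close>, where \<open>E\<^sub>\<alpha>\<close> is the
  Mittag-Leffler function and \<open>b\<^sub>n\<close> is the value at \<open>x\<^sub>0\<close> of the projection of \<open>u\<^sub>0\<close>. If
  \<open>a\<^sub>2\<^sup>0 < a\<^sub>1\<^sup>0\<close>, then \<open>F z = F (r z)\<close> with \<open>r = a\<^sub>2\<^sup>0 / a\<^sub>1\<^sup>0 < 1\<close> for small \<open>z > 0\<close>, so \<open>F\<close> is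
  constant near 0 by continuity at 0. A maximum principle for the Caputo derivative bounds \<open>E\<^sub>\<alpha>(- z)\<close>
  by 1 on the right half-plane. Hence \<open>F\<close> is holomorphic and thus constant there. The Laplace transform
  turns this into the constancy of \<open>\<Sum>n. b\<^sub>n / (1 + \<lambda>\<^sub>n y)\<close>, which forces all \<open>b\<^sub>n\<close> to vanish. So the
  homogenized coefficients agree, and since \<open>1 / a\<^sub>1 \<le> 1 / a\<^sub>2\<close> have the same mean, \<open>a\<^sub>1 = a\<^sub>2\<close> almost
  everywhere.\<close>

section \<open>The Mittag-Leffler function\<close>

text \<open>The obstacle is that \<open>F\<close> is in general not analytic at 0: the
  \<open>\<lambda>\<^sub>n\<close> are unbounded, so the double series cannot be rearranged by
  powers of \<open>z\<close>, and constancy near 0 cannot be read off Taylor coefficients. What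
  remains is continuity on the closed and holomorphy on the open right half-plane, both by the
  Weierstrass M-test with the majorants \<open>\<bar>b\<^sub>n\<bar>\<close>. A bound of the
  Mittag-Leffler function on the real axis alone would not give holomorphy, so the maximum principle
  is run for complex values. Summability of the \<open>b\<^sub>n\<close> is where the regularity and
  the boundary values of \<open>u0\<close> enter: the sine coefficients of \<open>u0\<close> decay
  like the inverse square of the index. The weak equation is an almost everywhere identity between
  functions of time with values in \<open>Hm1\<close>; evaluating all functionals at one fixed
  eigenfunction reduces it to a scalar Volterra equation, whose uniqueness is an exponentially
  weighted integral estimate.\<close>

definition mittag_leffler :: "real \<Rightarrow> 'a \<Rightarrow> 'a::{real_normed_field,banach}" where
  "mittag_leffler \<alpha> z = (\<Sum>k. z ^ k /\<^sub>R Gamma (\<alpha> * real k + 1))"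

lemma has_bochner_integral_lebesgue_on_nonneg:
  fixes f :: "real \<Rightarrow> real"
  assumes "(f has_integral I) S" "\<And>x. x \<in> S \<Longrightarrow> 0 \<le> f x" "S \<in> sets lebesgue"
  shows "has_bochner_integral (lebesgue_on S) f I"
proof -
  have "f absolutely_integrable_on S"
    using assms by (intro nonnegative_absolutely_integrable_1) auto
  then have i: "integrable (lebesgue_on S) f"
    using assms(3) by (rule absolutely_integrable_imp_integrable)
  then have "integral\<^sup>L (lebesgue_on S) f = integral S f"
    using assms(3) by (rule lebesgue_integral_eq_integral)
  then show ?thesis
    using i assms(1) by (simp add: has_bochner_integral_iff integral_unique)
qed

text \<open>From \<open>R\<close> on, the Gamma integrand is at least
  \<open>R powr x * exp (- t)\<close>. Since \<open>R\<close> is free, \<open>Gamma\<close> outgrows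
  every geometric rate, so the Mittag-Leffler series converges everywhere.\<close>

lemma Gamma_ge_powr:
  assumes "R > 0" "x \<ge> (0::real)"
  shows "R powr x * exp (- R) \<le> Gamma (x + 1)"
proof -
  have 1: "((\<lambda>t. t powr x / exp t) has_integral Gamma (x + 1)) {0..}"
    using Gamma_integral_real[of "x + 1"] assms by simp
  have 2: "((\<lambda>t. R powr x * exp (- 1 * t)) has_integral R powr x * (exp (- 1 * R) / 1)) {R..}"
    by (rule has_integral_mult_right[OF has_integral_exp_minus_to_infinity]) simp
  have "R powr x * (exp (- 1 * R) / 1) \<le> Gamma (x + 1)"
    by (rule has_integral_le[OF has_integral_restrict_UNIV[THEN iffD2, OF 2]
          has_integral_restrict_UNIV[THEN iffD2, OF 1]])
       (use assms in \<open>auto simp: exp_minus divide_inverse powr_mono2 intro!: mult_right_mono\<close>)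
  then show ?thesis by simp
qed

lemma Gamma_mult_nat_pos:
  assumes "\<alpha> > 0"
  shows "Gamma (\<alpha> * real k + 1) > 0"
  using assms by (intro Gamma_real_pos add_nonneg_pos) auto

lemma powr_mult_of_nat:
  assumes "s > (0::real)"
  shows "s powr (\<alpha> * real k) = (s powr \<alpha>) ^ k"
proof -
  have "s powr (\<alpha> * real k) = (s powr \<alpha>) powr real k" by (simp add: powr_powr)
  also have "\<dots> = (s powr \<alpha>) ^ k" by (rule powr_realpow) (use assms in simp)
  finally show ?thesis .
qed

lemma summable_mittag_leffler:
  assumes "\<alpha> > 0" "r \<ge> 0"
  shows "summable (\<lambda>k. r ^ k / Gamma (\<alpha> * real k + 1))"
proof -
  \<comment> \<open>\<open>R powr \<alpha> = 2 * r + 1\<close> bounds the terms by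
    \<open>exp R * (r / (2 * r + 1)) ^ k\<close>, a geometric decay of ratio at most 1/2; the
    summand 1 keeps \<open>R\<close> positive for \<open>r = 0\<close>.\<close>
  define R where "R = (2 * r + 1) powr (1 / \<alpha>)"
  have R: "R > 0" "R powr \<alpha> = 2 * r + 1"
    using assms by (auto simp: R_def powr_powr)
  have bound: "norm (r ^ k / Gamma (\<alpha> * real k + 1)) \<le> exp R * (1 / 2) ^ k" for k
  proof -
    have G: "(2 * r + 1) ^ k * exp (- R) \<le> Gamma (\<alpha> * real k + 1)"
      using Gamma_ge_powr[OF R(1), of "\<alpha> * real k"] assms R(2)
      by (simp add: powr_powr[symmetric] powr_realpow)
    have "r ^ k / Gamma (\<alpha> * real k + 1) \<le> r ^ k / ((2 * r + 1) ^ k * exp (- R))"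
      using assms by (intro divide_left_mono[OF G]) (auto intro!: mult_pos_pos Gamma_mult_nat_pos)
    also have "\<dots> = exp R * (r / (2 * r + 1)) ^ k"
      by (simp add: exp_minus power_divide field_simps)
    also have "\<dots> \<le> exp R * (1 / 2) ^ k"
      using assms by (intro mult_left_mono power_mono) (auto simp: field_simps)
    finally show ?thesis
      using assms Gamma_mult_nat_pos[OF assms(1), of k] by (simp add: less_imp_le)
  qed
  have "summable (\<lambda>k. exp R * (1 / 2) ^ k)"
    by (rule summable_mult[OF summable_geometric]) simp
  then show ?thesis
    by (rule summable_comparison_test'[where N = 0]) (rule bound)
qed

lemma summable_norm_mittag_leffler:
  fixes z :: "'a::{real_normed_field,banach}"
  assumes "\<alpha> > 0"
  shows "summable (\<lambda>k. norm (z ^ k /\<^sub>R Gamma (\<alpha> * real k + 1)))"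
proof -
  have "norm (z ^ k /\<^sub>R Gamma (\<alpha> * real k + 1)) = norm z ^ k / Gamma (\<alpha> * real k + 1)" for k
    using Gamma_mult_nat_pos[OF assms, of k] by (simp add: norm_power divide_inverse)
  then show ?thesis
    using summable_mittag_leffler[OF assms norm_ge_zero, of z] by (simp only:)
qed

lemma mittag_leffler_sums:
  fixes z :: "'a::{real_normed_field,banach}"
  assumes "\<alpha> > 0"
  shows "(\<lambda>k. z ^ k /\<^sub>R Gamma (\<alpha> * real k + 1)) sums mittag_leffler \<alpha> z"
  unfolding mittag_leffler_def
  by (rule summable_sums[OF summable_norm_cancel[OF summable_norm_mittag_leffler[OF assms]]])

lemma mittag_leffler_of_real:
  assumes "\<alpha> > 0"
  shows "mittag_leffler \<alpha> (of_real x :: 'a::{real_normed_field,banach}) = of_real (mittag_leffler \<alpha> x)"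
proof -
  have "(\<lambda>k. of_real (x ^ k /\<^sub>R Gamma (\<alpha> * real k + 1)) :: 'a) sums of_real (mittag_leffler \<alpha> x)"
    by (intro sums_of_real mittag_leffler_sums assms)
  then show ?thesis
    using mittag_leffler_sums[OF assms, of "of_real x :: 'a"]
    by (intro sums_unique2[of _ "mittag_leffler \<alpha> (of_real x :: 'a)"]) (auto simp: scaleR_conv_of_real)
qed

lemma mittag_leffler_0 [simp]: "mittag_leffler \<alpha> 0 = 1"
proof -
  have "mittag_leffler \<alpha> (0::'a) = (\<Sum>k. if k = 0 then 1 else 0)"
    unfolding mittag_leffler_def by (intro suminf_cong) (auto simp: Gamma_1)
  also have "\<dots> = 1"
    using sums_single[of 0 "\<lambda>_. 1 :: 'a"] by (rule sums_unique[symmetric])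
  finally show ?thesis .
qed

lemma holomorphic_mittag_leffler:
  assumes "\<alpha> > 0"
  shows "mittag_leffler \<alpha> holomorphic_on A"
proof -
  have "mittag_leffler \<alpha> holomorphic_on ball 0 (norm z + 1)" for z :: complex
    by (rule power_series_holomorphic[where a = "\<lambda>k. complex_of_real (1 / Gamma (\<alpha> * real k + 1))"])
       (use mittag_leffler_sums[OF assms] in \<open>auto simp: scaleR_conv_of_real divide_inverse\<close>)
  then have "mittag_leffler \<alpha> field_differentiable (at z)" for z :: complex
    by (rule holomorphic_on_imp_differentiable_at[of _ "ball 0 (norm z + 1)"]) auto
  then show ?thesis
    by (auto simp: holomorphic_on_def field_differentiable_at_within)
qed

lemma continuous_on_mittag_leffler_complex:
  fixes f :: "'b::topological_space \<Rightarrow> complex"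
  assumes "\<alpha> > 0" "continuous_on A f"
  shows "continuous_on A (\<lambda>x. mittag_leffler \<alpha> (f x))"
  using continuous_on_compose2[OF holomorphic_on_imp_continuous_on[OF holomorphic_mittag_leffler[OF assms(1), of UNIV]] assms(2)]
  by auto

lemma continuous_on_mittag_leffler:
  fixes f :: "'b::topological_space \<Rightarrow> real"
  assumes "\<alpha> > 0" "continuous_on A f"
  shows "continuous_on A (\<lambda>x. mittag_leffler \<alpha> (f x))"
proof -
  have "continuous_on A (\<lambda>x. Re (mittag_leffler \<alpha> (of_real (f x))))"
    by (intro continuous_on_Re continuous_on_mittag_leffler_complex continuous_on_of_real assms)
  then show ?thesis using assms by (simp add: mittag_leffler_of_real)
qed

section \<open>Riemann-Liouville integrals and the Volterra equation\<close>

lemma has_integral_frac_kernel: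
  fixes t a b :: real
  assumes "t > 0" "a > 0" "b > 0"
  shows "((\<lambda>s. s powr (a - 1) * (t - s) powr (b - 1)) has_integral Beta a b * t powr (a + b - 1)) {0<..<t}"
proof -
  have "((\<lambda>s. (s / t) powr (a - 1) * (1 - s / t) powr (b - 1)) has_integral t * Beta a b) ((*) t ` {0..1})"
    using has_integral_stretch_real[OF has_integral_Beta_real[OF assms(2,3)], of "1 / t"] assms
    by (simp add: field_simps image_image)
  then have "((\<lambda>s. t powr (a + b - 2) * ((s / t) powr (a - 1) * (1 - s / t) powr (b - 1))) has_integral t powr (a + b - 2) * (t * Beta a b)) {0..t}"
    using assms by (intro has_integral_mult_right[where c = "t powr (a + b - 2)"]) (simp add: image_mult_atLeastAtMost)
  then have *: "((\<lambda>s. t powr (a + b - 2) * ((s / t) powr (a - 1) * (1 - s / t) powr (b - 1))) has_integral t powr (a + b - 2) * (t * Beta a b)) {0<..<t}"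
    by (simp add: has_integral_Icc_iff_Ioo)
  have **: "t powr (a + b - 2) * (t * Beta a b) = Beta a b * t powr (a + b - 1)"
    using assms powr_add[of t "a + b - 2" 1] by simp
  have "t powr (a + b - 2) * ((s / t) powr (a - 1) * (1 - s / t) powr (b - 1)) = s powr (a - 1) * (t - s) powr (b - 1)"
    if "s \<in> {0<..<t}" for s
  proof -
    have "1 - s / t = (t - s) / t" using assms by (simp add: field_simps)
    moreover have "t powr (a + b - 2) = t powr (a - 1) * t powr (b - 1)"
      by (simp add: powr_add[symmetric] add.commute)
    ultimately show ?thesis
      using that assms by (simp add: powr_divide)
  qed
  then show ?thesis
    using * unfolding ** by (rule has_integral_eq)
qed

text \<open>The Riemann--Liouville integral of order \<open>\<alpha>\<close> acts on the monomials \<open>s powr (\<alpha> * k)\<close> as an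
  index shift, up to the Gamma weights.\<close>

lemma mittag_leffler_volterra:
  fixes y t :: real
  assumes \<alpha>: "\<alpha> > 0" and t: "t > 0"
  shows "integrable (lebesgue_on {0<..<t}) (\<lambda>s. (t - s) powr (\<alpha> - 1) * mittag_leffler \<alpha> (- y * s powr \<alpha>))"
    and "y * (LINT s|lebesgue_on {0<..<t}. (t - s) powr (\<alpha> - 1) * mittag_leffler \<alpha> (- y * s powr \<alpha>))
           = Gamma \<alpha> * (1 - mittag_leffler \<alpha> (- y * t powr \<alpha>))"
proof -
  let ?M = "lebesgue_on {0<..<t}"
  define f where "f k s = (- y) ^ k / Gamma (\<alpha> * real k + 1) * (s powr (\<alpha> * real k) * (t - s) powr (\<alpha> - 1))" for k s
  \<comment> \<open>The Beta integral of the \<open>k\<close>-th monomial is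
    \<open>Gamma (\<alpha> * real k + 1) * c k\<close>, and the Gamma factor cancels against the
    weight in \<open>f\<close>.\<close>
  define c where "c k = Gamma \<alpha> * t powr (\<alpha> * real (Suc k)) / Gamma (\<alpha> * real (Suc k) + 1)" for k
  have B: "has_bochner_integral ?M (\<lambda>s. s powr (\<alpha> * real k) * (t - s) powr (\<alpha> - 1)) (Gamma (\<alpha> * real k + 1) * c k)" for k
  proof -
    have "((\<lambda>s. s powr (\<alpha> * real k + 1 - 1) * (t - s) powr (\<alpha> - 1)) has_integral Beta (\<alpha> * real k + 1) \<alpha> * t powr (\<alpha> * real k + 1 + \<alpha> - 1)) {0<..<t}"
      by (rule has_integral_frac_kernel) (use \<alpha> t in \<open>auto intro: add_nonneg_pos\<close>)
    then have "((\<lambda>s. s powr (\<alpha> * real k) * (t - s) powr (\<alpha> - 1)) has_integral (Gamma (\<alpha> * real k + 1) * c k)) {0<..<t}"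
      by (simp add: Beta_def c_def algebra_simps)
    then show ?thesis by (rule has_bochner_integral_lebesgue_on_nonneg) auto
  qed
  have fi: "has_bochner_integral ?M (f k) ((- y) ^ k * c k)" for k
  proof -
    have "Gamma (\<alpha> * real k + 1) > 0" using \<alpha> by (rule Gamma_mult_nat_pos)
    then show ?thesis
      using has_bochner_integral_mult_right[OF B, of "(- y) ^ k / Gamma (\<alpha> * real k + 1)" k]
      unfolding f_def by simp
  qed
  have fa: "has_bochner_integral ?M (\<lambda>s. norm (f k s)) (\<bar>y\<bar> ^ k * c k)" for k
  proof -
    have G: "Gamma (\<alpha> * real k + 1) > 0" using \<alpha> by (rule Gamma_mult_nat_pos)
    then have "norm (f k s) = \<bar>y\<bar> ^ k / Gamma (\<alpha> * real k + 1) * (s powr (\<alpha> * real k) * (t - s) powr (\<alpha> - 1))" for s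
      by (simp add: f_def abs_mult power_abs[symmetric])
    then show ?thesis
      using has_bochner_integral_mult_right[OF B, of "\<bar>y\<bar> ^ k / Gamma (\<alpha> * real k + 1)" k] G by simp
  qed
  have E: "(\<lambda>k. f k s) sums ((t - s) powr (\<alpha> - 1) * mittag_leffler \<alpha> (- y * s powr \<alpha>))"
    "summable (\<lambda>k. norm (f k s))" if "s > 0" for s
  proof -
    have e: "f k s = (t - s) powr (\<alpha> - 1) * ((- y * s powr \<alpha>) ^ k /\<^sub>R Gamma (\<alpha> * real k + 1))" for k
      unfolding f_def power_mult_distrib[of "- y"] powr_mult_of_nat[OF that]
      by (simp add: divide_inverse)
    show "(\<lambda>k. f k s) sums ((t - s) powr (\<alpha> - 1) * mittag_leffler \<alpha> (- y * s powr \<alpha>))"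
      unfolding e by (rule sums_mult[OF mittag_leffler_sums[OF \<alpha>]])
    show "summable (\<lambda>k. norm (f k s))"
      unfolding e norm_mult by (rule summable_mult[OF summable_norm_mittag_leffler[OF \<alpha>]])
  qed
  \<comment> \<open>The two parameters serve two purposes: \<open>x = - y\<close> gives the identity
    itself, and first factor 1 gives summability, which is needed at
    \<open>x = \<bar>y\<bar>\<close> for the norms.\<close>
  have sc: "(\<lambda>k. y * (x ^ k * c k)) sums (Gamma \<alpha> * (y / x) * (mittag_leffler \<alpha> (x * t powr \<alpha>) - 1))"
    if "x \<noteq> 0" for x y
  proof -
    have "(\<lambda>k. (x * t powr \<alpha>) ^ Suc k /\<^sub>R Gamma (\<alpha> * real (Suc k) + 1)) sums (mittag_leffler \<alpha> (x * t powr \<alpha>) - 1)"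
      using mittag_leffler_sums[OF \<alpha>, of "x * t powr \<alpha>"] by (subst sums_Suc_iff) (simp add: Gamma_1)
    then have "(\<lambda>k. Gamma \<alpha> * (y / x) * ((x * t powr \<alpha>) ^ Suc k /\<^sub>R Gamma (\<alpha> * real (Suc k) + 1))) sums (Gamma \<alpha> * (y / x) * (mittag_leffler \<alpha> (x * t powr \<alpha>) - 1))"
      by (rule sums_mult)
    moreover have "Gamma \<alpha> * (y / x) * ((x * t powr \<alpha>) ^ Suc k /\<^sub>R Gamma (\<alpha> * real (Suc k) + 1)) = y * (x ^ k * c k)" for k
    proof -
      have "t powr (\<alpha> * real (Suc k)) = (t powr \<alpha>) ^ Suc k"
        by (rule powr_mult_of_nat[OF t])
      then have "c k = Gamma \<alpha> * (t powr \<alpha>) ^ Suc k / Gamma (\<alpha> * real (Suc k) + 1)"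
        unfolding c_def by (rule arg_cong)
      moreover have "(x * t powr \<alpha>) ^ Suc k = x * x ^ k * (t powr \<alpha>) ^ Suc k"
        by (simp add: power_mult_distrib)
      ultimately show ?thesis using that by (simp only: real_scaleR_def) (simp add: divide_inverse)
    qed
    ultimately show ?thesis by simp
  qed
  have sa: "summable (\<lambda>k. x ^ k * c k)" for x :: real
  proof (cases "x = 0")
    case True
    then show ?thesis by (intro summable_finite[of "{0}"]) (auto simp: power_0_left)
  next
    case False
    then show ?thesis using sums_summable[OF sc[OF False, of 1]] by simp
  qed
  have *: "integrable ?M (\<lambda>s. \<Sum>k. f k s)" "(\<lambda>k. integral\<^sup>L ?M (f k)) sums (LINT s|?M. (\<Sum>k. f k s))"
    by (rule integrable_suminf sums_integral; use fi fa sa[of "\<bar>y\<bar>"] E(2) in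
        \<open>auto simp: has_bochner_integral_iff intro!: AE_I2\<close>)+
  have eq: "(\<Sum>k. f k s) = (t - s) powr (\<alpha> - 1) * mittag_leffler \<alpha> (- y * s powr \<alpha>)" if "s \<in> space ?M" for s
    using E(1)[of s] that by (auto simp: sums_iff)
  show "integrable ?M (\<lambda>s. (t - s) powr (\<alpha> - 1) * mittag_leffler \<alpha> (- y * s powr \<alpha>))"
    using *(1) by (subst Bochner_Integration.integrable_cong[OF refl eq[symmetric]]) auto
  have ik: "integral\<^sup>L ?M (f k) = (- y) ^ k * c k" for k
    using fi[of k] by (simp add: has_bochner_integral_iff)
  have s1: "(\<lambda>k. y * ((- y) ^ k * c k)) sums (y * (LINT s|?M. (t - s) powr (\<alpha> - 1) * mittag_leffler \<alpha> (- y * s powr \<alpha>)))"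
  proof (rule sums_mult)
    have "(LINT s|?M. (\<Sum>k. f k s)) = (LINT s|?M. (t - s) powr (\<alpha> - 1) * mittag_leffler \<alpha> (- y * s powr \<alpha>))"
      by (rule Bochner_Integration.integral_cong) (use eq in auto)
    then show "(\<lambda>k. (- y) ^ k * c k) sums (LINT s|?M. (t - s) powr (\<alpha> - 1) * mittag_leffler \<alpha> (- y * s powr \<alpha>))"
      using *(2) ik by simp
  qed
  show "y * (LINT s|?M. (t - s) powr (\<alpha> - 1) * mittag_leffler \<alpha> (- y * s powr \<alpha>))
           = Gamma \<alpha> * (1 - mittag_leffler \<alpha> (- y * t powr \<alpha>))"
  proof (cases "y = 0")
    case False
    then show ?thesis
      using sums_unique2[OF s1 sc[of "- y"]] by (simp add: algebra_simps)
  qed simp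
qed

section \<open>Caputo derivative at time 1 and the maximum principle\<close>

lemma one_minus_powr_bounds:
  fixes s b :: real
  assumes "0 < s" "s \<le> 1" "b \<ge> 0"
  shows "0 \<le> 1 - s powr b" and "1 - s powr b \<le> (1 + b) * (1 - s)"
proof -
  show "0 \<le> 1 - s powr b" using assms powr_le1[of b s] by simp
  \<comment> \<open>Rounding the exponent up makes Bernoulli's inequality applicable. The linear
    decay in \<open>1 - s\<close> later beats the singular factor
    \<open>(1 - s) powr (- \<alpha>)\<close>.\<close>
  define n where "n = nat \<lceil>b\<rceil>"
  have n: "b \<le> real n" "real n \<le> b + 1"
    using assms by (auto simp: n_def)
  have "1 + real n * (s - 1) \<le> (1 + (s - 1)) ^ n"
    using assms by (intro Bernoulli_inequality) auto
  also have "\<dots> = s powr real n" using assms by (simp add: powr_realpow)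
  also have "\<dots> \<le> s powr b" using assms n by (intro powr_mono') auto
  finally have "1 - s powr b \<le> real n * (1 - s)" by (simp add: algebra_simps)
  also have "\<dots> \<le> (1 + b) * (1 - s)" using assms n by (intro mult_right_mono) auto
  finally show "1 - s powr b \<le> (1 + b) * (1 - s)" .
qed

text \<open>Up to the factor \<open>1 / \<Gamma>(1 - \<alpha>)\<close>, the map \<open>g \<mapsto> g 1 - g 0 + \<alpha> \<integral>\<^sub>0\<^sup>1 (g 1 - g s) (1 - s) powr (- \<alpha> - 1) ds\<close>
  is the Caputo derivative at time 1 after an integration by parts. This form exhibits its sign when
  \<open>g\<close> is maximal at 1.\<close>

lemma has_bochner_integral_caputo_powr:
  fixes \<alpha> \<beta> :: real
  assumes \<alpha>: "0 < \<alpha>" "\<alpha> < 1" and \<beta>: "\<beta> > 0"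
  shows "has_bochner_integral (lebesgue_on {0<..<1}) (\<lambda>s. (1 - s powr \<beta>) * (1 - s) powr (- \<alpha> - 1))
           ((\<beta> * Beta \<beta> (1 - \<alpha>) - 1) / \<alpha>)"
proof -
  \<comment> \<open>The boundary term of an integration by parts: \<open>G'\<close> is
    \<open>\<alpha>\<close> times the wanted integrand minus a Beta integrand, and \<open>G\<close>
    falls from 1 at 0 to 0 at 1.\<close>
  define G where "G s = (1 - s powr \<beta>) * (1 - s) powr (- \<alpha>)" for s :: real
  define G' where "G' s = \<alpha> * ((1 - s powr \<beta>) * (1 - s) powr (- \<alpha> - 1)) - \<beta> * (s powr (\<beta> - 1) * (1 - s) powr (1 - \<alpha> - 1))" for s :: real
  have cont: "continuous_on {0..1} G"
  proof -
    have "(G \<longlongrightarrow> G x) (at x within {0..1})" if x: "x \<in> {0..1}" for x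
    proof (cases "x = 1")
      case True
      have "((\<lambda>s. (1 + \<beta>) * (1 - s) powr (1 - \<alpha>)) \<longlongrightarrow> (1 + \<beta>) * (1 - x) powr (1 - \<alpha>)) (at x within {0..1})"
        using \<alpha> True by (intro tendsto_intros tendsto_powr') (auto simp: eventually_at_filter)
      then have "((\<lambda>s. (1 + \<beta>) * (1 - s) powr (1 - \<alpha>)) \<longlongrightarrow> 0) (at x within {0..1})"
        using True by simp
      moreover have "\<forall>\<^sub>F s in at x within {0..1}. norm (G s) \<le> (1 + \<beta>) * (1 - s) powr (1 - \<alpha>)"
      proof -
        have "\<forall>\<^sub>F s in at x within {0..1}. s > 1/2 \<and> s \<in> {0..1} \<and> s \<noteq> x"
          unfolding eventually_at using True by (intro exI[of _ "1/4"]) (auto simp: dist_real_def)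
        then show ?thesis
        proof eventually_elim
          case (elim s)
          then have s: "0 < s" "s < 1" using True by auto
          have "\<bar>G s\<bar> \<le> (1 + \<beta>) * (1 - s) * (1 - s) powr (- \<alpha>)"
            using one_minus_powr_bounds[of s \<beta>] s \<beta> by (auto simp: G_def abs_mult intro!: mult_right_mono)
          also have "\<dots> = (1 + \<beta>) * (1 - s) powr (1 - \<alpha>)"
            using s powr_add[of "1 - s" 1 "- \<alpha>"] by simp
          finally show ?case by simp
        qed
      qed
      ultimately have "(G \<longlongrightarrow> 0) (at x within {0..1})" by (rule Lim_null_comparison[rotated])
      then show ?thesis using True by (simp add: G_def)
    next
      case False
      then show ?thesis unfolding G_def using x \<beta>
        by (intro tendsto_intros tendsto_powr') (auto simp: eventually_at_filter)
    qed
    then show ?thesis by (simp add: continuous_on)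
  qed
  have deriv: "(G has_vector_derivative G' x) (at x)" if "x \<in> {0<..<1}" for x
  proof -
    have "((\<lambda>s. 1 - s) has_real_derivative -1) (at x)" by (auto intro!: derivative_eq_intros)
    from DERIV_fun_powr[OF this, of "- \<alpha>"] that
    have "((\<lambda>s. (1 - s) powr (- \<alpha>)) has_real_derivative \<alpha> * (1 - x) powr (- \<alpha> - 1)) (at x)" by simp
    moreover have "((\<lambda>s. 1 - s powr \<beta>) has_real_derivative - (\<beta> * x powr (\<beta> - 1))) (at x)"
      using that by (auto intro!: derivative_eq_intros)
    ultimately have "((\<lambda>s. (1 - s powr \<beta>) * (1 - s) powr (- \<alpha>)) has_real_derivative
        - (\<beta> * x powr (\<beta> - 1)) * (1 - x) powr (- \<alpha>) + \<alpha> * (1 - x) powr (- \<alpha> - 1) * (1 - x powr \<beta>)) (at x)"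
      by (rule DERIV_mult[rotated])
    then have "(G has_real_derivative G' x) (at x)"
      unfolding G_def[abs_def] by (simp add: G'_def algebra_simps)
    then show ?thesis by (simp add: has_real_derivative_iff_has_vector_derivative)
  qed
  have "(G' has_integral G 1 - G 0) {0..1}"
    by (rule fundamental_theorem_of_calculus_interior) (use cont deriv in auto)
  moreover have "G 1 - G 0 = -1" using \<beta> by (simp add: G_def)
  ultimately have 1: "(G' has_integral -1) {0<..<1}" by (simp add: has_integral_Icc_iff_Ioo)
  have 2: "((\<lambda>s. \<beta> * (s powr (\<beta> - 1) * (1 - s) powr (1 - \<alpha> - 1))) has_integral \<beta> * Beta \<beta> (1 - \<alpha>)) {0<..<1}"
    using has_integral_mult_right[OF has_integral_frac_kernel[of 1 \<beta> "1 - \<alpha>"], of \<beta>] \<alpha> \<beta> by simp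
  have "((\<lambda>s. (G' s + \<beta> * (s powr (\<beta> - 1) * (1 - s) powr (1 - \<alpha> - 1))) / \<alpha>) has_integral (-1 + \<beta> * Beta \<beta> (1 - \<alpha>)) / \<alpha>) {0<..<1}"
    by (rule has_integral_divide[OF has_integral_add[OF 1 2]])
  then have "((\<lambda>s. (1 - s powr \<beta>) * (1 - s) powr (- \<alpha> - 1)) has_integral (\<beta> * Beta \<beta> (1 - \<alpha>) - 1) / \<alpha>) {0<..<1}"
    using \<alpha> by (simp add: G'_def)
  then show ?thesis
    by (rule has_bochner_integral_lebesgue_on_nonneg)
       (use one_minus_powr_bounds(1) \<beta> in \<open>auto intro!: mult_nonneg_nonneg\<close>)
qed

text \<open>This is the fractional relaxation equation with rate \<open>z\<close> at time 1, in the
  integrated form above. It holds term by term: the derivative lowers the exponent by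
  \<open>\<alpha>\<close> and exchanges the Gamma weights, which shifts the series. Other times are
  reached by rescaling \<open>z\<close>.\<close>

lemma mittag_leffler_caputo_at_1:
  fixes z :: complex
  assumes \<alpha>: "0 < \<alpha>" "\<alpha> < 1"
  defines "g \<equiv> \<lambda>s::real. mittag_leffler \<alpha> (- z * of_real (s powr \<alpha>))"
  shows "integrable (lebesgue_on {0<..<1}) (\<lambda>s. of_real ((1 - s) powr (- \<alpha> - 1)) * (g 1 - g s))"
    and "(g 1 - 1) + of_real \<alpha> * (LINT s|lebesgue_on {0<..<1}. of_real ((1 - s) powr (- \<alpha> - 1)) * (g 1 - g s))
           = - of_real (Gamma (1 - \<alpha>)) * z * g 1"
proof -
  let ?M = "lebesgue_on {0<..<1::real}"
  \<comment> \<open>The constant term cancels in \<open>g 1 - g s\<close>, hence the shift to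
    \<open>Suc k\<close>.\<close>
  define a where "a k = (- z) ^ Suc k /\<^sub>R Gamma (\<alpha> * real (Suc k) + 1)" for k
  define h where "h k s = (1 - s powr (\<alpha> * real (Suc k))) * (1 - s) powr (- \<alpha> - 1)" for k and s :: real
  \<comment> \<open>\<open>Gamma (1 - \<alpha>)\<close> times the Caputo derivative at time 1 of
    \<open>s powr (\<alpha> * real (Suc k))\<close>.\<close>
  define d where "d k = (\<alpha> * real (Suc k)) * Beta (\<alpha> * real (Suc k)) (1 - \<alpha>)" for k
  have h: "has_bochner_integral ?M (h k) ((d k - 1) / \<alpha>)" for k
    unfolding h_def d_def by (rule has_bochner_integral_caputo_powr) (use \<alpha> in auto)
  have hpos: "h k s \<ge> 0" if "0 < s" "s < 1" for k s
    using one_minus_powr_bounds(1)[of s "\<alpha> * real (Suc k)"] that \<alpha> by (simp add: h_def)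
  have d: "d k = Gamma (\<alpha> * real (Suc k) + 1) * Gamma (1 - \<alpha>) / Gamma (\<alpha> * real k + 1)" for k
  proof -
    have "\<alpha> * real (Suc k) > 0" using \<alpha> by simp
    then have "Gamma (\<alpha> * real (Suc k) + 1) = \<alpha> * real (Suc k) * Gamma (\<alpha> * real (Suc k))"
      by (subst Gamma_plus1) (auto elim!: nonpos_Ints_cases)
    moreover have "\<alpha> * real (Suc k) + (1 - \<alpha>) = \<alpha> * real k + 1" by (simp add: algebra_simps)
    ultimately show ?thesis by (simp only: d_def Beta_def) simp
  qed
  have ad: "norm w ^ Suc k / Gamma (\<alpha> * real (Suc k) + 1) * d k = Gamma (1 - \<alpha>) * norm w * (norm w ^ k / Gamma (\<alpha> * real k + 1))"
    for k and w :: complex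
    using Gamma_mult_nat_pos[OF \<alpha>(1), of "Suc k"] unfolding d by simp
  have na: "norm (a k) = norm z ^ Suc k / Gamma (\<alpha> * real (Suc k) + 1)" for k
    using Gamma_mult_nat_pos[OF \<alpha>(1), of "Suc k"] unfolding a_def norm_scaleR norm_power norm_minus_cancel
    by (simp add: divide_inverse mult.commute)
  have sna: "summable (\<lambda>k. norm (a k))"
    using summable_norm_mittag_leffler[OF \<alpha>(1), of "- z"] unfolding a_def
    by (subst (asm) summable_Suc_iff[symmetric]) simp
  have snd: "summable (\<lambda>k. norm (a k) * d k)"
    unfolding na ad by (rule summable_mult[OF summable_mittag_leffler]) (use \<alpha> in auto)
  have fi: "has_bochner_integral ?M (\<lambda>s. a k * of_real (h k s)) (a k * of_real ((d k - 1) / \<alpha>))" for k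
    by (intro has_bochner_integral_mult_right has_bochner_integral_of_real h)
  have fa: "has_bochner_integral ?M (\<lambda>s. norm (a k * of_real (h k s))) (norm (a k) * ((d k - 1) / \<alpha>))" for k
  proof -
    have "has_bochner_integral ?M (\<lambda>s. norm (a k) * h k s) (norm (a k) * ((d k - 1) / \<alpha>))"
      by (intro has_bochner_integral_mult_right h)
    then show ?thesis
      by (rule has_bochner_integral_cong[THEN iffD1, rotated 3])
         (use hpos in \<open>auto simp: norm_mult\<close>)
  qed
  have E: "(\<lambda>k. a k * of_real (h k s)) sums (of_real ((1 - s) powr (- \<alpha> - 1)) * (g 1 - g s))"
    if s: "0 < s" for s
  proof -
    have 1: "(\<lambda>k. a k) sums (g 1 - 1)"
      using mittag_leffler_sums[OF \<alpha>(1), of "- z"] unfolding a_def g_def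
      by (subst sums_Suc_iff) (simp add: Gamma_1)
    have "(\<lambda>k. (- z * of_real (s powr \<alpha>)) ^ Suc k /\<^sub>R Gamma (\<alpha> * real (Suc k) + 1)) sums (g s - 1)"
      using mittag_leffler_sums[OF \<alpha>(1), of "- z * of_real (s powr \<alpha>)"] unfolding g_def
      by (subst sums_Suc_iff) (simp add: Gamma_1)
    moreover have "(- z * of_real (s powr \<alpha>)) ^ Suc k /\<^sub>R Gamma (\<alpha> * real (Suc k) + 1) = a k * of_real (s powr (\<alpha> * real (Suc k)))" for k
      unfolding a_def powr_mult_of_nat[OF s] power_mult_distrib[of "- z"] of_real_power
      by (rule mult_scaleR_left[symmetric])
    ultimately have 2: "(\<lambda>k. a k * of_real (s powr (\<alpha> * real (Suc k)))) sums (g s - 1)" by simp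
    have "(\<lambda>k. of_real ((1 - s) powr (- \<alpha> - 1)) * (a k - a k * of_real (s powr (\<alpha> * real (Suc k))))) sums
            (of_real ((1 - s) powr (- \<alpha> - 1)) * ((g 1 - 1) - (g s - 1)))"
      by (rule sums_mult[OF sums_diff[OF 1 2]])
    moreover have "of_real ((1 - s) powr (- \<alpha> - 1)) * (a k - a k * of_real (s powr (\<alpha> * real (Suc k)))) = a k * of_real (h k s)" for k
      unfolding h_def of_real_mult of_real_diff of_real_1 by (simp only: algebra_simps mult_1_left mult_1_right)
    ultimately show ?thesis by simp
  qed
  have En: "summable (\<lambda>k. norm (a k * of_real (h k s)))" if s: "0 < s" "s < 1" for s
  proof (rule summable_comparison_test'[where N = 0])
    show "summable (\<lambda>k. norm (a k) * (1 - s) powr (- \<alpha> - 1))"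
      by (rule summable_mult2[OF sna])
    show "norm (norm (a k * of_real (h k s))) \<le> norm (a k) * (1 - s) powr (- \<alpha> - 1)" for k
    proof -
      have "h k s \<le> 1 * (1 - s) powr (- \<alpha> - 1)" unfolding h_def by (intro mult_right_mono) auto
      then show ?thesis using hpos[OF s, of k] by (simp add: norm_mult mult_left_mono)
    qed
  qed
  have "(LINT s|?M. norm (a k * of_real (h k s))) = (norm (a k) * d k - norm (a k)) / \<alpha>" for k
    using has_bochner_integral_integral_eq[OF fa[of k]] by (simp add: algebra_simps)
  then have sn: "summable (\<lambda>k. LINT s|?M. norm (a k * of_real (h k s)))"
    using summable_divide[OF summable_diff[OF snd sna]] by simp
  have *: "integrable ?M (\<lambda>s. \<Sum>k. a k * of_real (h k s))"
    "(\<lambda>k. LINT s|?M. a k * of_real (h k s)) sums (LINT s|?M. (\<Sum>k. a k * of_real (h k s)))"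
    by (rule integrable_suminf sums_integral; use fi En sn in
        \<open>auto simp: has_bochner_integral_iff intro!: AE_I2\<close>)+
  have eq: "(\<Sum>k. a k * of_real (h k s)) = of_real ((1 - s) powr (- \<alpha> - 1)) * (g 1 - g s)" if "s \<in> space ?M" for s
    using E[of s] that by (auto simp: sums_iff)
  show "integrable ?M (\<lambda>s. of_real ((1 - s) powr (- \<alpha> - 1)) * (g 1 - g s))"
    using *(1) by (subst Bochner_Integration.integrable_cong[OF refl eq[symmetric]]) auto
  have I: "(LINT s|?M. (\<Sum>k. a k * of_real (h k s))) = (LINT s|?M. of_real ((1 - s) powr (- \<alpha> - 1)) * (g 1 - g s))"
    by (rule Bochner_Integration.integral_cong) (use eq in auto)
  have "(\<lambda>k. a k * of_real ((d k - 1) / \<alpha>)) sums (LINT s|?M. of_real ((1 - s) powr (- \<alpha> - 1)) * (g 1 - g s))"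
    using *(2) fi unfolding I by (simp add: has_bochner_integral_iff)
  then have s1: "(\<lambda>k. of_real \<alpha> * (a k * of_real ((d k - 1) / \<alpha>))) sums (of_real \<alpha> * (LINT s|?M. of_real ((1 - s) powr (- \<alpha> - 1)) * (g 1 - g s)))"
    by (rule sums_mult)
  have "(\<lambda>k. a k) sums (g 1 - 1)"
    using mittag_leffler_sums[OF \<alpha>(1), of "- z"] unfolding a_def g_def
    by (subst sums_Suc_iff) (simp add: Gamma_1)
  moreover have "(\<lambda>k. of_real (Gamma (1 - \<alpha>)) * (- z) * ((- z) ^ k /\<^sub>R Gamma (\<alpha> * real k + 1))) sums (of_real (Gamma (1 - \<alpha>)) * (- z) * g 1)"
    using sums_mult[OF mittag_leffler_sums[OF \<alpha>(1), of "- z"], of "of_real (Gamma (1 - \<alpha>)) * (- z)"] by (simp add: g_def)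
  ultimately have "(\<lambda>k. of_real (Gamma (1 - \<alpha>)) * (- z) * ((- z) ^ k /\<^sub>R Gamma (\<alpha> * real k + 1)) - a k) sums (of_real (Gamma (1 - \<alpha>)) * (- z) * g 1 - (g 1 - 1))"
    by (rule sums_diff[rotated])
  moreover have "of_real (Gamma (1 - \<alpha>)) * (- z) * ((- z) ^ k /\<^sub>R Gamma (\<alpha> * real k + 1)) - a k = of_real \<alpha> * (a k * of_real ((d k - 1) / \<alpha>))" for k
  proof -
    have "of_real (Gamma (1 - \<alpha>)) * (- z) * ((- z) ^ k /\<^sub>R Gamma (\<alpha> * real k + 1)) = a k * of_real (d k)"
      using Gamma_mult_nat_pos[OF \<alpha>(1), of "Suc k"] unfolding a_def d scaleR_conv_of_real
      by (simp add: divide_inverse del: of_nat_Suc)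
    moreover have "of_real \<alpha> * of_real ((d k - 1) / \<alpha>) = (of_real (d k) - 1 :: complex)"
      using \<alpha> by (simp flip: of_real_mult)
    then have "of_real \<alpha> * (a k * of_real ((d k - 1) / \<alpha>)) = a k * (of_real (d k) - 1)"
      by (metis mult.left_commute)
    ultimately show ?thesis by (simp add: algebra_simps)
  qed
  ultimately have "of_real (Gamma (1 - \<alpha>)) * (- z) * g 1 - (g 1 - 1) = of_real \<alpha> * (LINT s|?M. of_real ((1 - s) powr (- \<alpha> - 1)) * (g 1 - g s))"
    using s1 by (metis (no_types, lifting) sums_unique2 sums_cong)
  then show "(g 1 - 1) + of_real \<alpha> * (LINT s|?M. of_real ((1 - s) powr (- \<alpha> - 1)) * (g 1 - g s))
           = - of_real (Gamma (1 - \<alpha>)) * z * g 1" by (simp add: algebra_simps)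
qed

text \<open>Suppose the modulus exceeds 1 somewhere on the segment from 0 to \<open>- z\<close>, and
  look at its maximum there. Multiplied by the conjugate of the maximal value,
  \<open>g 1 - 1\<close> and all \<open>g 1 - g s\<close> have nonnegative real part, the first a
  positive one, whereas the right-hand side of the fractional equation gets a nonpositive real part.
  The imaginary axis is reached as a limit.\<close>

lemma norm_mittag_leffler_le_1:
  fixes z :: complex
  assumes \<alpha>: "0 < \<alpha>" "\<alpha> < 1" and z: "Re z \<ge> 0"
  shows "norm (mittag_leffler \<alpha> (- z)) \<le> 1"
proof -
  have strict: "norm (mittag_leffler \<alpha> (- z)) \<le> 1" if z: "Re z > 0" for z
  proof (rule ccontr)
    assume *: "\<not> norm (mittag_leffler \<alpha> (- z)) \<le> 1"
    obtain r where r: "r \<in> {0..1}" "\<And>s. s \<in> {0..1} \<Longrightarrow> norm (mittag_leffler \<alpha> (- z * of_real s)) \<le> norm (mittag_leffler \<alpha> (- z * of_real r))"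
    proof -
      have "continuous_on {0..1} (\<lambda>s::real. norm (mittag_leffler \<alpha> (- z * of_real s)))"
        by (intro continuous_on_norm continuous_on_mittag_leffler_complex continuous_intros \<alpha>)
      from continuous_attains_sup[OF _ _ this] show ?thesis using that by auto
    qed
    have M: "norm (mittag_leffler \<alpha> (- z * of_real r)) > 1" using r(2)[of 1] * by simp
    then have "r \<noteq> 0" by (intro notI) simp
    then have "r > 0" using r(1) by auto
    \<comment> \<open>Rescaling puts the maximum at time 1; \<open>r * s powr \<alpha>\<close> stays
      in \<open>{0..1}\<close>, so \<open>g 1\<close> dominates every \<open>g s\<close>.\<close>
    define w where "w = z * of_real r"
    define g where "g s = mittag_leffler \<alpha> (- w * of_real (s powr \<alpha>))" for s :: real
    have Rw: "Re w > 0" using z \<open>r > 0\<close> by (simp add: w_def)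
    have g1: "g 1 = mittag_leffler \<alpha> (- z * of_real r)" by (simp add: g_def w_def)
    have le: "norm (g s) \<le> norm (g 1)" if "0 < s" "s < 1" for s
    proof -
      have "r * s powr \<alpha> \<in> {0..1}" using r(1) that \<alpha> powr_le1[of \<alpha> s] by (auto intro: mult_le_one)
      from r(2)[OF this] show ?thesis unfolding g1 by (simp add: g_def w_def mult.assoc)
    qed
    let ?M = "lebesgue_on {0<..<1::real}"
    define f where "f s = of_real ((1 - s) powr (- \<alpha> - 1)) * (g 1 - g s)" for s
    have int: "integrable ?M f" and id: "(g 1 - 1) + of_real \<alpha> * (LINT s|?M. f s) = - of_real (Gamma (1 - \<alpha>)) * w * g 1"
      using mittag_leffler_caputo_at_1[OF \<alpha>, of w] unfolding f_def g_def by auto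
    have nn: "Re (cnj (g 1) * g 1) = (norm (g 1))\<^sup>2"
      using cmod_power2[of "g 1"] by (simp add: power2_eq_square)
    have "Re (cnj (g 1) * f s) \<ge> 0" if "0 < s" "s < 1" for s
    proof -
      have "Re (cnj (g 1) * g s) \<le> norm (cnj (g 1) * g s)" by (rule complex_Re_le_cmod)
      also have "\<dots> \<le> norm (g 1) * norm (g 1)" using le[OF that] by (simp add: norm_mult mult_left_mono)
      also have "\<dots> = Re (cnj (g 1) * g 1)" using nn by (simp add: power2_eq_square)
      finally have "0 \<le> Re (cnj (g 1) * (g 1 - g s))" by (simp add: algebra_simps)
      moreover have "Re (cnj (g 1) * f s) = (1 - s) powr (- \<alpha> - 1) * Re (cnj (g 1) * (g 1 - g s))"
        unfolding f_def by (simp add: algebra_simps)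
      ultimately show ?thesis by simp
    qed
    then have "(LINT s|?M. Re (cnj (g 1) * f s)) \<ge> 0"
      by (intro integral_nonneg_AE AE_I2) auto
    also have "(LINT s|?M. Re (cnj (g 1) * f s)) = Re (cnj (g 1) * (LINT s|?M. f s))"
      using int by (subst integral_Re) auto
    finally have 1: "Re (cnj (g 1) * (LINT s|?M. f s)) \<ge> 0" .
    have n1: "norm (g 1) > 1" using M g1 by simp
    have "Re (cnj (g 1) * 1) \<le> norm (g 1)" using complex_Re_le_cmod[of "cnj (g 1)"] by simp
    also have "\<dots> < (norm (g 1))\<^sup>2" using mult_strict_right_mono[OF n1 less_trans[OF zero_less_one n1]] by (simp add: power2_eq_square)
    finally have 2: "Re (cnj (g 1) * (g 1 - 1)) > 0" using nn by (simp add: algebra_simps)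
    have "Re (cnj (g 1) * ((g 1 - 1) + of_real \<alpha> * (LINT s|?M. f s))) = Re (cnj (g 1) * (g 1 - 1)) + \<alpha> * Re (cnj (g 1) * (LINT s|?M. f s))"
      by (simp add: algebra_simps)
    also have "\<dots> > 0" using 1 2 \<alpha> by (intro add_pos_nonneg) auto
    finally have "Re (cnj (g 1) * (- of_real (Gamma (1 - \<alpha>)) * w * g 1)) > 0" unfolding id .
    moreover have "cnj (g 1) * (- of_real (Gamma (1 - \<alpha>)) * w * g 1) = of_real (- Gamma (1 - \<alpha>) * (norm (g 1))\<^sup>2) * w"
      using complex_norm_square[of "g 1"] by (simp add: mult_ac)
    ultimately have "Re (of_real (- Gamma (1 - \<alpha>) * (norm (g 1))\<^sup>2) * w) > 0" by (simp only:)
    then have "- Gamma (1 - \<alpha>) * (norm (g 1))\<^sup>2 * Re w > 0"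
      by (simp only: times_complex.sel Re_complex_of_real Im_complex_of_real mult_zero_left diff_0_right)
    moreover have "Gamma (1 - \<alpha>) * (norm (g 1))\<^sup>2 * Re w \<ge> 0"
      using \<alpha> Rw by (intro mult_nonneg_nonneg) (auto intro!: less_imp_le[OF Gamma_real_pos])
    ultimately show False by linarith
  qed
  have "((\<lambda>e. norm (mittag_leffler \<alpha> (- (z + of_real e)))) \<longlongrightarrow> norm (mittag_leffler \<alpha> (- (z + of_real 0)))) (at_right 0)"
  proof -
    have "continuous_on UNIV (\<lambda>e::real. norm (mittag_leffler \<alpha> (- (z + of_real e))))"
      by (intro continuous_on_norm continuous_on_mittag_leffler_complex continuous_intros \<alpha>)
    then have "isCont (\<lambda>e::real. norm (mittag_leffler \<alpha> (- (z + of_real e)))) 0"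
      by (simp add: continuous_on_eq_continuous_at)
    then show ?thesis
      unfolding isCont_def by (rule filterlim_mono) (auto simp: at_within_le_at)
  qed
  moreover have "\<forall>\<^sub>F e in at_right 0. norm (mittag_leffler \<alpha> (- (z + of_real e))) \<le> 1"
    by (intro eventually_at_right_less[THEN eventually_mono] strict) (use z in auto)
  ultimately have "norm (mittag_leffler \<alpha> (- (z + of_real 0))) \<le> 1"
    by (rule tendsto_upperbound) auto
  then show ?thesis by simp
qed

lemma abs_mittag_leffler_le_1:
  assumes "0 < \<alpha>" "\<alpha> < 1" "(y::real) \<ge> 0"
  shows "\<bar>mittag_leffler \<alpha> (- y)\<bar> \<le> 1"
  using norm_mittag_leffler_le_1[OF assms(1,2), of "of_real y"] assms
  by (simp add: mittag_leffler_of_real flip: of_real_minus)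

section \<open>Stieltjes series\<close>

text \<open>By partial fractions the sum of the \<open>b n / lam n\<close> is
  \<open>\<sigma>\<close> times the Stieltjes series of \<open>b n / lam n\<close>. That series is
  bounded uniformly in \<open>\<sigma>\<close>, so letting \<open>\<sigma>\<close> tend to 0 kills
  the sum, and then the series itself vanishes. This is one step of a recursion that replaces
  \<open>b n\<close> by \<open>b n / lam n\<close>.\<close>

lemma stieltjes_series_eq_0_imp:
  fixes b lam :: "nat \<Rightarrow> real"
  assumes b: "summable (\<lambda>n. \<bar>b n\<bar>)" and lam: "strict_mono lam" "lam 0 > 0"
    and zero: "\<And>\<sigma>. \<sigma> > 0 \<Longrightarrow> (\<Sum>n. b n / (\<sigma> + lam n)) = 0"
  shows "(\<Sum>n. b n / lam n) = 0" and "\<sigma> > 0 \<Longrightarrow> (\<Sum>n. (b n / lam n) / (\<sigma> + lam n)) = 0"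
proof -
  have ge: "lam 0 \<le> lam n" for n using lam(1) by (simp add: strict_mono_less_eq)
  have sm: "summable (\<lambda>n. \<bar>c n / d n\<bar>)" if "summable (\<lambda>n. \<bar>c n\<bar>)" "\<And>n. lam 0 \<le> d n" for c d :: "nat \<Rightarrow> real"
  proof (rule summable_comparison_test'[where N = 0])
    show "summable (\<lambda>n. \<bar>c n\<bar> / lam 0)" by (rule summable_divide[OF that(1)])
    show "norm \<bar>c n / d n\<bar> \<le> \<bar>c n\<bar> / lam 0" for n
      using that(2)[of n] lam(2) by (auto simp: abs_mult intro!: divide_left_mono mult_pos_pos)
  qed
  have s1: "summable (\<lambda>n. \<bar>b n / lam n\<bar>)" by (rule sm[OF b ge])
  have s2: "summable (\<lambda>n. \<bar>b n / (\<sigma> + lam n)\<bar>)" if "\<sigma> > 0" for \<sigma>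
    by (rule sm[OF b]) (use ge that in \<open>simp add: add_increasing\<close>)
  have s3: "summable (\<lambda>n. \<bar>(b n / lam n) / (\<sigma> + lam n)\<bar>)" if "\<sigma> > 0" for \<sigma>
    by (rule sm[OF s1]) (use ge that in \<open>simp add: add_increasing\<close>)
  have eq: "(\<Sum>n. b n / lam n) = \<sigma> * (\<Sum>n. (b n / lam n) / (\<sigma> + lam n))" if "\<sigma> > 0" for \<sigma>
  proof -
    have "(\<Sum>n. b n / lam n) - (\<Sum>n. b n / (\<sigma> + lam n)) = (\<Sum>n. b n / lam n - b n / (\<sigma> + lam n))"
      by (rule suminf_diff) (use s1 s2[OF that] in \<open>auto intro: summable_rabs_cancel\<close>)
    also have "\<dots> = (\<Sum>n. \<sigma> * ((b n / lam n) / (\<sigma> + lam n)))"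
    proof (rule suminf_cong)
      fix n
      have "lam n > 0" using ge[of n] lam(2) by simp
      then show "b n / lam n - b n / (\<sigma> + lam n) = \<sigma> * ((b n / lam n) / (\<sigma> + lam n))"
        using that by (simp add: field_simps)
    qed
    also have "\<dots> = \<sigma> * (\<Sum>n. (b n / lam n) / (\<sigma> + lam n))"
      by (rule suminf_mult) (use s3[OF that] in \<open>auto intro: summable_rabs_cancel\<close>)
    finally show ?thesis using zero[OF that] by simp
  qed
  define B where "B = (\<Sum>n. \<bar>b n / lam n\<bar>) / lam 0"
  have le: "\<bar>\<Sum>n. b n / lam n\<bar> \<le> \<sigma> * B" if "\<sigma> > 0" for \<sigma>
  proof -
    have "\<bar>\<Sum>n. (b n / lam n) / (\<sigma> + lam n)\<bar> \<le> (\<Sum>n. \<bar>(b n / lam n) / (\<sigma> + lam n)\<bar>)"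
      by (rule summable_rabs[OF s3[OF that]])
    also have "\<dots> \<le> (\<Sum>n. \<bar>b n / lam n\<bar> / lam 0)"
    proof (rule suminf_le[OF _ s3[OF that] summable_divide[OF s1]])
      fix n
      have "\<bar>(b n / lam n) / (\<sigma> + lam n)\<bar> = \<bar>b n / lam n\<bar> / \<bar>\<sigma> + lam n\<bar>" by (rule abs_divide)
      also have "\<dots> \<le> \<bar>b n / lam n\<bar> / lam 0"
        using ge[of n] that lam(2) by (intro divide_left_mono mult_pos_pos) auto
      finally show "\<bar>(b n / lam n) / (\<sigma> + lam n)\<bar> \<le> \<bar>b n / lam n\<bar> / lam 0" .
    qed
    also have "\<dots> = B" unfolding B_def by (rule suminf_divide[OF s1])
    finally show ?thesis
      unfolding eq[OF that] using that by (simp add: abs_mult mult_left_mono)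
  qed
  show z: "(\<Sum>n. b n / lam n) = 0"
  proof -
    have "((\<lambda>\<sigma>. \<sigma> * B) \<longlongrightarrow> 0 * B) (at_right 0)" by (intro tendsto_intros)
    moreover have "\<forall>\<^sub>F \<sigma> in at_right 0. \<bar>\<Sum>n. b n / lam n\<bar> \<le> \<sigma> * B"
      using eventually_at_right_less[of "0::real"] by eventually_elim (rule le)
    ultimately have "\<bar>\<Sum>n. b n / lam n\<bar> \<le> 0 * B"
      by (rule tendsto_lowerbound) simp
    then show ?thesis by simp
  qed
  show "(\<Sum>n. (b n / lam n) / (\<sigma> + lam n)) = 0" if "\<sigma> > 0" using eq[OF that] z that by simp
qed

text \<open>The functional \<open>\<Sum>n. b n / (1 + lam n * y)\<close> determines the moments \<open>\<Sum>n. b n / lam n ^ k\<close>,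
  in which the first nonzero coefficient dominates for large \<open>k\<close>.\<close>

lemma stieltjes_series_const_imp_eq_0:
  fixes b lam :: "nat \<Rightarrow> real"
  assumes b: "summable (\<lambda>n. \<bar>b n\<bar>)" and lam: "strict_mono lam" "lam 0 > 0"
    and const: "\<And>y. y > 0 \<Longrightarrow> (\<Sum>n. b n / (1 + lam n * y)) = c"
  shows "b n = 0"
proof -
  have ge: "lam 0 \<le> lam n" for n using lam(1) by (simp add: strict_mono_less_eq)
  have pos: "lam n > 0" for n using ge[of n] lam(2) by simp
  have sb: "summable (\<lambda>n. \<bar>b n / (\<sigma> + lam n)\<bar>)" if "\<sigma> > 0" for \<sigma>
  proof (rule summable_comparison_test'[where N = 0])
    show "summable (\<lambda>n. \<bar>b n\<bar> / \<sigma>)" by (rule summable_divide[OF b])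
    show "norm \<bar>b n / (\<sigma> + lam n)\<bar> \<le> \<bar>b n\<bar> / \<sigma>" for n
      using that pos[of n] by (auto simp: abs_mult intro!: divide_left_mono mult_pos_pos)
  qed
  have c: "\<sigma> * (\<Sum>n. b n / (\<sigma> + lam n)) = c" if "\<sigma> > 0" for \<sigma>
  proof -
    have "\<sigma> * (\<Sum>n. b n / (\<sigma> + lam n)) = (\<Sum>n. \<sigma> * (b n / (\<sigma> + lam n)))"
      by (rule suminf_mult[symmetric]) (use sb[OF that] in \<open>auto intro: summable_rabs_cancel\<close>)
    also have "\<dots> = (\<Sum>n. b n / (1 + lam n * (1 / \<sigma>)))"
      using that by (intro suminf_cong) (simp add: field_simps)
    also have "\<dots> = c" by (rule const) (use that in simp)
    finally show ?thesis .
  qed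
  define B where "B = (\<Sum>n. \<bar>b n\<bar>) / lam 0"
  \<comment> \<open>With \<open>\<sigma> = 1 / y\<close> the constant is \<open>\<sigma>\<close>
    times a sum that stays bounded as \<open>\<sigma>\<close> tends to 0, so it is 0.\<close>
  have "\<bar>c\<bar> \<le> \<sigma> * B" if "\<sigma> > 0" for \<sigma>
  proof -
    have "\<bar>\<Sum>n. b n / (\<sigma> + lam n)\<bar> \<le> (\<Sum>n. \<bar>b n / (\<sigma> + lam n)\<bar>)"
      by (rule summable_rabs[OF sb[OF that]])
    also have "\<dots> \<le> (\<Sum>n. \<bar>b n\<bar> / lam 0)"
    proof (rule suminf_le[OF _ sb[OF that] summable_divide[OF b]])
      show "\<bar>b n / (\<sigma> + lam n)\<bar> \<le> \<bar>b n\<bar> / lam 0" for n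
        using ge[of n] that lam(2) unfolding abs_divide by (intro divide_left_mono mult_pos_pos) auto
    qed
    also have "\<dots> = B" unfolding B_def by (rule suminf_divide[OF b])
    finally show ?thesis
      unfolding c[OF that, symmetric] using that by (simp add: abs_mult mult_left_mono)
  qed
  then have "\<forall>\<^sub>F \<sigma> in at_right 0. \<bar>c\<bar> \<le> \<sigma> * B"
    using eventually_at_right_less[of "0::real"] by (auto elim: eventually_mono)
  moreover have "((\<lambda>\<sigma>. \<sigma> * B) \<longlongrightarrow> 0 * B) (at_right 0)" by (intro tendsto_intros)
  ultimately have "\<bar>c\<bar> \<le> 0 * B" by (intro tendsto_lowerbound) auto
  then have zero: "(\<Sum>n. b n / (\<sigma> + lam n)) = 0" if "\<sigma> > 0" for \<sigma>
    using c[OF that] that by simp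
  have mom: "(\<forall>\<sigma>>0. (\<Sum>n. (b n / lam n ^ k) / (\<sigma> + lam n)) = 0) \<and> summable (\<lambda>n. \<bar>b n / lam n ^ k\<bar>)" for k
  proof (induction k)
    case 0
    then show ?case using zero b by simp
  next
    case (Suc k)
    have e: "b n / lam n ^ Suc k = (b n / lam n ^ k) / lam n" for n by simp
    have "(\<Sum>n. (b n / lam n ^ Suc k) / (\<sigma> + lam n)) = 0" if "\<sigma> > 0" for \<sigma>
      unfolding e by (rule stieltjes_series_eq_0_imp(2)[OF _ lam _ that]) (use Suc in auto)
    moreover have "summable (\<lambda>n. \<bar>b n / lam n ^ Suc k\<bar>)"
    proof (rule summable_comparison_test'[where N = 0])
      show "summable (\<lambda>n. \<bar>b n / lam n ^ k\<bar> / lam 0)" by (rule summable_divide) (use Suc in auto)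
      show "norm \<bar>b n / lam n ^ Suc k\<bar> \<le> \<bar>b n / lam n ^ k\<bar> / lam 0" for n
      proof -
        have "norm \<bar>b n / lam n ^ Suc k\<bar> = \<bar>b n / lam n ^ k\<bar> / lam n"
          using pos[of n] unfolding e by (simp only: real_norm_def abs_idempotent abs_divide[of _ "lam n"] abs_of_pos)
        then show ?thesis
          using ge[of n] lam(2) by (simp only:) (intro divide_left_mono mult_pos_pos, auto)
      qed
    qed
    ultimately show ?case by blast
  qed
  have mom0: "(\<Sum>n. b n / lam n ^ Suc k) = 0" for k
    using stieltjes_series_eq_0_imp(1)[OF _ lam, of "\<lambda>n. b n / lam n ^ k"] mom[of k] by (simp add: field_simps)
  show ?thesis
  proof (induction n rule: less_induct)
    case (less m)
    \<comment> \<open>The moment of order \<open>Suc k\<close> times \<open>lam m ^ Suc k\<close> is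
      \<open>b m\<close> plus a tail: terms below \<open>m\<close> vanish by induction, and each
      term above is damped by at least \<open>\<rho> ^ Suc k\<close>.\<close>
    define \<rho> where "\<rho> = lam m / lam (Suc m)"
    have \<rho>: "0 < \<rho>" "\<rho> < 1" using pos[of m] lam(1) by (auto simp: \<rho>_def strict_mono_less pos)
    define C where "C = (\<Sum>n. \<bar>b n\<bar>)"
    have "\<bar>b m\<bar> \<le> C * \<rho> ^ Suc k" for k
    proof -
      define w where "w n = b n * (lam m / lam n) ^ Suc k" for n
      have w: "w n = lam m ^ Suc k * (b n / lam n ^ Suc k)" for n
        by (simp add: w_def power_divide del: power_Suc)
      have sw: "summable (\<lambda>n. \<bar>w n\<bar>)"
        using summable_mult[OF conjunct2[OF mom[of "Suc k"]], of "\<bar>lam m ^ Suc k\<bar>"]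
        unfolding w abs_mult .
      have "(\<Sum>n. w n) = 0"
        unfolding w using suminf_mult[of "\<lambda>n. b n / lam n ^ Suc k" "lam m ^ Suc k"] mom0[of k] mom[of "Suc k"]
        by (simp add: summable_rabs_cancel del: power_Suc)
      then have "(\<Sum>n. w (n + Suc m)) + (\<Sum>n<Suc m. w n) = 0"
        using suminf_split_initial_segment[OF summable_rabs_cancel[OF sw], of "Suc m"] by simp
      moreover have "(\<Sum>n<Suc m. w n) = b m" using less pos[of m] by (simp add: w_def del: power_Suc)
      ultimately have "\<bar>b m\<bar> = \<bar>\<Sum>n. w (n + Suc m)\<bar>" by simp
      also have "\<dots> \<le> (\<Sum>n. \<bar>w (n + Suc m)\<bar>)"
        by (rule summable_rabs) (use sw in \<open>subst summable_iff_shift\<close>)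
      also have "\<dots> \<le> (\<Sum>n. \<bar>b (n + Suc m)\<bar> * \<rho> ^ Suc k)"
      proof (rule suminf_le)
        fix n
        have "lam (Suc m) \<le> lam (n + Suc m)" using lam(1) by (simp add: strict_mono_less_eq)
        then have "lam m / lam (n + Suc m) \<le> \<rho>"
          unfolding \<rho>_def using pos by (intro divide_left_mono) (auto simp: less_imp_le)
        then have "(lam m / lam (n + Suc m)) ^ Suc k \<le> \<rho> ^ Suc k"
          using pos by (intro power_mono) (auto simp: less_imp_le)
        then show "\<bar>w (n + Suc m)\<bar> \<le> \<bar>b (n + Suc m)\<bar> * \<rho> ^ Suc k"
          unfolding w_def abs_mult using pos by (intro mult_left_mono) (auto simp: less_imp_le)
      next
        show "summable (\<lambda>n. \<bar>w (n + Suc m)\<bar>)" using sw by (subst summable_iff_shift)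
        show "summable (\<lambda>n. \<bar>b (n + Suc m)\<bar> * \<rho> ^ Suc k)"
          by (rule summable_mult2) (use b in \<open>subst summable_iff_shift\<close>)
      qed
      also have "\<dots> = (\<Sum>n. \<bar>b (n + Suc m)\<bar>) * \<rho> ^ Suc k"
        by (rule suminf_mult2[symmetric]) (use b in \<open>subst summable_iff_shift\<close>)
      also have "\<dots> \<le> C * \<rho> ^ Suc k"
      proof (rule mult_right_mono)
        show "(\<Sum>n. \<bar>b (n + Suc m)\<bar>) \<le> C"
          unfolding C_def using suminf_split_initial_segment[OF b, of "Suc m"] by (simp add: sum_nonneg del: sum.lessThan_Suc)
      qed (use \<rho> in auto)
      finally show ?thesis .
    qed
    moreover have "(\<lambda>k. C * \<rho> ^ Suc k) \<longlonglongrightarrow> C * 0"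
      using \<rho> by (intro tendsto_mult tendsto_const LIMSEQ_Suc[OF LIMSEQ_power_zero]) auto
    ultimately have "\<bar>b m\<bar> \<le> C * 0" by (intro LIMSEQ_le_const) auto
    then show ?case by simp
  qed
qed

section \<open>Fractional integrals and the Laplace transform\<close>

text \<open>Extended by 0 to the whole line, so that fractional integration, up to the factor
  \<open>1 / Gamma \<alpha>\<close>, is a convolution on \<open>lborel\<close> with no moving
  interval of integration.\<close>

definition frac_kernel :: "real \<Rightarrow> real \<Rightarrow> real" where
  "frac_kernel \<alpha> u = indicator {0<..} u * u powr (\<alpha> - 1)"

lemma frac_kernel_nonneg [simp]: "frac_kernel \<alpha> u \<ge> 0"
  by (simp add: frac_kernel_def)

lemma borel_measurable_frac_kernel [measurable]: "frac_kernel \<alpha> \<in> borel_measurable borel"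
  unfolding frac_kernel_def by measurable

lemma nn_integral_frac_kernel:
  assumes "\<alpha> > 0" "\<gamma> > 0"
  shows "(\<integral>\<^sup>+t. ennreal (exp (- \<gamma> * t) * frac_kernel \<alpha> (t - s)) \<partial>lborel)
           = ennreal (Gamma \<alpha> * \<gamma> powr (- \<alpha>) * exp (- \<gamma> * s))"
proof -
  have "(\<integral>\<^sup>+t. ennreal (exp (- \<gamma> * t) * frac_kernel \<alpha> (t - s)) \<partial>lborel)
      = ennreal \<bar>1 / \<gamma>\<bar> * (\<integral>\<^sup>+x. ennreal (exp (- \<gamma> * (s + (1 / \<gamma>) * x)) * frac_kernel \<alpha> ((s + (1 / \<gamma>) * x) - s)) \<partial>lborel)"
    using assms by (intro nn_integral_real_affine) auto
  also have "(\<integral>\<^sup>+x. ennreal (exp (- \<gamma> * (s + (1 / \<gamma>) * x)) * frac_kernel \<alpha> ((s + (1 / \<gamma>) * x) - s)) \<partial>lborel)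
      = (\<integral>\<^sup>+x. ennreal (exp (- \<gamma> * s) * \<gamma> powr (1 - \<alpha>)) * ennreal (indicator {0<..} x * (x powr (\<alpha> - 1) / exp x)) \<partial>lborel)"
  proof (intro nn_integral_cong)
    fix x :: real
    have "exp (- \<gamma> * (s + (1 / \<gamma>) * x)) * frac_kernel \<alpha> ((s + (1 / \<gamma>) * x) - s)
        = (exp (- \<gamma> * s) * \<gamma> powr (1 - \<alpha>)) * (indicator {0<..} x * (x powr (\<alpha> - 1) / exp x))"
    proof (cases "x > 0")
      case True
      have "- \<gamma> * (s + (1 / \<gamma>) * x) = - \<gamma> * s - x" using assms by (simp add: algebra_simps)
      then have "exp (- \<gamma> * (s + (1 / \<gamma>) * x)) = exp (- \<gamma> * s) / exp x" by (simp only: exp_diff)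
      moreover have "(x / \<gamma>) powr (\<alpha> - 1) = x powr (\<alpha> - 1) * \<gamma> powr (1 - \<alpha>)"
        using assms True powr_minus_divide[of \<gamma> "\<alpha> - 1"] by (simp add: powr_divide)
      ultimately show ?thesis using True assms by (simp add: frac_kernel_def)
    next
      case False
      then show ?thesis using assms by (simp add: frac_kernel_def indicator_def zero_less_divide_iff)
    qed
    then show "ennreal (exp (- \<gamma> * (s + (1 / \<gamma>) * x)) * frac_kernel \<alpha> ((s + (1 / \<gamma>) * x) - s))
        = ennreal (exp (- \<gamma> * s) * \<gamma> powr (1 - \<alpha>)) * ennreal (indicator {0<..} x * (x powr (\<alpha> - 1) / exp x))"
      by (simp only:) (rule ennreal_mult', simp)
  qed
  also have "\<dots> = ennreal (exp (- \<gamma> * s) * \<gamma> powr (1 - \<alpha>)) * (\<integral>\<^sup>+x. ennreal (indicator {0<..} x * (x powr (\<alpha> - 1) / exp x)) \<partial>lborel)"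
    by (rule nn_integral_cmult) measurable
  also have "(\<integral>\<^sup>+x. ennreal (indicator {0<..} x * (x powr (\<alpha> - 1) / exp x)) \<partial>lborel) = (\<integral>\<^sup>+x. ennreal (indicator {0..} x * x powr (\<alpha> - 1) / exp x) \<partial>lborel)"
    by (intro nn_integral_cong) (auto simp: indicator_def)
  also have "\<dots> = ennreal (Gamma \<alpha>)"
    using Gamma_conv_nn_integral_real[OF assms(1)] by simp
  also have "ennreal \<bar>1 / \<gamma>\<bar> * (ennreal (exp (- \<gamma> * s) * \<gamma> powr (1 - \<alpha>)) * ennreal (Gamma \<alpha>)) = ennreal (Gamma \<alpha> * \<gamma> powr (- \<alpha>) * exp (- \<gamma> * s))"
  proof -
    have "\<gamma> powr (1 - \<alpha>) = \<gamma> * \<gamma> powr (- \<alpha>)" using assms powr_add[of \<gamma> 1 "- \<alpha>"] by simp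
    moreover have "Gamma \<alpha> > 0" using assms by (intro Gamma_real_pos)
    ultimately show ?thesis using assms by (simp add: ennreal_mult[symmetric] field_simps)
  qed
  finally show ?thesis .
qed

text \<open>The Laplace transform turns the convolution into a product. Values in
  \<open>ennreal\<close> let Tonelli exchange the integrals.\<close>

lemma nn_integral_exp_frac_integral:
  assumes "\<alpha> > 0" "\<gamma> > 0" and h [measurable]: "h \<in> borel_measurable borel"
  shows "(\<integral>\<^sup>+t. ennreal (exp (- \<gamma> * t)) * (\<integral>\<^sup>+s. ennreal (frac_kernel \<alpha> (t - s)) * h s \<partial>lborel) \<partial>lborel)
           = ennreal (Gamma \<alpha> * \<gamma> powr (- \<alpha>)) * (\<integral>\<^sup>+s. ennreal (exp (- \<gamma> * s)) * h s \<partial>lborel)"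
proof -
  have G: "Gamma \<alpha> > 0" using assms by (intro Gamma_real_pos)
  have "(\<integral>\<^sup>+t. ennreal (exp (- \<gamma> * t)) * (\<integral>\<^sup>+s. ennreal (frac_kernel \<alpha> (t - s)) * h s \<partial>lborel) \<partial>lborel)
      = (\<integral>\<^sup>+t. (\<integral>\<^sup>+s. ennreal (exp (- \<gamma> * t) * frac_kernel \<alpha> (t - s)) * h s \<partial>lborel) \<partial>lborel)"
    by (intro nn_integral_cong, subst nn_integral_cmult[symmetric]) (auto simp: ennreal_mult mult.assoc)
  also have "\<dots> = (\<integral>\<^sup>+s. (\<integral>\<^sup>+t. ennreal (exp (- \<gamma> * t) * frac_kernel \<alpha> (t - s)) * h s \<partial>lborel) \<partial>lborel)"
    by (rule lborel_pair.Fubini') measurable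
  also have "\<dots> = (\<integral>\<^sup>+s. ennreal (Gamma \<alpha> * \<gamma> powr (- \<alpha>)) * (ennreal (exp (- \<gamma> * s)) * h s) \<partial>lborel)"
    using nn_integral_frac_kernel[OF assms(1,2)] G
    by (intro nn_integral_cong, subst nn_integral_multc) (auto simp: ennreal_mult mult.assoc)
  also have "\<dots> = ennreal (Gamma \<alpha> * \<gamma> powr (- \<alpha>)) * (\<integral>\<^sup>+s. ennreal (exp (- \<gamma> * s)) * h s \<partial>lborel)"
    by (rule nn_integral_cmult) measurable
  finally show ?thesis .
qed

text \<open>A Gronwall argument in one stroke: with the weight \<open>exp (- \<gamma> * t)\<close>,
  fractional integration has the factor \<open>Gamma \<alpha> * \<gamma> powr (- \<alpha>)\<close>,
  which a large \<open>\<gamma>\<close> makes a contraction on the whole half-line.\<close>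

lemma frac_integral_inequality_imp_AE_0:
  fixes h :: "real \<Rightarrow> ennreal"
  assumes "\<alpha> > 0" "\<kappa> \<ge> 0" and h [measurable]: "h \<in> borel_measurable borel"
    and fin: "(\<integral>\<^sup>+s. h s \<partial>lborel) < \<infinity>" and pos: "\<And>s. s \<le> 0 \<Longrightarrow> h s = 0"
    and le: "AE t in lborel. h t \<le> ennreal \<kappa> * (\<integral>\<^sup>+s. ennreal (frac_kernel \<alpha> (t - s)) * h s \<partial>lborel)"
  shows "AE t in lborel. h t = 0"
proof -
  define c where "c = \<kappa> * Gamma \<alpha>"
  have G: "Gamma \<alpha> > 0" using assms by (intro Gamma_real_pos)
  \<comment> \<open>\<open>\<gamma> powr \<alpha> = 2 * c + 1\<close> gives the contraction factor
    \<open>c / (2 * c + 1)\<close>, which is at most 1/2.\<close>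
  define \<gamma> where "\<gamma> = (2 * c + 1) powr (1 / \<alpha>)"
  have c: "c \<ge> 0" using G assms by (simp add: c_def)
  have \<gamma>: "\<gamma> > 0" "\<gamma> powr \<alpha> = 2 * c + 1" using c assms by (auto simp: \<gamma>_def powr_powr)
  define A where "A = (\<integral>\<^sup>+s. ennreal (exp (- \<gamma> * s)) * h s \<partial>lborel)"
  \<comment> \<open>Finiteness is essential: the inequality between \<open>A\<close> and its half is
    also satisfied by an infinite \<open>A\<close>.\<close>
  have "A \<le> (\<integral>\<^sup>+s. h s \<partial>lborel)"
    unfolding A_def
  proof (intro nn_integral_mono)
    fix s
    show "ennreal (exp (- \<gamma> * s)) * h s \<le> h s"
    proof (cases "s > 0")
      case True
      then have "ennreal (exp (- \<gamma> * s)) * h s \<le> 1 * h s" using \<gamma> by (intro mult_right_mono) auto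
      then show ?thesis by simp
    qed (simp add: pos)
  qed
  then have Afin: "A < \<infinity>" using fin by simp
  have "A \<le> (\<integral>\<^sup>+t. ennreal \<kappa> * (ennreal (exp (- \<gamma> * t)) * (\<integral>\<^sup>+s. ennreal (frac_kernel \<alpha> (t - s)) * h s \<partial>lborel)) \<partial>lborel)"
    unfolding A_def
  proof (rule nn_integral_mono_AE)
    show "AE t in lborel. ennreal (exp (- \<gamma> * t)) * h t \<le> ennreal \<kappa> * (ennreal (exp (- \<gamma> * t)) * (\<integral>\<^sup>+s. ennreal (frac_kernel \<alpha> (t - s)) * h s \<partial>lborel))"
      using le
    proof eventually_elim
      case (elim t)
      from mult_left_mono[OF elim, of "ennreal (exp (- \<gamma> * t))"] show ?case
        by (simp add: mult.left_commute)
    qed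
  qed
  also have "\<dots> = ennreal \<kappa> * (\<integral>\<^sup>+t. ennreal (exp (- \<gamma> * t)) * (\<integral>\<^sup>+s. ennreal (frac_kernel \<alpha> (t - s)) * h s \<partial>lborel) \<partial>lborel)"
    by (rule nn_integral_cmult) measurable
  also have "\<dots> = ennreal \<kappa> * (ennreal (Gamma \<alpha> * \<gamma> powr (- \<alpha>)) * A)"
    unfolding A_def by (subst nn_integral_exp_frac_integral) (use assms \<gamma> in auto)
  also have "\<dots> = ennreal (c / (2 * c + 1)) * A"
    using G assms \<gamma>(2) by (simp add: c_def powr_minus_divide ennreal_mult[symmetric] mult.assoc[symmetric])
  also have "\<dots> \<le> ennreal (1 / 2) * A"
    using c by (intro mult_right_mono ennreal_leI) (auto simp: field_simps)
  finally have *: "A \<le> ennreal (1 / 2) * A" .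
  obtain r where r: "A = ennreal r" "r \<ge> 0" using Afin by (cases A) auto
  have "ennreal (1 / 2) * ennreal r = ennreal (1 / 2 * r)"
    by (rule ennreal_mult[symmetric]) (use r in auto)
  then have "ennreal r \<le> ennreal (1 / 2 * r)" using * r(1) by (simp only:)
  then have "r \<le> 1 / 2 * r" using r(2) by (subst (asm) ennreal_le_iff) auto
  then have "A = 0" using r by simp
  then have "AE s in lborel. ennreal (exp (- \<gamma> * s)) * h s = 0"
    unfolding A_def by (subst (asm) nn_integral_0_iff_AE) auto
  then show ?thesis by eventually_elim simp
qed

text \<open>The absolute value of \<open>d\<close> satisfies the preceding inequality. Tonelli on
  \<open>lborel\<close> calls for Borel functions while \<open>d\<close> is only Lebesgue
  measurable, so the argument runs on a Borel representative \<open>d2\<close>.\<close>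

lemma frac_integral_equation_unique:
  fixes d :: "real \<Rightarrow> real"
  assumes \<alpha>: "\<alpha> > 0" and d: "integrable (lebesgue_on {0<..<T}) d"
    and eq: "AE t in lebesgue_on {0<..<T}. d t = \<kappa> * (LINT s|lebesgue_on {0<..<t}. (t - s) powr (\<alpha> - 1) * d s)"
  shows "AE t in lebesgue_on {0<..<T}. d t = 0"
proof -
  define d1 where "d1 s = (if s \<in> {0<..<T} then d s else 0)" for s
  have "d1 \<in> borel_measurable lebesgue"
    unfolding d1_def using d by (subst borel_measurable_if) (auto simp: integrable_iff_bounded)
  then obtain d2 where d2 [measurable]: "d2 \<in> borel_measurable lborel" and d12: "AE s in lborel. d1 s = d2 s"
    using completion_ex_borel_measurable_real[of d1 lborel] by auto
  define h where "h s = indicator {0<..<T} s * ennreal \<bar>d2 s\<bar>" for s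
  have hm [measurable]: "h \<in> borel_measurable borel" unfolding h_def by measurable
  have hd: "AE s in lebesgue. h s = ennreal \<bar>d1 s\<bar>"
    using AE_completion[OF d12] by eventually_elim (auto simp: h_def d1_def split: split_indicator if_splits)
  have I: "(\<integral>\<^sup>+s. h s \<partial>lborel) = (\<integral>\<^sup>+s. ennreal \<bar>d s\<bar> \<partial>lebesgue_on {0<..<T})"
  proof -
    have "(\<integral>\<^sup>+s. h s \<partial>lborel) = (\<integral>\<^sup>+s. h s \<partial>lebesgue)" by (rule nn_integral_completion[symmetric])
    also have "\<dots> = (\<integral>\<^sup>+s. ennreal \<bar>d s\<bar> * indicator {0<..<T} s \<partial>lebesgue)"
    proof (rule nn_integral_cong_AE)
      show "AE s in lebesgue. h s = ennreal \<bar>d s\<bar> * indicator {0<..<T} s"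
        using hd by eventually_elim (auto simp: d1_def)
    qed
    also have "\<dots> = (\<integral>\<^sup>+s. ennreal \<bar>d s\<bar> \<partial>lebesgue_on {0<..<T})"
      by (simp add: nn_integral_restrict_space)
    finally show ?thesis .
  qed
  have "AE t in lborel. h t = 0"
  proof (rule frac_integral_inequality_imp_AE_0[OF \<alpha> _ hm])
    show "\<bar>\<kappa>\<bar> \<ge> 0" by simp
    show "(\<integral>\<^sup>+s. h s \<partial>lborel) < \<infinity>"
      unfolding I using d by (simp add: integrable_iff_bounded)
    show "h s = 0" if "s \<le> 0" for s using that by (simp add: h_def)
    have "AE t in lebesgue. t \<in> {0<..<T} \<longrightarrow> d t = \<kappa> * (LINT s|lebesgue_on {0<..<t}. (t - s) powr (\<alpha> - 1) * d s)"
      using eq by (subst (asm) AE_restrict_space_iff) auto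
    then have "AE t in lebesgue. h t \<le> ennreal \<bar>\<kappa>\<bar> * (\<integral>\<^sup>+s. ennreal (frac_kernel \<alpha> (t - s)) * h s \<partial>lborel)"
      using hd
    proof eventually_elim
      case (elim t)
      show ?case
      proof (cases "t \<in> {0<..<T}")
        case True
        have "ennreal \<bar>LINT s|lebesgue_on {0<..<t}. (t - s) powr (\<alpha> - 1) * d s\<bar>
            \<le> (\<integral>\<^sup>+s. ennreal \<bar>(t - s) powr (\<alpha> - 1) * d s\<bar> \<partial>lebesgue_on {0<..<t})"
        proof (cases "integrable (lebesgue_on {0<..<t}) (\<lambda>s. (t - s) powr (\<alpha> - 1) * d s)")
          case True
          then show ?thesis using integral_norm_bound_ennreal by fastforce
        \<comment> \<open>Without integrability the integral is 0 by convention and the bound is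
          trivial.\<close>
        qed (simp add: not_integrable_integral_eq)
        also have "\<dots> = (\<integral>\<^sup>+s. ennreal \<bar>(t - s) powr (\<alpha> - 1) * d s\<bar> * indicator {0<..<t} s \<partial>lebesgue)"
          by (simp add: nn_integral_restrict_space)
        also have "\<dots> \<le> (\<integral>\<^sup>+s. ennreal (frac_kernel \<alpha> (t - s)) * h s \<partial>lebesgue)"
        proof (rule nn_integral_mono_AE)
          show "AE s in lebesgue. ennreal \<bar>(t - s) powr (\<alpha> - 1) * d s\<bar> * indicator {0<..<t} s \<le> ennreal (frac_kernel \<alpha> (t - s)) * h s"
            using hd
          proof eventually_elim
            case (elim s)
            show ?case
              using True elim by (auto simp: frac_kernel_def d1_def abs_mult ennreal_mult[symmetric] split: split_indicator)
          qed
        qed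
        also have "\<dots> = (\<integral>\<^sup>+s. ennreal (frac_kernel \<alpha> (t - s)) * h s \<partial>lborel)"
          by (rule nn_integral_completion)
        finally have "ennreal \<bar>\<kappa>\<bar> * ennreal \<bar>LINT s|lebesgue_on {0<..<t}. (t - s) powr (\<alpha> - 1) * d s\<bar> \<le> ennreal \<bar>\<kappa>\<bar> * (\<integral>\<^sup>+s. ennreal (frac_kernel \<alpha> (t - s)) * h s \<partial>lborel)"
          by (rule mult_left_mono) simp
        moreover have "h t = ennreal \<bar>\<kappa>\<bar> * ennreal \<bar>LINT s|lebesgue_on {0<..<t}. (t - s) powr (\<alpha> - 1) * d s\<bar>"
          using elim True by (simp add: d1_def abs_mult ennreal_mult[symmetric])
        ultimately show ?thesis by simp
      qed (simp add: h_def)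
    qed
    then show "AE t in lborel. h t \<le> ennreal \<bar>\<kappa>\<bar> * (\<integral>\<^sup>+s. ennreal (frac_kernel \<alpha> (t - s)) * h s \<partial>lborel)"
      by (simp add: AE_completion_iff)
  qed
  from AE_completion[OF this] hd have "AE t in lebesgue. d1 t = 0"
    by eventually_elim simp
  then show ?thesis
    by (subst AE_restrict_space_iff) (auto simp: d1_def elim: eventually_mono)
qed

lemma has_integral_Ici_imp_Ioi:
  fixes f :: "real \<Rightarrow> 'a::banach"
  assumes "(f has_integral I) {a..}"
  shows "(f has_integral I) {a<..}"
proof -
  have "((\<lambda>x. if x \<in> {a<..} then f x else 0) has_integral I) {a..}"
    by (rule has_integral_spike[OF _ _ assms, of "{a}"]) auto
  then show ?thesis by (subst (asm) has_integral_restrict) auto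
qed

text \<open>Transforming the series term by term would give the geometric series in
  \<open>- y\<close>, which diverges for \<open>y \<ge> 1\<close>. Instead the Volterra equation is
  transformed at parameter 1: the transform \<open>I\<close> satisfies
  \<open>(1 - I) / y = I\<close>.\<close>

lemma laplace_mittag_leffler:
  fixes y :: real
  assumes \<alpha>: "0 < \<alpha>" "\<alpha> < 1" and y: "y > 0"
  shows "has_bochner_integral (lebesgue_on {0<..}) (\<lambda>u. exp (- u) * mittag_leffler \<alpha> (- y * u powr \<alpha>)) (1 / (1 + y))"
proof -
  let ?M = "lebesgue_on {0<..} :: real measure"
  define g where "g u = mittag_leffler \<alpha> (- y * u powr \<alpha>)" for u
  have G: "Gamma \<alpha> > 0" using \<alpha> by (intro Gamma_real_pos)
  have Gamma_p1: "Gamma (\<alpha> + 1) = \<alpha> * Gamma \<alpha>"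
    using \<alpha> by (intro Gamma_plus1) (auto elim!: nonpos_Ints_cases)
  have g1: "\<bar>g u\<bar> \<le> 1" for u
    using abs_mittag_leffler_le_1[OF \<alpha>, of "y * u powr \<alpha>"] y by (simp add: g_def)
  have g0: "0 \<le> 1 + g s" for s using g1[of s] by linarith
  have gm [measurable]: "g \<in> borel_measurable borel"
  proof -
    have "mittag_leffler \<alpha> \<in> borel_measurable (borel :: real measure)"
      by (intro borel_measurable_continuous_onI continuous_on_mittag_leffler \<alpha> continuous_on_id)
    then show ?thesis unfolding g_def by measurable
  qed
  have e1: "has_bochner_integral ?M (\<lambda>u. exp (- u)) 1"
  proof (rule has_bochner_integral_lebesgue_on_nonneg)
    show "((\<lambda>u. exp (- u)) has_integral 1) ({0<..} :: real set)"
      using has_integral_exp_minus_to_infinity[of 1 0] by (intro has_integral_Ici_imp_Ioi) simp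
  qed auto
  have ea: "has_bochner_integral ?M (\<lambda>u. exp (- u) * u powr \<alpha>) (Gamma (\<alpha> + 1))"
  proof (rule has_bochner_integral_lebesgue_on_nonneg)
    show "((\<lambda>u. exp (- u) * u powr \<alpha>) has_integral Gamma (\<alpha> + 1)) ({0<..} :: real set)"
      using Gamma_integral_real[of "\<alpha> + 1"] \<alpha>
      by (intro has_integral_Ici_imp_Ioi) (simp add: exp_minus divide_inverse mult.commute)
  qed auto
  have eg: "integrable ?M (\<lambda>u. exp (- u) * g u)"
  proof (rule Bochner_Integration.integrable_bound)
    show "integrable ?M (\<lambda>u. exp (- u))" using e1 by (simp add: has_bochner_integral_iff)
    show "(\<lambda>u. exp (- u) * g u) \<in> borel_measurable ?M"
      by (intro measurable_restrict_space1 measurable_completion) measurable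
    show "AE u in ?M. norm (exp (- u) * g u) \<le> norm (exp (- u))"
      using g1 by (auto simp: abs_mult)
  qed
  define I where "I = (LINT u|?M. exp (- u) * g u)"
  \<comment> \<open>Adding 1 makes the function nonnegative, as Tonelli requires; \<open>F\<close>
    is the kernel integral of \<open>1 + g\<close>, its first summand coming from the 1 and its
    second from the Volterra equation.\<close>
  define h where "h s = indicator {0<..} s * ennreal (1 + g s)" for s
  have hm [measurable]: "h \<in> borel_measurable borel" unfolding h_def by measurable
  define F where "F t = t powr \<alpha> / \<alpha> + Gamma \<alpha> * (1 - g t) / y" for t
  have inner: "(\<integral>\<^sup>+s. ennreal (frac_kernel \<alpha> (t - s)) * h s \<partial>lborel) = ennreal (F t)" if t: "t > 0" for t
  proof -
    have "Beta 1 \<alpha> = 1 / \<alpha>"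
      using G Gamma_p1 by (simp add: Beta_def add.commute)
    moreover have "((\<lambda>s. s powr (1 - 1) * (t - s) powr (\<alpha> - 1)) has_integral Beta 1 \<alpha> * t powr (1 + \<alpha> - 1)) {0<..<t}"
      by (rule has_integral_frac_kernel) (use t \<alpha> in auto)
    ultimately have "((\<lambda>s. (t - s) powr (\<alpha> - 1)) has_integral (t powr \<alpha> / \<alpha>)) {0<..<t}"
      by (subst has_integral_cong[of _ _ "\<lambda>s. s powr (1 - 1) * (t - s) powr (\<alpha> - 1)"]) auto
    then have "has_bochner_integral (lebesgue_on {0<..<t}) (\<lambda>s. (t - s) powr (\<alpha> - 1)) (t powr \<alpha> / \<alpha>)"
      by (rule has_bochner_integral_lebesgue_on_nonneg) auto
    moreover have "has_bochner_integral (lebesgue_on {0<..<t}) (\<lambda>s. (t - s) powr (\<alpha> - 1) * g s) (Gamma \<alpha> * (1 - g t) / y)"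
      using mittag_leffler_volterra[OF \<alpha>(1) t, of y] y by (auto simp: has_bochner_integral_iff g_def field_simps)
    ultimately have "has_bochner_integral (lebesgue_on {0<..<t}) (\<lambda>s. (t - s) powr (\<alpha> - 1) + (t - s) powr (\<alpha> - 1) * g s) (F t)"
      unfolding F_def by (rule has_bochner_integral_add)
    then have *: "has_bochner_integral (lebesgue_on {0<..<t}) (\<lambda>s. (t - s) powr (\<alpha> - 1) * (1 + g s)) (F t)"
      by (simp add: algebra_simps)
    have "(\<integral>\<^sup>+s. ennreal ((t - s) powr (\<alpha> - 1) * (1 + g s)) \<partial>lebesgue_on {0<..<t}) = ennreal (F t)"
      using * g0 by (subst nn_integral_eq_integral) (auto simp: has_bochner_integral_iff)
    moreover have "(\<integral>\<^sup>+s. ennreal ((t - s) powr (\<alpha> - 1) * (1 + g s)) \<partial>lebesgue_on {0<..<t})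
        = (\<integral>\<^sup>+s. ennreal ((t - s) powr (\<alpha> - 1) * (1 + g s)) * indicator {0<..<t} s \<partial>lebesgue)"
      by (simp add: nn_integral_restrict_space)
    moreover have "\<dots> = (\<integral>\<^sup>+s. ennreal (frac_kernel \<alpha> (t - s)) * h s \<partial>lebesgue)"
      using g0 by (intro nn_integral_cong) (auto simp: h_def frac_kernel_def ennreal_mult[symmetric] split: split_indicator)
    moreover have "\<dots> = (\<integral>\<^sup>+s. ennreal (frac_kernel \<alpha> (t - s)) * h s \<partial>lborel)"
      by (rule nn_integral_completion)
    ultimately show ?thesis by simp
  qed
  have inner0: "(\<integral>\<^sup>+s. ennreal (frac_kernel \<alpha> (t - s)) * h s \<partial>lborel) = 0" if t: "t \<le> 0" for t
  proof -
    have z: "ennreal (frac_kernel \<alpha> (t - s)) * h s = 0" for s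
      using t by (auto simp: frac_kernel_def h_def split: split_indicator)
    show ?thesis unfolding z by simp
  qed
  have F0: "F t \<ge> 0" for t
    using g1[of t] \<alpha> G y unfolding F_def by (auto simp: abs_le_iff)
  have Fm [measurable]: "F \<in> borel_measurable borel" unfolding F_def by measurable
  have Fi: "has_bochner_integral ?M (\<lambda>t. exp (- t) * F t) (Gamma (\<alpha> + 1) / \<alpha> + Gamma \<alpha> * (1 - I) / y)"
  proof -
    have "has_bochner_integral ?M (\<lambda>t. exp (- t) * t powr \<alpha> / \<alpha> + (Gamma \<alpha> / y) * (exp (- t) - exp (- t) * g t)) (Gamma (\<alpha> + 1) / \<alpha> + (Gamma \<alpha> / y) * (1 - I))"
      using eg by (intro has_bochner_integral_add has_bochner_integral_divide has_bochner_integral_mult_right has_bochner_integral_diff ea e1)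
        (auto simp: has_bochner_integral_iff I_def)
    then show ?thesis by (simp add: F_def algebra_simps diff_divide_distrib add_divide_distrib)
  qed
  have Hi: "has_bochner_integral ?M (\<lambda>t. exp (- t) * (1 + g t)) (1 + I)"
    using has_bochner_integral_add[OF e1, of "\<lambda>u. exp (- u) * g u" I] eg
    by (auto simp: has_bochner_integral_iff I_def algebra_simps)
  have toM: "(\<integral>\<^sup>+t. ennreal (f t) * indicator {0<..} t \<partial>lborel) = ennreal J"
    if "has_bochner_integral ?M f J" "\<And>t. f t \<ge> 0" and [measurable]: "f \<in> borel_measurable borel" for f :: "real \<Rightarrow> real" and J
  proof -
    have "ennreal J = (\<integral>\<^sup>+t. ennreal (f t) \<partial>?M)"
      using that by (subst nn_integral_eq_integral) (auto simp: has_bochner_integral_iff)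
    also have "\<dots> = (\<integral>\<^sup>+t. ennreal (f t) * indicator {0<..} t \<partial>lebesgue)"
      by (simp add: nn_integral_restrict_space)
    also have "\<dots> = (\<integral>\<^sup>+t. ennreal (f t) * indicator {0<..} t \<partial>lborel)"
      by (rule nn_integral_completion)
    finally show ?thesis by simp
  qed
  have "ennreal (Gamma (\<alpha> + 1) / \<alpha> + Gamma \<alpha> * (1 - I) / y) = (\<integral>\<^sup>+t. ennreal (exp (- t) * F t) * indicator {0<..} t \<partial>lborel)"
    by (rule toM[OF Fi, symmetric]) (use F0 in auto)
  also have "\<dots> = (\<integral>\<^sup>+t. ennreal (exp (- 1 * t)) * (\<integral>\<^sup>+s. ennreal (frac_kernel \<alpha> (t - s)) * h s \<partial>lborel) \<partial>lborel)"
    using inner inner0 F0 by (intro nn_integral_cong) (auto simp: ennreal_mult split: split_indicator)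
  also have "\<dots> = ennreal (Gamma \<alpha>) * (\<integral>\<^sup>+s. ennreal (exp (- 1 * s)) * h s \<partial>lborel)"
    by (subst nn_integral_exp_frac_integral) (use \<alpha> in auto)
  also have "(\<integral>\<^sup>+s. ennreal (exp (- 1 * s)) * h s \<partial>lborel) = (\<integral>\<^sup>+s. ennreal (exp (- s) * (1 + g s)) * indicator {0<..} s \<partial>lborel)"
    by (intro nn_integral_cong) (auto simp: h_def ennreal_mult' split: split_indicator)
  also have "\<dots> = ennreal (1 + I)"
    by (rule toM[OF Hi]) (use g0 in auto)
  finally have E: "ennreal (Gamma (\<alpha> + 1) / \<alpha> + Gamma \<alpha> * (1 - I) / y) = ennreal (Gamma \<alpha>) * ennreal (1 + I)" .
  have "\<bar>I\<bar> \<le> 1"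
  proof -
    have "\<bar>I\<bar> \<le> (LINT u|?M. norm (exp (- u) * g u))" unfolding I_def using integral_norm_bound by fastforce
    also have "\<dots> \<le> (LINT u|?M. exp (- u))"
      using e1 g1 by (intro integral_mono integrable_norm[OF eg]) (auto simp: has_bochner_integral_iff abs_mult)
    finally show ?thesis using e1 by (simp add: has_bochner_integral_iff)
  qed
  then have I: "0 \<le> 1 + I" "0 \<le> 1 - I" by auto
  have "0 \<le> Gamma (\<alpha> + 1) / \<alpha> + Gamma \<alpha> * (1 - I) / y" "0 \<le> Gamma \<alpha> * (1 + I)"
    using I G \<alpha> y unfolding Gamma_p1 by auto
  moreover have "ennreal (Gamma \<alpha> * (1 + I)) = ennreal (Gamma \<alpha>) * ennreal (1 + I)"
    using I G by (intro ennreal_mult) auto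
  ultimately have "Gamma (\<alpha> + 1) / \<alpha> + Gamma \<alpha> * (1 - I) / y = Gamma \<alpha> * (1 + I)"
    using E by (metis ennreal_inj)
  then have "Gamma \<alpha> * ((1 - I) / y) = Gamma \<alpha> * I" using \<alpha> Gamma_p1 by (simp add: algebra_simps)
  then have "(1 - I) / y = I" using G by (metis mult_left_cancel less_irrefl)
  then have "I = 1 / (1 + y)" using y by (simp add: field_simps)
  then show ?thesis using eg unfolding I_def g_def by (simp add: has_bochner_integral_iff)
qed

section \<open>Mittag-Leffler series and the uniqueness of their coefficients\<close>

lemma mittag_leffler_series:
  fixes b lam :: "nat \<Rightarrow> real"
  assumes \<alpha>: "0 < \<alpha>" "\<alpha> < 1" and b: "summable (\<lambda>n. \<bar>b n\<bar>)" and lam: "\<And>n. lam n > 0"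
  defines "F \<equiv> \<lambda>z::complex. \<Sum>n. of_real (b n) * mittag_leffler \<alpha> (- of_real (lam n) * z)"
  shows "F holomorphic_on {z. Re z > 0}" and "continuous_on {z. Re z \<ge> 0} F"
    and "y \<ge> 0 \<Longrightarrow> summable (\<lambda>n. \<bar>b n * mittag_leffler \<alpha> (- lam n * y)\<bar>)"
    and "y \<ge> 0 \<Longrightarrow> F (of_real y) = of_real (\<Sum>n. b n * mittag_leffler \<alpha> (- lam n * y))"
proof -
  let ?f = "\<lambda>n z. of_real (b n) * mittag_leffler \<alpha> (- of_real (lam n) * z) :: complex"
  have bound: "norm (?f n z) \<le> \<bar>b n\<bar>" if "Re z \<ge> 0" for n z
  proof -
    have "norm (mittag_leffler \<alpha> (- (of_real (lam n) * z))) \<le> 1"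
      using that lam[of n] by (intro norm_mittag_leffler_le_1 \<alpha>) auto
    then show ?thesis by (simp add: norm_mult mult_left_le)
  qed
  have unif: "uniform_limit {z. Re z \<ge> 0} (\<lambda>N z. \<Sum>n<N. ?f n z) F sequentially"
    unfolding F_def by (rule Weierstrass_m_test[OF _ b]) (use bound in auto)
  show "continuous_on {z. Re z \<ge> 0} F"
    by (rule uniform_limit_theorem[OF always_eventually unif])
       (auto intro!: continuous_intros continuous_on_mittag_leffler_complex \<alpha>)
  show "F holomorphic_on {z. Re z > 0}"
  proof (rule holomorphic_uniform_sequence[where f = "\<lambda>N z. \<Sum>n<N. ?f n z"])
    show "open {z. Re z > 0}" by (rule open_halfspace_Re_gt)
    have "(\<lambda>z. mittag_leffler \<alpha> (- of_real (lam n) * z)) holomorphic_on A" for n A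
      using holomorphic_on_compose_gen[OF _ holomorphic_mittag_leffler[OF \<alpha>(1), of UNIV], of "\<lambda>z. - of_real (lam n) * z" A]
      by (auto simp: o_def intro!: holomorphic_intros)
    then show "(\<lambda>z. \<Sum>n<N. ?f n z) holomorphic_on {z. Re z > 0}" for N
      by (intro holomorphic_intros)
    fix x :: complex
    assume x: "x \<in> {z. Re z > 0}"
    have sub: "cball x (Re x / 2) \<subseteq> {z. Re z > 0}"
    proof
      fix z assume "z \<in> cball x (Re x / 2)"
      then have "norm (x - z) \<le> Re x / 2" by (simp add: dist_norm)
      then have "Re (x - z) \<le> Re x / 2" using complex_Re_le_cmod[of "x - z"] by linarith
      then show "z \<in> {z. Re z > 0}" using x by simp
    qed
    then have "uniform_limit (cball x (Re x / 2)) (\<lambda>N z. \<Sum>n<N. ?f n z) F sequentially"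
      by (intro uniform_limit_on_subset[OF unif]) auto
    then show "\<exists>d>0. cball x d \<subseteq> {z. 0 < Re z} \<and> uniform_limit (cball x d) (\<lambda>N z. \<Sum>n<N. ?f n z) F sequentially"
      using sub x by (intro exI[of _ "Re x / 2"]) auto
  qed
  have eq: "?f n (of_real y) = of_real (b n * mittag_leffler \<alpha> (- lam n * y))" for n y
    using mittag_leffler_of_real[OF \<alpha>(1), of "- lam n * y", where 'a = complex] by simp
  show sm: "summable (\<lambda>n. \<bar>b n * mittag_leffler \<alpha> (- lam n * y)\<bar>)" if "y \<ge> 0" for y
  proof (rule summable_comparison_test'[OF b])
    show "norm \<bar>b n * mittag_leffler \<alpha> (- lam n * y)\<bar> \<le> \<bar>b n\<bar>" for n
      using bound[of "of_real y" n] that unfolding eq by (simp only: norm_of_real real_norm_def abs_idempotent Re_complex_of_real)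
  qed
  show "F (of_real y) = of_real (\<Sum>n. b n * mittag_leffler \<alpha> (- lam n * y))" if "y \<ge> 0" for y
    unfolding F_def eq by (rule suminf_of_real[OF summable_rabs_cancel[OF sm[OF that]], symmetric])
qed

lemma continuous_on_mittag_leffler_series:
  fixes b lam :: "nat \<Rightarrow> real"
  assumes \<alpha>: "0 < \<alpha>" "\<alpha> < 1" and b: "summable (\<lambda>n. \<bar>b n\<bar>)" and lam: "\<And>n. lam n > 0"
  shows "continuous_on {0..} (\<lambda>y. \<Sum>n. b n * mittag_leffler \<alpha> (- lam n * y))"
proof -
  define F where "F = (\<lambda>z::complex. \<Sum>n. of_real (b n) * mittag_leffler \<alpha> (- of_real (lam n) * z))"
  have cont: "continuous_on {z. Re z \<ge> 0} F"
    unfolding F_def by (rule mittag_leffler_series(2)[OF \<alpha> b lam])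
  have "continuous_on {0..} (\<lambda>y. Re (F (of_real y)))"
    by (intro continuous_on_Re continuous_on_compose2[OF cont] continuous_on_of_real continuous_on_id) auto
  then show ?thesis
  proof (rule continuous_on_eq)
    fix y :: real assume "y \<in> {0..}"
    then show "Re (F (of_real y)) = (\<Sum>n. b n * mittag_leffler \<alpha> (- lam n * y))"
      unfolding F_def by (subst mittag_leffler_series(4)[OF \<alpha> b lam]) auto
  qed
qed

text \<open>Iteration gives \<open>f y = f (r ^ k * y)\<close>, and \<open>r < 1\<close> keeps all
  these points below \<open>d\<close> while they tend to 0.\<close>

lemma scale_invariant_imp_eq_at_0:
  fixes f :: "real \<Rightarrow> 'a::t2_space"
  assumes cont: "continuous_on {0..} f" and r: "0 < r" "r < 1"
    and inv: "\<And>y. 0 < y \<Longrightarrow> y < d \<Longrightarrow> f y = f (r * y)" and y: "0 < y" "y < d"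
  shows "f y = f 0"
proof -
  have *: "f y = f (r ^ k * y) \<and> r ^ k * y < d" for k
  proof (induction k)
    case 0
    then show ?case using y by simp
  next
    case (Suc k)
    have "0 < r ^ k * y" using r y by simp
    then have "f (r ^ k * y) = f (r * (r ^ k * y))" using Suc by (intro inv) auto
    moreover have "r * (r ^ k * y) \<le> 1 * (r ^ k * y)" using r y by (intro mult_right_mono) auto
    ultimately show ?case using Suc by (simp add: mult.assoc)
  qed
  have "(\<lambda>k. r ^ k * y) \<longlonglongrightarrow> 0 * y"
    using r by (intro tendsto_mult tendsto_const LIMSEQ_power_zero) auto
  then have "(\<lambda>k. r ^ k * y) \<longlonglongrightarrow> 0" by simp
  then have "(\<lambda>k. f (r ^ k * y)) \<longlonglongrightarrow> f 0"
    using r y by (intro continuous_on_tendsto_compose[OF cont]) auto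
  then have "(\<lambda>k. f y) \<longlonglongrightarrow> f 0" using * by simp
  then show ?thesis by (rule LIMSEQ_const_iff[THEN iffD1])
qed

text \<open>The hypothesis says that \<open>F z = (\<Sum>n. b n * E\<^sub>\<alpha> (- lam n * z))\<close> satisfies \<open>F z = F (a\<^sub>2 / a\<^sub>1 * z)\<close>
  for small positive \<open>z\<close>. By continuity at 0 it is constant there, and by analyticity on the right half-plane;
  a Laplace transform then yields a constant Stieltjes series.\<close>

lemma mittag_leffler_series_scaling_imp_eq_0:
  fixes b lam :: "nat \<Rightarrow> real"
  assumes \<alpha>: "0 < \<alpha>" "\<alpha> < 1" and b: "summable (\<lambda>n. \<bar>b n\<bar>)" and lam: "strict_mono lam" "lam 0 > 0"
    and a: "0 < a2" "a2 < a1" and \<delta>: "\<delta> > 0"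
    and eq: "\<And>y. 0 < y \<Longrightarrow> y < \<delta> \<Longrightarrow>
      (\<Sum>n. b n * mittag_leffler \<alpha> (- (a1 * lam n) * y)) = (\<Sum>n. b n * mittag_leffler \<alpha> (- (a2 * lam n) * y))"
  shows "b n = 0"
proof -
  have pos: "lam n > 0" for n
    using lam strict_mono_less_eq[OF lam(1), of 0 n] by simp
  define F where "F z = (\<Sum>n. of_real (b n) * mittag_leffler \<alpha> (- of_real (lam n) * z))" for z :: complex
  define f where "f y = (\<Sum>n. b n * mittag_leffler \<alpha> (- lam n * y))" for y
  have F: "F = (\<lambda>z. \<Sum>n. of_real (b n) * mittag_leffler \<alpha> (- of_real (lam n) * z))"
    by (simp add: F_def fun_eq_iff)
  have hol: "F holomorphic_on {z. Re z > 0}"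
    unfolding F by (rule mittag_leffler_series[OF \<alpha> b pos])
  have sm: "summable (\<lambda>n. \<bar>b n * mittag_leffler \<alpha> (- lam n * y)\<bar>)"
    and Fr: "F (of_real y) = of_real (f y)" if "y \<ge> 0" for y
    unfolding F f_def by (rule mittag_leffler_series(3,4)[OF \<alpha> b pos that])+
  have contf: "continuous_on {0..} f"
    unfolding f_def[abs_def] by (rule continuous_on_mittag_leffler_series[OF \<alpha> b pos])
  \<comment> \<open>The substitution of \<open>a1 * y\<close> for the argument leaves only the ratio
    of the two coefficients.\<close>
  have inv: "f y = f (a2 / a1 * y)" if "0 < y" "y < a1 * \<delta>" for y
  proof -
    have "f (a1 * (y / a1)) = f (a2 * (y / a1))"
      using eq[of "y / a1"] that a unfolding f_def by (simp add: field_simps)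
    then show ?thesis using a by simp
  qed
  have const0: "f y = f 0" if "0 < y" "y < a1 * \<delta>" for y
    by (rule scale_invariant_imp_eq_at_0[OF contf _ _ inv that]) (use a in auto)
  have Fc: "F w - of_real (f 0) = 0" if w: "Re w > 0" for w
  proof (rule analytic_continuation[where f = "\<lambda>w. F w - of_real (f 0)" and w = w and S = "{z. Re z > 0}" and U = "of_real ` {0<..<a1 * \<delta>}" and \<xi> = "of_real (a1 * \<delta> / 2)"])
    show "(\<lambda>w. F w - of_real (f 0)) holomorphic_on {z. Re z > 0}"
      by (intro holomorphic_intros hol)
    show "open {z. Re z > 0}" by (rule open_halfspace_Re_gt)
    show "connected {z. Re z > 0}" by (rule convex_connected[OF convex_halfspace_Re_gt])
    show "complex_of_real ` {0<..<a1 * \<delta>} \<subseteq> {z. Re z > 0}" by auto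
    show "complex_of_real (a1 * \<delta> / 2) \<in> {z. Re z > 0}" using a \<delta> by simp
    \<comment> \<open>The accumulation point has to lie inside the half-plane; 0 is only on its
      boundary, so the midpoint of the interval is used.\<close>
    show "complex_of_real (a1 * \<delta> / 2) islimpt of_real ` {0<..<a1 * \<delta>}"
    proof -
      have "(a1 * \<delta> / 2) islimpt {0<..<a1 * \<delta>}" using a \<delta> by (intro interior_limit_point) auto
      then show ?thesis
        by (rule islimpt_isCont_image) (auto simp: eventually_at_filter simp del: of_real_mult of_real_divide)
    qed
    show "F z - of_real (f 0) = 0" if "z \<in> complex_of_real ` {0<..<a1 * \<delta>}" for z
      using that const0 by (auto simp: Fr)
    show "w \<in> {z. Re z > 0}" using w by simp
  qed
  have const: "f y = f 0" if "y > 0" for y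
    using Fc[of "of_real y"] that by (simp add: Fr flip: of_real_diff)
  show ?thesis
  proof (rule stieltjes_series_const_imp_eq_0[OF b lam])
    fix y :: real assume y: "y > 0"
    let ?M = "lebesgue_on {0<..} :: real measure"
    \<comment> \<open>The terms of \<open>exp (- u) * f (y * u powr \<alpha>)\<close>, which equals
      \<open>exp (- u) * f 0\<close>. Integrating in \<open>u\<close> term by term turns the
      \<open>n\<close>-th one into \<open>b n / (1 + lam n * y)\<close>.\<close>
    define h where "h n u = b n * (exp (- u) * mittag_leffler \<alpha> (- (lam n * y) * u powr \<alpha>))" for n u
    have hi: "has_bochner_integral ?M (h n) (b n * (1 / (1 + lam n * y)))" for n
      unfolding h_def using pos[of n] y by (intro has_bochner_integral_mult_right laplace_mittag_leffler \<alpha>) auto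
    have e1: "has_bochner_integral ?M (\<lambda>u. exp (- u)) 1"
    proof (rule has_bochner_integral_lebesgue_on_nonneg)
      show "((\<lambda>u. exp (- u)) has_integral 1) ({0<..} :: real set)"
        using has_integral_exp_minus_to_infinity[of 1 0] by (intro has_integral_Ici_imp_Ioi) simp
    qed auto
    have hb: "norm (h n u) \<le> \<bar>b n\<bar> * exp (- u)" for n u
    proof -
      have "\<bar>mittag_leffler \<alpha> (- (lam n * y * u powr \<alpha>))\<bar> \<le> 1"
        using pos[of n] y by (intro abs_mittag_leffler_le_1 \<alpha>) auto
      then have "\<bar>exp (- u) * mittag_leffler \<alpha> (- (lam n * y) * u powr \<alpha>)\<bar> \<le> exp (- u)"
        by (simp add: abs_mult)
      then show ?thesis unfolding h_def real_norm_def abs_mult[of "b n"] by (rule mult_left_mono) simp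
    qed
    have hn: "(LINT u|?M. norm (h n u)) \<le> \<bar>b n\<bar>" for n
    proof -
      have "(LINT u|?M. norm (h n u)) \<le> (LINT u|?M. \<bar>b n\<bar> * exp (- u))"
        using hi[of n] e1 hb by (intro integral_mono) (auto simp: has_bochner_integral_iff)
      also have "\<dots> = \<bar>b n\<bar>" using e1 by (simp add: has_bochner_integral_iff)
      finally show ?thesis .
    qed
    have "(\<lambda>n. integral\<^sup>L ?M (h n)) sums (LINT u|?M. (\<Sum>n. h n u))"
    proof (rule sums_integral)
      show "integrable ?M (h n)" for n using hi by (simp add: has_bochner_integral_iff)
      show "AE u in ?M. summable (\<lambda>n. norm (h n u))"
        by (intro AE_I2 summable_comparison_test'[OF summable_mult2[OF b]]) (use hb in auto)
      show "summable (\<lambda>n. LINT u|?M. norm (h n u))"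
        by (rule summable_comparison_test'[OF b]) (use hn in \<open>auto simp: abs_of_nonneg\<close>)
    qed
    moreover have "(\<Sum>n. h n u) = exp (- u) * f 0" if u: "u > 0" for u
    proof -
      have e: "h n u = exp (- u) * (b n * mittag_leffler \<alpha> (- lam n * (y * u powr \<alpha>)))" for n
        by (simp add: h_def mult_ac)
      have "(\<Sum>n. h n u) = exp (- u) * f (y * u powr \<alpha>)"
        unfolding e f_def using sm[of "y * u powr \<alpha>"] y by (intro suminf_mult) (auto intro: summable_rabs_cancel)
      then show ?thesis using const[of "y * u powr \<alpha>"] y u by simp
    qed
    then have "(LINT u|?M. (\<Sum>n. h n u)) = (LINT u|?M. exp (- u) * f 0)"
      by (intro Bochner_Integration.integral_cong) auto
    ultimately have "(\<lambda>n. integral\<^sup>L ?M (h n)) sums f 0"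
      using e1 by (simp add: has_bochner_integral_iff)
    then show "(\<Sum>n. b n / (1 + lam n * y)) = f 0"
      using hi by (simp add: has_bochner_integral_iff sums_iff)
  qed
qed

section \<open>Smooth cutoff functions\<close>

text \<open>The powers of \<open>1 / x\<close> are built in so that the family is closed under
  differentiation up to linear combinations.\<close>

definition flat :: "nat \<Rightarrow> real \<Rightarrow> real" where
  "flat k x = (if x > 0 then exp (- 1 / x) / x ^ k else 0)"

lemma flat_tendsto_0: "(flat k \<longlongrightarrow> 0) (at 0)"
proof (rule filterlim_split_at_real)
  have "eventually (\<lambda>x. flat k x = 0) (at_left (0::real))"
    by (auto simp: eventually_at_filter flat_def)
  then show "(flat k \<longlongrightarrow> 0) (at_left 0)" by (rule tendsto_eventually)
  have "((\<lambda>x. (inverse x) ^ k / exp (inverse x)) \<longlongrightarrow> (0::real)) (at_right 0)"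
    by (rule filterlim_compose[OF tendsto_power_div_exp_0 filterlim_inverse_at_top_right])
  moreover have "eventually (\<lambda>x. (inverse x) ^ k / exp (inverse x) = flat k x) (at_right (0::real))"
    by (auto simp: eventually_at_filter flat_def exp_minus field_simps)
  ultimately show "(flat k \<longlongrightarrow> 0) (at_right 0)" by (rule Lim_transform_eventually)
qed

lemma DERIV_flat: "(flat k has_real_derivative flat (k + 2) x - real k * flat (k + 1) x) (at x)"
proof (cases x "0::real" rule: linorder_cases)
  case less
  have "((\<lambda>_. 0) has_real_derivative 0) (at x)" by simp
  then have "(flat k has_real_derivative 0) (at x)"
    by (rule has_field_derivative_transform_within_open[of _ _ _ "{..<0}"]) (use less in \<open>auto simp: flat_def\<close>)
  then show ?thesis using less by (simp add: flat_def)
next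
  case equal
  \<comment> \<open>The difference quotient of \<open>flat k\<close> at 0 is
    \<open>flat (Suc k)\<close>, so the limit is already known.\<close>
  have "((\<lambda>h. (flat k (0 + h) - flat k 0) / h) \<longlongrightarrow> 0) (at 0)"
  proof (rule Lim_transform_eventually[OF flat_tendsto_0[of "Suc k"]])
    show "\<forall>\<^sub>F h in at 0. flat (Suc k) h = (flat k (0 + h) - flat k 0) / h"
      by (auto simp: eventually_at_filter flat_def)
  qed
  then show ?thesis using equal by (simp add: DERIV_def flat_def)
next
  case greater
  have "((\<lambda>x. exp (- 1 / x) / x ^ k) has_real_derivative
      exp (- 1 / x) / x ^ (k + 2) - real k * (exp (- 1 / x) / x ^ (k + 1))) (at x)"
  proof (cases k)
    case 0
    then show ?thesis using greater
      by (auto intro!: derivative_eq_intros simp: power2_eq_square)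
  next
    case (Suc m)
    then show ?thesis using greater
      by (auto intro!: derivative_eq_intros simp: field_simps power2_eq_square) (cases m; simp)
  qed
  then have "(flat k has_real_derivative
      exp (- 1 / x) / x ^ (k + 2) - real k * (exp (- 1 / x) / x ^ (k + 1))) (at x)"
    by (rule has_field_derivative_transform_within_open[of _ _ _ "{0<..}"]) (use greater in \<open>auto simp: flat_def\<close>)
  then show ?thesis using greater by (simp add: flat_def)
qed

text \<open>An algebra of smooth functions that is closed under differentiation and contains what is
  needed below: polynomials, trigonometric functions and cutoff functions.\<close>

inductive_set smooth_alg :: "(real \<Rightarrow> real) set" where
  affine: "(\<lambda>x. a * x + b) \<in> smooth_alg"
| sin: "(\<lambda>x. sin (a * x + b)) \<in> smooth_alg"
| cos: "(\<lambda>x. cos (a * x + b)) \<in> smooth_alg"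
| flat: "(\<lambda>x. flat k (a * x + b)) \<in> smooth_alg"
| add: "f \<in> smooth_alg \<Longrightarrow> g \<in> smooth_alg \<Longrightarrow> (\<lambda>x. f x + g x) \<in> smooth_alg"
| mult: "f \<in> smooth_alg \<Longrightarrow> g \<in> smooth_alg \<Longrightarrow> (\<lambda>x. f x * g x) \<in> smooth_alg"
| inverse: "f \<in> smooth_alg \<Longrightarrow> (\<And>x. f x \<noteq> 0) \<Longrightarrow> (\<lambda>x. 1 / f x) \<in> smooth_alg"

lemma smooth_alg_const: "(\<lambda>x. c) \<in> smooth_alg"
  using smooth_alg.affine[of 0 c] by simp

lemma smooth_alg_cmult: "f \<in> smooth_alg \<Longrightarrow> (\<lambda>x. c * f x) \<in> smooth_alg"
  by (rule smooth_alg.mult[OF smooth_alg_const])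

lemma smooth_alg_DERIV_ex:
  assumes "f \<in> smooth_alg"
  shows "\<exists>f'\<in>smooth_alg. \<forall>x. (f has_real_derivative f' x) (at x)"
  using assms
proof induction
  case (affine a b)
  have "((\<lambda>x. a * x + b) has_real_derivative a) (at x)" for x by (auto intro!: derivative_eq_intros)
  then show ?case using smooth_alg_const[of a] by (auto intro!: bexI[of _ "\<lambda>_. a"])
next
  case (sin a b)
  have "((\<lambda>x. sin (a * x + b)) has_real_derivative a * cos (a * x + b)) (at x)" for x
    by (auto intro!: derivative_eq_intros)
  then show ?case
    by (intro bexI[of _ "\<lambda>x. a * cos (a * x + b)"] allI smooth_alg_cmult smooth_alg.cos)
next
  case (cos a b)
  have "((\<lambda>x. cos (a * x + b)) has_real_derivative (- a) * sin (a * x + b)) (at x)" for x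
    by (auto intro!: derivative_eq_intros)
  then show ?case
    by (intro bexI[of _ "\<lambda>x. (- a) * sin (a * x + b)"] allI smooth_alg_cmult smooth_alg.sin)
next
  case (flat k a b)
  have "((\<lambda>x. flat k (a * x + b)) has_real_derivative
      a * (flat (k + 2) (a * x + b) + (- real k) * flat (k + 1) (a * x + b))) (at x)" for x
  proof -
    have "((\<lambda>x. a * x + b) has_real_derivative a) (at x)" by (auto intro!: derivative_eq_intros)
    from DERIV_chain2[where f = "flat k", OF DERIV_flat this] show ?thesis by (simp add: mult.commute)
  qed
  then show ?case
    by (intro bexI[of _ "\<lambda>x. a * (flat (k + 2) (a * x + b) + (- real k) * flat (k + 1) (a * x + b))"]
        allI smooth_alg_cmult smooth_alg.add smooth_alg.flat)
next
  case (add f g)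
  then obtain f' g' where "f' \<in> smooth_alg" "g' \<in> smooth_alg"
    "\<And>x. (f has_real_derivative f' x) (at x)" "\<And>x. (g has_real_derivative g' x) (at x)" by blast
  then show ?case by (intro bexI[of _ "\<lambda>x. f' x + g' x"] smooth_alg.add allI DERIV_add)
next
  case (mult f g)
  then obtain f' g' where *: "f' \<in> smooth_alg" "g' \<in> smooth_alg"
    "\<And>x. (f has_real_derivative f' x) (at x)" "\<And>x. (g has_real_derivative g' x) (at x)" by blast
  then show ?case using mult.hyps
    by (intro bexI[of _ "\<lambda>x. f' x * g x + g' x * f x"] smooth_alg.add smooth_alg.mult allI DERIV_mult)
next
  case (inverse f)
  then obtain f' where *: "f' \<in> smooth_alg" "\<And>x. (f has_real_derivative f' x) (at x)" by blast
  have "((\<lambda>x. 1 / f x) has_real_derivative - 1 * (f' x * (1 / f x * (1 / f x)))) (at x)" for x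
    using *(2)[of x] inverse.hyps(2)[of x] by (auto intro!: derivative_eq_intros)
  moreover have "(\<lambda>x. - 1 * (f' x * (1 / f x * (1 / f x)))) \<in> smooth_alg"
    using inverse.hyps * by (intro smooth_alg_cmult smooth_alg.mult smooth_alg.inverse) auto
  ultimately show ?case by (intro bexI[of _ "\<lambda>x. - 1 * (f' x * (1 / f x * (1 / f x)))"] allI)
qed

lemma
  assumes "f \<in> smooth_alg"
  shows smooth_alg_deriv: "deriv f \<in> smooth_alg"
    and smooth_alg_DERIV: "(f has_real_derivative deriv f x) (at x)"
proof -
  obtain f' where f': "f' \<in> smooth_alg" "\<And>x. (f has_real_derivative f' x) (at x)"
    using smooth_alg_DERIV_ex[OF assms] by blast
  then have "deriv f = f'" by (auto simp: fun_eq_iff intro: DERIV_imp_deriv)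
  then show "deriv f \<in> smooth_alg" "(f has_real_derivative deriv f x) (at x)" using f' by auto
qed

lemma smooth_alg_continuous: "f \<in> smooth_alg \<Longrightarrow> continuous_on A f"
  using smooth_alg_DERIV DERIV_isCont continuous_at_imp_continuous_on by blast

lemma smooth_alg_funpow_deriv: "f \<in> smooth_alg \<Longrightarrow> (deriv ^^ n) f \<in> smooth_alg"
  by (induction n) (auto intro: smooth_alg_deriv)

lemma smooth_alg_test_function:
  assumes "f \<in> smooth_alg" "compact K" "K \<subseteq> S" "\<And>x. x \<notin> K \<Longrightarrow> f x = 0"
  shows "f \<in> test_functions S"
proof -
  have "(deriv ^^ n) f differentiable_on UNIV" for n
    using smooth_alg_DERIV[OF smooth_alg_funpow_deriv[OF assms(1), of n]]
    by (auto simp: differentiable_on_def real_differentiable_def)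
  then show ?thesis using assms(2-4) by (auto simp: test_functions_def)
qed

text \<open>The usual smooth transition on the unit interval; the denominator is positive because
  \<open>x\<close> and \<open>1 - x\<close> are never both nonpositive.\<close>

definition smooth_step :: "real \<Rightarrow> real" where
  "smooth_step x = flat 0 x / (flat 0 x + flat 0 (1 - x))"

lemma flat_0_nonneg: "flat 0 x \<ge> 0" by (simp add: flat_def)

lemma flat_sum_pos: "flat 0 x + flat 0 (1 - x) > 0"
  by (cases "x > 0") (auto simp: flat_def add_pos_pos add_pos_nonneg)

lemma smooth_step_bounds: "0 \<le> smooth_step x" "smooth_step x \<le> 1"
  using flat_sum_pos[of x] flat_0_nonneg[of x] flat_0_nonneg[of "1 - x"]
  by (auto simp: smooth_step_def divide_le_eq)

lemma smooth_step_eq_0: "x \<le> 0 \<Longrightarrow> smooth_step x = 0"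
  by (simp add: smooth_step_def flat_def)

lemma smooth_step_eq_1: "x \<ge> 1 \<Longrightarrow> smooth_step x = 1"
  by (simp add: smooth_step_def flat_def)

lemma smooth_step_affine: "(\<lambda>x. smooth_step (a * x + b)) \<in> smooth_alg"
proof -
  have "(\<lambda>x. flat 0 (a * x + b) * (1 / (flat 0 (a * x + b) + flat 0 ((- a) * x + (1 - b))))) \<in> smooth_alg"
  proof (intro smooth_alg.mult smooth_alg.inverse smooth_alg.add smooth_alg.flat)
    fix x
    have "(- a) * x + (1 - b) = 1 - (a * x + b)" by simp
    then show "flat 0 (a * x + b) + flat 0 ((- a) * x + (1 - b)) \<noteq> 0"
      by (metis flat_sum_pos less_irrefl)
  qed
  then show ?thesis by (simp add: smooth_step_def algebra_simps)
qed

lemma smooth_step_smooth: "smooth_step \<in> smooth_alg"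
  using smooth_step_affine[of 1 0] by simp

lemma deriv_smooth_step_eq_0:
  assumes "x < 0 \<or> x > 1"
  shows "deriv smooth_step x = 0"
proof -
  have "((\<lambda>_. smooth_step x) has_real_derivative 0) (at x)" by simp
  then have "(smooth_step has_real_derivative 0) (at x)"
    by (rule has_field_derivative_transform_within_open[of _ _ _ "if x < 0 then {..<0} else {1<..}"])
       (use assms in \<open>auto simp: smooth_step_eq_0 smooth_step_eq_1\<close>)
  then show ?thesis by (rule DERIV_imp_deriv)
qed

lemma deriv_smooth_step_bounded: obtains C where "C \<ge> 0" "\<And>x. \<bar>deriv smooth_step x\<bar> \<le> C"
proof -
  have "continuous_on {0..1} (deriv smooth_step)"
    by (intro smooth_alg_continuous smooth_alg_deriv smooth_step_smooth)
  then have "bounded (deriv smooth_step ` {0..1})"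
    by (intro compact_imp_bounded compact_continuous_image) auto
  then obtain C where C: "\<forall>x\<in>{0..1}. \<bar>deriv smooth_step x\<bar> \<le> C"
    by (auto simp: bounded_iff)
  show ?thesis
  proof (rule that[of "max C 0"])
    show "\<bar>deriv smooth_step x\<bar> \<le> max C 0" for x
      using C[rule_format, of x] deriv_smooth_step_eq_0[of x] by (cases "x \<in> {0..1}") auto
  qed simp
qed

text \<open>The \<open>n\<close>-th cutoff function vanishes within distance \<open>1 / (n + 1)\<close> of the end points and
  is 1 at distance \<open>2 / (n + 1)\<close> and more.\<close>

definition cutoff :: "real \<Rightarrow> real \<Rightarrow> nat \<Rightarrow> real \<Rightarrow> real" where
  "cutoff p q n x = smooth_step (real (Suc n) * (x - p) - 1) * smooth_step (real (Suc n) * (q - x) - 1)"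

lemma cutoff_smooth: "cutoff p q n \<in> smooth_alg"
proof -
  have "(\<lambda>x. smooth_step (real (Suc n) * x + (- real (Suc n) * p - 1)) * smooth_step ((- real (Suc n)) * x + (real (Suc n) * q - 1))) \<in> smooth_alg"
    by (intro smooth_alg.mult smooth_step_affine)
  moreover have "(\<lambda>x. smooth_step (real (Suc n) * x + (- real (Suc n) * p - 1)) * smooth_step ((- real (Suc n)) * x + (real (Suc n) * q - 1))) = cutoff p q n"
    unfolding cutoff_def by (rule ext, intro arg_cong2[where f = "(*)"] arg_cong[where f = smooth_step]) (auto simp: algebra_simps)
  ultimately show ?thesis by simp
qed

lemma cutoff_bounds: "0 \<le> cutoff p q n x" "cutoff p q n x \<le> 1"
  using smooth_step_bounds by (auto simp: cutoff_def intro!: mult_le_one)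

text \<open>Equality on a neighbourhood rather than at the point, so that derivatives of products
  with the cutoff agree eventually as well.\<close>

lemma cutoff_tendsto_1:
  assumes "x \<in> {p<..<q}"
  shows "\<forall>\<^sub>F n in sequentially. \<forall>\<^sub>F y in nhds x. cutoff p q n y = 1"
proof -
  \<comment> \<open>With half the distance to the boundary, all points within \<open>d\<close> of
    \<open>x\<close> keep distance \<open>d\<close> from both ends, and
    \<open>2 \<le> real (Suc n) * d\<close> pushes both step arguments past 1.\<close>
  define d where "d = min (x - p) (q - x) / 2"
  have d: "d > 0" using assms by (simp add: d_def)
  have "\<forall>\<^sub>F n in sequentially. 2 / d \<le> real n"
    by (rule eventually_ge_at_top[THEN eventually_mono, of "nat \<lceil>2 / d\<rceil>"]) linarith
  then show ?thesis
  proof eventually_elim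
    case (elim n)
    then have n: "2 \<le> real (Suc n) * d" using d by (simp add: field_simps)
    have "cutoff p q n y = 1" if "y \<in> {x - d<..<x + d}" for y
    proof -
      have "d \<le> y - p" "d \<le> q - y" using that by (auto simp: d_def min_def field_simps split: if_splits)
      then have *: "real (Suc n) * d \<le> real (Suc n) * (y - p)" "real (Suc n) * d \<le> real (Suc n) * (q - y)"
        by (auto intro!: mult_left_mono)
      have "smooth_step (real (Suc n) * (y - p) - 1) = 1" "smooth_step (real (Suc n) * (q - y) - 1) = 1"
        by (rule smooth_step_eq_1, use n * in linarith)+
      then show ?thesis by (simp add: cutoff_def del: of_nat_Suc)
    qed
    then show ?case
      using d by (intro eventually_nhds_in_open[of "{x - d<..<x + d}", THEN eventually_mono]) auto
  qed
qed

lemma cutoff_mult_test_function: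
  assumes "f \<in> smooth_alg"
  shows "(\<lambda>x. cutoff p q n x * f x) \<in> test_functions {p<..<q}"
proof (rule smooth_alg_test_function[of _ "{p + 1 / real (Suc n)..q - 1 / real (Suc n)}"])
  show "(\<lambda>x. cutoff p q n x * f x) \<in> smooth_alg" by (intro smooth_alg.mult cutoff_smooth assms)
  define e where "e = 1 / real (Suc n)"
  have "e > 0" by (simp add: e_def)
  then show "{p + 1 / real (Suc n)..q - 1 / real (Suc n)} \<subseteq> {p<..<q}"
    unfolding e_def[symmetric] by auto
  show "cutoff p q n x * f x = 0" if "x \<notin> {p + 1 / real (Suc n)..q - 1 / real (Suc n)}" for x
  proof -
    have "x - p < 1 / real (Suc n) \<or> q - x < 1 / real (Suc n)" using that by auto
    then have "real (Suc n) * (x - p) < 1 \<or> real (Suc n) * (q - x) < 1"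
      by (auto simp: field_simps simp del: of_nat_Suc)
    then show ?thesis by (auto simp: cutoff_def smooth_step_eq_0 simp del: of_nat_Suc)
  qed
qed auto

lemma real_polynomial_function_smooth_alg:
  assumes "real_polynomial_function (g :: real \<Rightarrow> real)"
  shows "g \<in> smooth_alg"
  using assms
proof induction
  case (linear f)
  then obtain c where "f = (\<lambda>x. x * c)" by (auto simp: real_bounded_linear)
  then show ?case using smooth_alg.affine[of c 0] by (simp add: mult.commute)
qed (auto intro: smooth_alg.intros smooth_alg_const)

section \<open>Fundamental lemma of the calculus of variations\<close>

lemma AE_eq_0_if_integral_mult_continuous_eq_0:
  fixes h :: "real \<Rightarrow> real"
  assumes h: "integrable (lebesgue_on {p<..<q}) h"
    and zero: "\<And>k. continuous_on UNIV k \<Longrightarrow> (LINT x|lebesgue_on {p<..<q}. h x * k x) = 0"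
  shows "AE x in lebesgue_on {p<..<q}. h x = 0"
proof -
  let ?M = "lebesgue_on {p<..<q}"
  \<comment> \<open>Testing against the sign of \<open>h\<close> would give the integral of its
    absolute value; the sign is measurable and hence an almost everywhere limit of continuous
    functions.\<close>
  define s where "s x = (if x \<in> {p<..<q} then sgn (h x) else 0)" for x
  have hm [measurable]: "h \<in> borel_measurable ?M" using h by simp
  have "(\<lambda>x. sgn (h x)) \<in> borel_measurable ?M" by measurable
  then have "s \<in> borel_measurable lebesgue"
    unfolding s_def by (subst borel_measurable_if) auto
  then have "s measurable_on UNIV" by (rule lebesgue_measurable_imp_measurable_on) simp
  then obtain N g where N: "negligible N" and g: "\<And>n. continuous_on UNIV (g n)"
    and lim: "\<And>x. x \<notin> N \<Longrightarrow> (\<lambda>n. g n x) \<longlonglongrightarrow> s x"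
    unfolding measurable_on_def by auto
  \<comment> \<open>Truncation to \<open>[-1, 1]\<close> supplies the majorant
    \<open>\<bar>h x\<bar>\<close> and leaves the limit unchanged, since a sign lies in that
    range.\<close>
  define k where "k n x = max (- 1) (min 1 (g n x))" for n x
  have k: "continuous_on UNIV (k n)" "\<bar>k n x\<bar> \<le> 1" for n x
    unfolding k_def using g by (auto intro!: continuous_intros)
  have km: "k n \<in> borel_measurable ?M" for n
    by (intro continuous_imp_measurable_on_sets_lebesgue continuous_on_subset[OF k(1)]) auto
  have "(\<lambda>n. LINT x|?M. h x * k n x) \<longlonglongrightarrow> (LINT x|?M. \<bar>h x\<bar>)"
  proof (rule integral_dominated_convergence)
    show "integrable ?M (\<lambda>x. \<bar>h x\<bar>)" using h by simp
    have "AE x in lebesgue. x \<notin> N" using N by (intro AE_not_in) (simp add: negligible_iff_null_sets)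
    then have "AE x in ?M. x \<notin> N" by (subst AE_restrict_space_iff) auto
    then show "AE x in ?M. (\<lambda>n. h x * k n x) \<longlonglongrightarrow> \<bar>h x\<bar>"
    proof (rule AE_mp, intro AE_I2 impI)
      fix x assume x: "x \<in> space ?M" "x \<notin> N"
      have "(\<lambda>n. h x * max (- 1) (min 1 (g n x))) \<longlonglongrightarrow> h x * max (- 1) (min 1 (s x))"
        by (intro tendsto_intros lim x)
      moreover have "h x * max (- 1) (min 1 (s x)) = \<bar>h x\<bar>"
        using x by (auto simp: s_def sgn_if)
      ultimately show "(\<lambda>n. h x * k n x) \<longlonglongrightarrow> \<bar>h x\<bar>" unfolding k_def by simp
    qed
    show "AE x in ?M. norm (h x * k n x) \<le> \<bar>h x\<bar>" for n
      using k(2) by (auto simp: abs_mult mult_left_le)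
  qed (use km in measurable)
  then have "(LINT x|?M. \<bar>h x\<bar>) = 0"
    using zero[OF k(1)] by (simp add: LIMSEQ_const_iff)
  then show ?thesis
    using h by (subst (asm) integral_nonneg_eq_0_iff_AE) auto
qed

lemma integrable_mult_continuous:
  fixes h f :: "real \<Rightarrow> real"
  assumes h: "integrable (lebesgue_on {p<..<q}) h" and f: "continuous_on UNIV f"
  shows "integrable (lebesgue_on {p<..<q}) (\<lambda>x. h x * f x)"
proof -
  let ?M = "lebesgue_on {p<..<q}"
  have [measurable]: "h \<in> borel_measurable ?M" using h by simp
  have [measurable]: "f \<in> borel_measurable ?M"
    by (intro continuous_imp_measurable_on_sets_lebesgue continuous_on_subset[OF f]) auto
  have "bounded (f ` {p..q})"
    by (intro compact_imp_bounded compact_continuous_image continuous_on_subset[OF f]) auto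
  then obtain B where B: "\<forall>x\<in>{p..q}. \<bar>f x\<bar> \<le> B" by (auto simp: bounded_iff)
  show ?thesis
  proof (rule Bochner_Integration.integrable_bound)
    show "integrable ?M (\<lambda>x. B * \<bar>h x\<bar>)" using h by simp
    show "AE x in ?M. norm (h x * f x) \<le> norm (B * \<bar>h x\<bar>)"
    proof (intro AE_I2)
      fix x assume "x \<in> space ?M"
      then have "\<bar>f x\<bar> \<le> B" by (intro B[rule_format]) auto
      then have "\<bar>h x\<bar> * \<bar>f x\<bar> \<le> \<bar>h x\<bar> * B" by (rule mult_left_mono) simp
      then show "norm (h x * f x) \<le> norm (B * \<bar>h x\<bar>)"
        using \<open>\<bar>f x\<bar> \<le> B\<close> by (simp add: abs_mult mult.commute)
    qed
  qed measurable
qed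

lemma integral_mult_eq_0_if_approx:
  fixes h k :: "real \<Rightarrow> real"
  assumes h: "integrable (lebesgue_on {p<..<q}) h" and k: "continuous_on UNIV k"
    and approx: "\<And>e. e > 0 \<Longrightarrow> \<exists>P. continuous_on UNIV P \<and> (\<forall>x\<in>{p<..<q}. \<bar>k x - P x\<bar> \<le> e) \<and>
      (LINT x|lebesgue_on {p<..<q}. h x * P x) = 0"
  shows "(LINT x|lebesgue_on {p<..<q}. h x * k x) = 0"
proof (rule ccontr)
  let ?M = "lebesgue_on {p<..<q}"
  assume *: "(LINT x|?M. h x * k x) \<noteq> 0"
  define I where "I = (LINT x|?M. \<bar>h x\<bar>)"
  have I: "I \<ge> 0" unfolding I_def by simp
  \<comment> \<open>Makes \<open>I * e\<close> strictly smaller than the supposedly nonzero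
    integral; the \<open>+ 1\<close> covers \<open>I = 0\<close>.\<close>
  define e where "e = \<bar>LINT x|?M. h x * k x\<bar> / (I + 1)"
  have e: "e > 0" using * I by (simp add: e_def)
  obtain P where P: "continuous_on UNIV P" "\<And>x. x \<in> {p<..<q} \<Longrightarrow> \<bar>k x - P x\<bar> \<le> e"
    "(LINT x|?M. h x * P x) = 0"
    using approx[OF e] by blast
  have "(LINT x|?M. h x * k x) = (LINT x|?M. h x * (k x - P x))"
    using Bochner_Integration.integral_diff[OF integrable_mult_continuous[OF h k] integrable_mult_continuous[OF h P(1)]] P(3)
    by (simp add: right_diff_distrib)
  then have "\<bar>LINT x|?M. h x * k x\<bar> \<le> (LINT x|?M. \<bar>h x * (k x - P x)\<bar>)"
    by (metis integral_abs_bound)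
  also have "\<dots> \<le> (LINT x|?M. \<bar>h x\<bar> * e)"
  proof (rule integral_mono)
    show "integrable ?M (\<lambda>x. \<bar>h x * (k x - P x)\<bar>)"
      by (intro integrable_abs integrable_mult_continuous h continuous_intros k P)
    show "\<bar>h x * (k x - P x)\<bar> \<le> \<bar>h x\<bar> * e" if "x \<in> space ?M" for x
      using P(2)[of x] that by (auto simp: abs_mult intro!: mult_left_mono)
  qed (use h in simp)
  also have "\<dots> = I * e" by (simp add: I_def)
  also have "\<dots> < (I + 1) * e" using e by simp
  also have "\<dots> = \<bar>LINT x|?M. h x * k x\<bar>" using I by (simp add: e_def)
  finally show False by simp
qed

text \<open>A polynomial times a cutoff is a test function, and dominated convergence removes the
  cutoff. Weierstrass approximation then passes from polynomials to continuous functions.\<close>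

lemma AE_eq_0_if_integral_mult_test_function_eq_0:
  fixes h :: "real \<Rightarrow> real"
  assumes h: "integrable (lebesgue_on {p<..<q}) h"
    and zero: "\<And>\<phi>. \<phi> \<in> test_functions {p<..<q} \<Longrightarrow> (LINT x|lebesgue_on {p<..<q}. h x * \<phi> x) = 0"
  shows "AE x in lebesgue_on {p<..<q}. h x = 0"
proof (rule AE_eq_0_if_integral_mult_continuous_eq_0[OF h])
  let ?M = "lebesgue_on {p<..<q}"
  fix k :: "real \<Rightarrow> real" assume k: "continuous_on UNIV k"
  have hm [measurable]: "h \<in> borel_measurable ?M" using h by simp
  have cm: "f \<in> borel_measurable ?M" if "continuous_on UNIV f" for f :: "real \<Rightarrow> real"
    by (intro continuous_imp_measurable_on_sets_lebesgue continuous_on_subset[OF that]) auto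
  have poly: "(LINT x|?M. h x * P x) = 0" if P: "P \<in> smooth_alg" for P
  proof -
    have "(\<lambda>n. LINT x|?M. h x * (cutoff p q n x * P x)) \<longlonglongrightarrow> (LINT x|?M. h x * P x)"
    proof (rule integral_dominated_convergence)
      have c: "continuous_on UNIV P" "continuous_on UNIV (cutoff p q n)" for n
        by (intro smooth_alg_continuous P cutoff_smooth)+
      show "integrable ?M (\<lambda>x. \<bar>h x * P x\<bar>)" using integrable_mult_continuous[OF h c(1)] by simp
      show "(\<lambda>x. h x * P x) \<in> borel_measurable ?M" using cm[OF c(1)] by measurable
      show "(\<lambda>x. h x * (cutoff p q n x * P x)) \<in> borel_measurable ?M" for n
        using cm[OF c(1)] cm[OF c(2)] by measurable
      show "AE x in ?M. norm (h x * (cutoff p q n x * P x)) \<le> \<bar>h x * P x\<bar>" for n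
        using cutoff_bounds[of p q n]
        by (intro AE_I2) (auto simp: abs_mult mult.left_commute[of "\<bar>h _\<bar>"] intro!: mult_right_le_one_le mult_left_le_one_le)
      show "AE x in ?M. (\<lambda>n. h x * (cutoff p q n x * P x)) \<longlonglongrightarrow> h x * P x"
      proof (intro AE_I2 tendsto_eventually)
        fix x assume "x \<in> space ?M"
        then have "\<forall>\<^sub>F n in sequentially. \<forall>\<^sub>F y in nhds x. cutoff p q n y = 1"
          by (intro cutoff_tendsto_1) auto
        then show "\<forall>\<^sub>F n in sequentially. h x * (cutoff p q n x * P x) = h x * P x"
          by eventually_elim (auto dest: eventually_nhds_x_imp_x)
      qed
    qed
    then show ?thesis using zero[OF cutoff_mult_test_function[OF P]] by (simp add: LIMSEQ_const_iff)
  qed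
  show "(LINT x|?M. h x * k x) = 0"
  proof (rule integral_mult_eq_0_if_approx[OF h k])
    fix e :: real assume "e > 0"
    then obtain P where P: "real_polynomial_function P" "\<And>x. x \<in> {p..q} \<Longrightarrow> \<bar>k x - P x\<bar> < e"
      using Stone_Weierstrass_real_polynomial_function[of "{p..q}" k e] continuous_on_subset[OF k] by auto
    have "\<forall>x\<in>{p<..<q}. \<bar>k x - P x\<bar> \<le> e" using P(2) by (auto intro: less_imp_le)
    then show "\<exists>P. continuous_on UNIV P \<and> (\<forall>x\<in>{p<..<q}. \<bar>k x - P x\<bar> \<le> e) \<and> (LINT x|?M. h x * P x) = 0"
      using poly smooth_alg_continuous real_polynomial_function_smooth_alg[OF P(1)] by blast
  qed
qed

section \<open>Sobolev spaces on a bounded interval\<close>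

lemma L2_mult_integrable:
  assumes "f \<in> L2 S" "g \<in> L2 S"
  shows "integrable (lebesgue_on S) (\<lambda>x. f x * g x)"
proof (rule Bochner_Integration.integrable_bound)
  show "integrable (lebesgue_on S) (\<lambda>x. (f x)\<^sup>2 + (g x)\<^sup>2)"
    using assms by (simp add: L2_def)
  show "(\<lambda>x. f x * g x) \<in> borel_measurable (lebesgue_on S)"
    using assms unfolding L2_def by auto
  have "\<bar>a * b\<bar> \<le> a\<^sup>2 + b\<^sup>2" for a b :: real
  proof -
    have "\<bar>a * b\<bar> \<le> 2 * \<bar>a\<bar> * \<bar>b\<bar>" by (simp add: abs_mult)
    also have "\<dots> \<le> a\<^sup>2 + b\<^sup>2" using sum_squares_bound[of "\<bar>a\<bar>" "\<bar>b\<bar>"] by simp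
    finally show ?thesis .
  qed
  then show "AE x in lebesgue_on S. norm (f x * g x) \<le> norm ((f x)\<^sup>2 + (g x)\<^sup>2)" by simp
qed

lemma L2_measurable: "f \<in> L2 S \<Longrightarrow> f \<in> borel_measurable (lebesgue_on S)"
  by (simp add: L2_def)

lemma L2_add:
  assumes "f \<in> L2 S" "g \<in> L2 S"
  shows "(\<lambda>x. f x + g x) \<in> L2 S"
proof -
  have "integrable (lebesgue_on S) (\<lambda>x. (f x)\<^sup>2 + 2 * (f x * g x) + (g x)\<^sup>2)"
    using assms L2_mult_integrable[OF assms] by (simp add: L2_def)
  then have "integrable (lebesgue_on S) (\<lambda>x. (f x + g x)\<^sup>2)"
    by (simp add: power2_sum algebra_simps)
  then show ?thesis using assms by (auto simp: L2_def)
qed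

lemma L2_cmult: "f \<in> L2 S \<Longrightarrow> (\<lambda>x. c * f x) \<in> L2 S"
  by (auto simp: L2_def power_mult_distrib)

lemma L2_diff: "f \<in> L2 S \<Longrightarrow> g \<in> L2 S \<Longrightarrow> (\<lambda>x. f x - g x) \<in> L2 S"
  using L2_add[of f S "\<lambda>x. (-1) * g x"] L2_cmult[of g S "-1"] by simp

lemma L2_inner_commute: "L2_inner S f g = L2_inner S g f"
  by (simp add: L2_inner_def mult.commute)

lemma L2_inner_cmult_left: "L2_inner S (\<lambda>x. c * f x) g = c * L2_inner S f g"
  by (simp add: L2_inner_def mult.assoc)

lemma L2_inner_diff_left:
  assumes "f \<in> L2 S" "g \<in> L2 S" "h \<in> L2 S"
  shows "L2_inner S (\<lambda>x. f x - g x) h = L2_inner S f h - L2_inner S g h"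
  unfolding L2_inner_def left_diff_distrib
  by (rule Bochner_Integration.integral_diff) (use assms L2_mult_integrable in auto)

lemma L2_inner_cong_AE:
  assumes "AE x in lebesgue_on S. f x = f' x" "f \<in> borel_measurable (lebesgue_on S)" "f' \<in> borel_measurable (lebesgue_on S)"
    "g \<in> borel_measurable (lebesgue_on S)"
  shows "L2_inner S f g = L2_inner S f' g"
  unfolding L2_inner_def
proof (rule integral_cong_AE)
  show "AE x in lebesgue_on S. f x * g x = f' x * g x" using assms(1) by eventually_elim simp
qed (use assms(2-4) in \<open>intro borel_measurable_times; simp\<close>)+

lemma L2_inner_self_nonneg: "L2_inner S f f \<ge> 0"
  by (simp add: L2_inner_def)

lemma L2_Cauchy_Schwarz:
  assumes f: "f \<in> L2 S" and g: "g \<in> L2 S"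
  shows "(L2_inner S f g)\<^sup>2 \<le> L2_inner S f f * L2_inner S g g"
proof -
  define A B C where "A = L2_inner S f f" and "B = L2_inner S f g" and "C = L2_inner S g g"
  have q: "0 \<le> A - 2 * t * B + t\<^sup>2 * C" for t
  proof -
    let ?h = "\<lambda>x. f x - t * g x"
    have tg: "(\<lambda>x. t * g x) \<in> L2 S" by (rule L2_cmult[OF g])
    have h: "?h \<in> L2 S" by (rule L2_diff[OF f tg])
    have "L2_inner S ?h ?h = L2_inner S f ?h - t * L2_inner S g ?h"
      using L2_inner_diff_left[OF f tg h] by (simp add: L2_inner_cmult_left)
    also have "L2_inner S f ?h = A - t * B"
      unfolding L2_inner_commute[of S f ?h] L2_inner_diff_left[OF f tg f]
      by (simp add: L2_inner_cmult_left A_def B_def L2_inner_commute[of S g f])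
    also have "L2_inner S g ?h = B - t * C"
      unfolding L2_inner_commute[of S g ?h] L2_inner_diff_left[OF f tg g]
      by (simp add: L2_inner_cmult_left C_def B_def)
    finally have "A - 2 * t * B + t\<^sup>2 * C = L2_inner S ?h ?h" by (simp add: algebra_simps power2_eq_square)
    then show ?thesis using L2_inner_self_nonneg[of S ?h] by simp
  qed
  have C: "C \<ge> 0" unfolding C_def by (rule L2_inner_self_nonneg)
  have "B\<^sup>2 \<le> A * C"
  proof (cases "C = 0")
    case True
    have "B = 0"
    proof (rule ccontr)
      assume "B \<noteq> 0"
      \<comment> \<open>When \<open>C = 0\<close> the quadratic is affine in \<open>t\<close>, and
        this \<open>t\<close> gives it the value -1.\<close>
      then show False using q[of "(A + 1) / (2 * B)"] True by simp
    qed
    then show ?thesis using True by simp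
  next
    case False
    then have "0 \<le> A - B\<^sup>2 / C" using q[of "B / C"] by (simp add: power2_eq_square)
    then show ?thesis using C False by (simp add: field_simps)
  qed
  then show ?thesis by (simp add: A_def B_def C_def)
qed

lemma L2_inner_tendsto:
  assumes fn: "\<And>n. f n \<in> L2 S" and f: "f0 \<in> L2 S" and g: "g \<in> L2 S"
    and lim: "(\<lambda>n. L2_inner S (\<lambda>x. f n x - f0 x) (\<lambda>x. f n x - f0 x)) \<longlonglongrightarrow> 0"
  shows "(\<lambda>n. L2_inner S (f n) g) \<longlonglongrightarrow> L2_inner S f0 g"
proof -
  let ?d = "\<lambda>n x. f n x - f0 x"
  have "(\<lambda>n. sqrt (L2_inner S (?d n) (?d n) * L2_inner S g g)) \<longlonglongrightarrow> sqrt (0 * L2_inner S g g)"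
    by (intro tendsto_intros lim)
  moreover have "\<bar>L2_inner S (f n) g - L2_inner S f0 g\<bar> \<le> sqrt (L2_inner S (?d n) (?d n) * L2_inner S g g)" for n
  proof -
    have "\<bar>L2_inner S (?d n) g\<bar> \<le> sqrt (L2_inner S (?d n) (?d n) * L2_inner S g g)"
      using L2_Cauchy_Schwarz[OF L2_diff[OF fn f] g] by (intro real_le_rsqrt) simp
    then show ?thesis using L2_inner_diff_left[OF fn f g] by simp
  qed
  then have "\<forall>\<^sub>F n in sequentially. norm (L2_inner S (f n) g - L2_inner S f0 g) \<le> sqrt (L2_inner S (?d n) (?d n) * L2_inner S g g)"
    by (intro always_eventually allI) simp
  ultimately have "(\<lambda>n. L2_inner S (f n) g - L2_inner S f0 g) \<longlonglongrightarrow> 0"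
    by (intro Lim_null_comparison[where f = "\<lambda>n. L2_inner S (f n) g - L2_inner S f0 g"]) simp_all
  then show ?thesis by (simp add: LIM_zero_iff)
qed

locale bounded_interval =
  fixes p q :: real
  assumes pq: "p < q"
begin

abbreviation "\<Omega> \<equiv> {p<..<q}"
abbreviation "M \<equiv> lebesgue_on {p<..<q}"

lemma finite_M: "finite_measure M"
  by (rule finite_measure_lebesgue_on) auto

lemma integrable_const_M: "integrable M (\<lambda>x. c :: real)"
  using finite_measure.integrable_const[OF finite_M] .

lemma L2_integrable:
  assumes "f \<in> L2 \<Omega>" shows "integrable M f"
proof -
  have "(\<lambda>x. 1 :: real) \<in> L2 \<Omega>" unfolding L2_def using integrable_const_M[of 1] by auto
  from L2_mult_integrable[OF assms this] show ?thesis by simp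
qed

lemma continuous_on_measurable_M:
  fixes f :: "real \<Rightarrow> real"
  assumes "continuous_on UNIV f" shows "f \<in> borel_measurable M"
  by (intro continuous_imp_measurable_on_sets_lebesgue continuous_on_subset[OF assms]) auto

lemma L2_bounded:
  assumes "f \<in> borel_measurable M" "\<And>x. x \<in> \<Omega> \<Longrightarrow> \<bar>f x\<bar> \<le> B"
  shows "f \<in> L2 \<Omega>"
proof -
  have "integrable M (\<lambda>x. (f x)\<^sup>2)"
  proof (rule Bochner_Integration.integrable_bound[OF integrable_const_M[of "B\<^sup>2"]])
    show "AE x in M. norm ((f x)\<^sup>2) \<le> norm (B\<^sup>2)"
    proof (intro AE_I2)
      fix x assume "x \<in> space M"
      then have "\<bar>f x\<bar> \<le> B" by (intro assms) simp
      then show "norm ((f x)\<^sup>2) \<le> norm (B\<^sup>2)" using abs_le_square_iff[of "f x" B] by simp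
    qed
  qed (use assms in measurable)
  then show ?thesis using assms by (simp add: L2_def)
qed

lemma continuous_bounded:
  assumes "continuous_on UNIV f"
  obtains B :: real where "\<And>x. x \<in> {p..q} \<Longrightarrow> \<bar>f x\<bar> \<le> B" "B \<ge> 0"
proof -
  have "bounded (f ` {p..q})"
    by (intro compact_imp_bounded compact_continuous_image continuous_on_subset[OF assms]) auto
  then obtain B where "\<forall>x\<in>{p..q}. \<bar>f x\<bar> \<le> B" by (auto simp: bounded_iff)
  then show ?thesis using that[of "max B 0"] by fastforce
qed

lemma L2_continuous:
  assumes "continuous_on UNIV f" shows "f \<in> L2 \<Omega>"
proof -
  obtain B :: real where B: "\<And>x. x \<in> {p..q} \<Longrightarrow> \<bar>f x\<bar> \<le> B" using continuous_bounded[OF assms] by blast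
  show ?thesis by (rule L2_bounded[OF continuous_on_measurable_M[OF assms], of B]) (use B in auto)
qed

lemma test_function_continuous:
  assumes "\<phi> \<in> test_functions S"
  shows "continuous_on UNIV \<phi>" "continuous_on UNIV (deriv \<phi>)" "(\<phi> has_real_derivative deriv \<phi> x) (at x)"
proof -
  have d: "(deriv ^^ n) \<phi> differentiable_on UNIV" for n using assms by (simp add: test_functions_def)
  have "\<phi> differentiable (at x)" for x using d[of 0] by (simp add: differentiable_on_def)
  then show "(\<phi> has_real_derivative deriv \<phi> x) (at x)"
    by (metis DERIV_imp_deriv real_differentiableE)
  show "continuous_on UNIV \<phi>" using differentiable_imp_continuous_on[OF d[of 0]] by simp
  show "continuous_on UNIV (deriv \<phi>)" using differentiable_imp_continuous_on[OF d[of 1]] by simp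
qed

lemma test_function_L2:
  assumes "\<phi> \<in> test_functions \<Omega>"
  shows "\<phi> \<in> L2 \<Omega>" "deriv \<phi> \<in> L2 \<Omega>"
  using L2_continuous test_function_continuous[OF assms] by auto

lemma is_weak_deriv_unique:
  assumes "w1 \<in> L2 \<Omega>" "w2 \<in> L2 \<Omega>" "is_weak_deriv \<Omega> v w1" "is_weak_deriv \<Omega> v w2"
  shows "AE x in M. w1 x = w2 x"
proof -
  have "AE x in M. w1 x - w2 x = 0"
  proof (rule AE_eq_0_if_integral_mult_test_function_eq_0)
    show "integrable M (\<lambda>x. w1 x - w2 x)" using assms by (intro L2_integrable L2_diff)
    fix \<phi> assume \<phi>: "\<phi> \<in> test_functions \<Omega>"
    have "L2_inner \<Omega> (\<lambda>x. w1 x - w2 x) \<phi> = 0"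
      using assms \<phi> test_function_L2[OF \<phi>] by (auto simp: L2_inner_diff_left is_weak_deriv_def)
    then show "(LINT x|M. (w1 x - w2 x) * \<phi> x) = 0" by (simp add: L2_inner_def)
  qed
  then show ?thesis by simp
qed

lemma wderiv_H1:
  assumes "v \<in> H1 \<Omega>"
  shows "v \<in> L2 \<Omega>" "wderiv \<Omega> v \<in> L2 \<Omega>" "is_weak_deriv \<Omega> v (wderiv \<Omega> v)"
proof -
  have "\<exists>w. w \<in> L2 \<Omega> \<and> is_weak_deriv \<Omega> v w" using assms by (auto simp: H1_def)
  from someI_ex[OF this] show "wderiv \<Omega> v \<in> L2 \<Omega>" "is_weak_deriv \<Omega> v (wderiv \<Omega> v)"
    by (auto simp: wderiv_def)
  show "v \<in> L2 \<Omega>" using assms by (simp add: H1_def)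
qed

lemma wderiv_unique:
  assumes "v \<in> L2 \<Omega>" "w \<in> L2 \<Omega>" "is_weak_deriv \<Omega> v w"
  shows "v \<in> H1 \<Omega>" "AE x in M. wderiv \<Omega> v x = w x"
proof -
  show v: "v \<in> H1 \<Omega>" using assms by (auto simp: H1_def)
  show "AE x in M. wderiv \<Omega> v x = w x"
    by (rule is_weak_deriv_unique) (use assms wderiv_H1[OF v] in auto)
qed

lemma is_weak_deriv_diff:
  assumes "v1 \<in> L2 \<Omega>" "v2 \<in> L2 \<Omega>" "w1 \<in> L2 \<Omega>" "w2 \<in> L2 \<Omega>" "is_weak_deriv \<Omega> v1 w1" "is_weak_deriv \<Omega> v2 w2"
  shows "is_weak_deriv \<Omega> (\<lambda>x. v1 x - v2 x) (\<lambda>x. w1 x - w2 x)"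
  using assms test_function_L2 by (auto simp: is_weak_deriv_def L2_inner_diff_left)

lemma is_weak_deriv_cong_AE:
  assumes "is_weak_deriv \<Omega> v w" "AE x in M. v x = v' x" "AE x in M. w x = w' x"
    "v \<in> L2 \<Omega>" "w \<in> L2 \<Omega>" "v' \<in> borel_measurable M" "w' \<in> borel_measurable M"
  shows "is_weak_deriv \<Omega> v' w'"
  unfolding is_weak_deriv_def
proof
  fix \<phi> assume \<phi>: "\<phi> \<in> test_functions \<Omega>"
  have "L2_inner \<Omega> v' (deriv \<phi>) = L2_inner \<Omega> v (deriv \<phi>)" "L2_inner \<Omega> w' \<phi> = L2_inner \<Omega> w \<phi>"
    using assms test_function_L2[OF \<phi>] by (auto intro!: L2_inner_cong_AE[symmetric] simp: L2_measurable)
  then show "L2_inner \<Omega> v' (deriv \<phi>) = - L2_inner \<Omega> w' \<phi>"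
    using assms(1) \<phi> by (simp add: is_weak_deriv_def)
qed

lemma classical_weak_deriv:
  assumes f: "\<And>x. (f has_real_derivative f' x) (at x)" and f': "continuous_on UNIV f'"
  shows "is_weak_deriv \<Omega> f f'"
  unfolding is_weak_deriv_def
proof
  fix \<phi> assume \<phi>: "\<phi> \<in> test_functions \<Omega>"
  then obtain K where K: "K \<subseteq> \<Omega>" "\<And>x. x \<notin> K \<Longrightarrow> \<phi> x = 0" by (auto simp: test_functions_def)
  have fc: "continuous_on UNIV f" using f DERIV_isCont continuous_at_imp_continuous_on by blast
  note \<phi>c = test_function_continuous[OF \<phi>]
  let ?g = "\<lambda>x. f x * deriv \<phi> x + f' x * \<phi> x"
  have L: "f \<in> L2 \<Omega>" "f' \<in> L2 \<Omega>" "\<phi> \<in> L2 \<Omega>" "deriv \<phi> \<in> L2 \<Omega>"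
    using L2_continuous fc f' \<phi>c by auto
  have int: "integrable M ?g" using L by (intro Bochner_Integration.integrable_add L2_mult_integrable)
  have "(?g has_integral f q * \<phi> q - f p * \<phi> p) {p..q}"
  proof (rule fundamental_theorem_of_calculus)
    fix x
    have "((\<lambda>x. f x * \<phi> x) has_real_derivative f' x * \<phi> x + deriv \<phi> x * f x) (at x)"
      by (rule DERIV_mult[OF f \<phi>c(3)])
    moreover have "f' x * \<phi> x + deriv \<phi> x * f x = ?g x" by simp
    ultimately have "((\<lambda>x. f x * \<phi> x) has_real_derivative ?g x) (at x within {p..q})"
      by (metis has_field_derivative_at_within)
    then show "((\<lambda>x. f x * \<phi> x) has_vector_derivative ?g x) (at x within {p..q})"
      by (simp add: has_real_derivative_iff_has_vector_derivative)
  qed (use pq in simp)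
  moreover have "q \<notin> K" using K(1) by fastforce
  then have "\<phi> q = 0" by (rule K(2))
  moreover have "p \<notin> K" using K(1) by fastforce
  then have "\<phi> p = 0" by (rule K(2))
  ultimately have "(?g has_integral 0) \<Omega>" by (simp add: has_integral_Icc_iff_Ioo)
  then have "(LINT x|M. ?g x) = 0"
    using lebesgue_integral_eq_integral[OF int] by (simp add: integral_unique)
  then have "L2_inner \<Omega> f (deriv \<phi>) + L2_inner \<Omega> f' \<phi> = 0"
    using L by (simp add: L2_inner_def L2_mult_integrable)
  then show "L2_inner \<Omega> f (deriv \<phi>) = - L2_inner \<Omega> f' \<phi>" by simp
qed

lemma smooth_alg_H1:
  assumes "f \<in> smooth_alg"
  shows "f \<in> L2 \<Omega>" "f \<in> H1 \<Omega>" "AE x in M. wderiv \<Omega> f x = deriv f x" "is_weak_deriv \<Omega> f (deriv f)"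
proof -
  have c: "continuous_on UNIV f" "continuous_on UNIV (deriv f)"
    using assms smooth_alg_deriv smooth_alg_continuous by auto
  show w: "is_weak_deriv \<Omega> f (deriv f)"
    by (rule classical_weak_deriv[OF smooth_alg_DERIV[OF assms] c(2)])
  show "f \<in> L2 \<Omega>" by (rule L2_continuous[OF c(1)])
  then show "f \<in> H1 \<Omega>" "AE x in M. wderiv \<Omega> f x = deriv f x"
    using wderiv_unique[OF _ L2_continuous[OF c(2)] w] by auto
qed

lemma H01_H1: "v \<in> H01 \<Omega> \<Longrightarrow> v \<in> H1 \<Omega>"
  by (simp add: H01_def)

text \<open>\<open>H1_norm\<close> is defined through the chosen \<open>wderiv\<close>; here any
  weak derivatives may be used, as they agree almost everywhere. Squaring removes the root.\<close>

lemma H1_norm_diff: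
  assumes "f \<in> L2 \<Omega>" "f' \<in> L2 \<Omega>" "is_weak_deriv \<Omega> f f'" "v \<in> L2 \<Omega>" "v' \<in> L2 \<Omega>" "is_weak_deriv \<Omega> v v'"
  shows "(H1_norm \<Omega> (\<lambda>x. f x - v x))\<^sup>2 = L2_inner \<Omega> (\<lambda>x. f x - v x) (\<lambda>x. f x - v x) + L2_inner \<Omega> (\<lambda>x. f' x - v' x) (\<lambda>x. f' x - v' x)"
proof -
  let ?d = "\<lambda>x. f x - v x" and ?d' = "\<lambda>x. f' x - v' x"
  have d: "?d \<in> L2 \<Omega>" "?d' \<in> L2 \<Omega>" "is_weak_deriv \<Omega> ?d ?d'"
    using assms by (auto intro: L2_diff is_weak_deriv_diff)
  note w = wderiv_unique[OF d] wderiv_H1[OF wderiv_unique(1)[OF d]]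
  have "L2_inner \<Omega> (wderiv \<Omega> ?d) (wderiv \<Omega> ?d) = L2_inner \<Omega> ?d' (wderiv \<Omega> ?d)"
    using w d by (intro L2_inner_cong_AE L2_measurable) auto
  also have "\<dots> = L2_inner \<Omega> ?d' ?d'"
    unfolding L2_inner_commute[of _ ?d' "wderiv \<Omega> ?d"] using w d by (intro L2_inner_cong_AE L2_measurable) auto
  finally show ?thesis
    using L2_inner_self_nonneg[of \<Omega> ?d] L2_inner_self_nonneg[of \<Omega> "wderiv \<Omega> ?d"] by (simp add: H1_norm_def)
qed

text \<open>For test functions in place of \<open>v\<close> this is the definition of the weak
  derivative of \<open>w\<close>. Both sides are continuous in the \<open>H1_norm\<close> of
  \<open>v\<close>, so it passes to the closure.\<close>

lemma H01_integration_by_parts: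
  assumes v: "v \<in> H01 \<Omega>" and w: "w \<in> H1 \<Omega>"
  shows "L2_inner \<Omega> (wderiv \<Omega> v) w = - L2_inner \<Omega> v (wderiv \<Omega> w)"
proof -
  obtain \<phi> where \<phi>: "\<And>n. \<phi> n \<in> test_functions \<Omega>" and lim: "(\<lambda>n. H1_norm \<Omega> (\<lambda>x. \<phi> n x - v x)) \<longlonglongrightarrow> 0"
    using v by (auto simp: H01_def)
  note v' = wderiv_H1[OF H01_H1[OF v]] and w' = wderiv_H1[OF w]
  have \<phi>L: "\<phi> n \<in> L2 \<Omega>" "deriv (\<phi> n) \<in> L2 \<Omega>" "is_weak_deriv \<Omega> (\<phi> n) (deriv (\<phi> n))" for n
    using test_function_L2[OF \<phi>] test_function_continuous[OF \<phi>] by (auto intro!: classical_weak_deriv)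
  let ?a = "\<lambda>n. L2_inner \<Omega> (\<lambda>x. \<phi> n x - v x) (\<lambda>x. \<phi> n x - v x)"
  let ?b = "\<lambda>n. L2_inner \<Omega> (\<lambda>x. deriv (\<phi> n) x - wderiv \<Omega> v x) (\<lambda>x. deriv (\<phi> n) x - wderiv \<Omega> v x)"
  have "(\<lambda>n. (H1_norm \<Omega> (\<lambda>x. \<phi> n x - v x))\<^sup>2) \<longlonglongrightarrow> 0\<^sup>2" by (intro tendsto_power lim)
  then have ab: "(\<lambda>n. ?a n + ?b n) \<longlonglongrightarrow> 0"
    using H1_norm_diff[OF \<phi>L v'] by simp
  have "?a \<longlonglongrightarrow> 0"
    by (rule tendsto_sandwich[OF _ _ tendsto_const ab]) (auto simp: L2_inner_self_nonneg)
  moreover have "?b \<longlonglongrightarrow> 0"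
    by (rule tendsto_sandwich[OF _ _ tendsto_const ab]) (auto simp: L2_inner_self_nonneg)
  ultimately have 1: "(\<lambda>n. L2_inner \<Omega> (\<phi> n) (wderiv \<Omega> w)) \<longlonglongrightarrow> L2_inner \<Omega> v (wderiv \<Omega> w)"
    and 2: "(\<lambda>n. L2_inner \<Omega> (deriv (\<phi> n)) w) \<longlonglongrightarrow> L2_inner \<Omega> (wderiv \<Omega> v) w"
    using \<phi>L v' w' by (auto intro!: L2_inner_tendsto)
  have "L2_inner \<Omega> (deriv (\<phi> n)) w = - L2_inner \<Omega> (\<phi> n) (wderiv \<Omega> w)" for n
    using w'(3) \<phi>[of n] by (simp add: is_weak_deriv_def L2_inner_commute)
  then have "(\<lambda>n. - L2_inner \<Omega> (\<phi> n) (wderiv \<Omega> w)) \<longlonglongrightarrow> L2_inner \<Omega> (wderiv \<Omega> v) w" using 2 by simp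
  then show ?thesis using tendsto_minus[OF 1] LIMSEQ_unique by blast
qed

end

section \<open>Spectral theory of the Dirichlet Laplacian\<close>

text \<open>Built to be stable under multiplication by \<open>cos (\<theta> x)\<close>. The index
  \<open>m = 0\<close> contributes the zero function, which appears when the product with the first
  sine is expanded.\<close>

inductive_set sine_span :: "('a \<Rightarrow> real) \<Rightarrow> ('a \<Rightarrow> real) set" for \<theta> where
  sin: "(\<lambda>x. sin (real m * \<theta> x)) \<in> sine_span \<theta>"
| add: "f \<in> sine_span \<theta> \<Longrightarrow> g \<in> sine_span \<theta> \<Longrightarrow> (\<lambda>x. f x + g x) \<in> sine_span \<theta>"
| cmult: "f \<in> sine_span \<theta> \<Longrightarrow> (\<lambda>x. c * f x) \<in> sine_span \<theta>"

lemma sine_span_cos: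
  assumes "w \<in> sine_span \<theta>"
  shows "(\<lambda>x. cos (\<theta> x) * w x) \<in> sine_span \<theta>"
  using assms
proof induction
  case (sin m)
  show ?case
  proof (cases m)
    case 0
    then show ?thesis using sine_span.sin[of 0 \<theta>] by simp
  next
    case (Suc k)
    have eq: "cos t * sin (real m * t) = 1 / 2 * (sin (real (m + 1) * t) + sin (real k * t))" for t
      unfolding sin_times_cos[of "real m * t" t, unfolded mult.commute[of "sin _"]]
      by (simp add: Suc algebra_simps)
    show ?thesis unfolding eq by (intro sine_span.cmult sine_span.add sine_span.sin)
  qed
next
  case (add f g)
  then show ?case using sine_span.add by (simp add: distrib_left)
next
  case (cmult f c)
  then show ?case using sine_span.cmult by (simp add: mult.left_commute)
qed

text \<open>A product of polynomials acts factor by factor, which is why \<open>w\<close> ranges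
  over the whole span in the induction.\<close>

lemma sine_span_polynomial:
  fixes P :: "real \<Rightarrow> real"
  assumes "real_polynomial_function P" "w \<in> sine_span \<theta>"
  shows "(\<lambda>x. P (cos (\<theta> x)) * w x) \<in> sine_span \<theta>"
  using assms
proof (induction arbitrary: w)
  case (linear f)
  then obtain c where "f = (\<lambda>x. x * c)" by (auto simp: real_bounded_linear)
  then show ?case using sine_span.cmult[OF sine_span_cos[OF linear(2)], of c] by (simp add: mult_ac)
next
  case (const c)
  then show ?case by (rule sine_span.cmult)
next
  case (add f g)
  show ?case using sine_span.add[OF add.IH(1)[OF add.prems] add.IH(2)[OF add.prems]] by (simp add: distrib_right)
next
  case (mult f g)
  show ?case using mult.IH(1)[OF mult.IH(2)[OF mult.prems]] by (simp add: mult.assoc)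
qed

context bounded_interval
begin

text \<open>On the support of the derivative of the cutoff, \<open>f\<close> is of the order of the distance to the
  boundary, which compensates the factor \<open>n + 1\<close> of that derivative.\<close>

lemma smooth_alg_H01:
  assumes f: "f \<in> smooth_alg" and fp: "f p = 0" and fq: "f q = 0"
  shows "f \<in> H01 \<Omega>"
proof -
  define \<phi> where "\<phi> n x = cutoff p q n x * f x" for n x
  have \<phi>t: "\<phi> n \<in> test_functions \<Omega>" for n
    unfolding \<phi>_def by (rule cutoff_mult_test_function[OF f])
  have fc: "continuous_on UNIV f" "continuous_on UNIV (deriv f)" "(f has_real_derivative deriv f x) (at x)" for x
    by (intro smooth_alg_continuous smooth_alg_deriv smooth_alg_DERIV f)+
  obtain B :: real where B: "\<And>x. x \<in> {p..q} \<Longrightarrow> \<bar>f x\<bar> \<le> B" "B \<ge> 0" using continuous_bounded[OF fc(1)] by blast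
  obtain B' :: real where B': "\<And>x. x \<in> {p..q} \<Longrightarrow> \<bar>deriv f x\<bar> \<le> B'" "B' \<ge> 0" using continuous_bounded[OF fc(2)] by blast
  obtain C where C: "C \<ge> 0" "\<And>x. \<bar>deriv smooth_step x\<bar> \<le> C" using deriv_smooth_step_bounded by blast
  \<comment> \<open>Applied with \<open>y\<close> an end point, where \<open>f\<close> vanishes,
    this bounds \<open>f\<close> by \<open>B'\<close> times the distance to the boundary.\<close>
  have lip: "\<bar>f x - f y\<bar> \<le> B' * \<bar>x - y\<bar>" if "x \<in> {p..q}" "y \<in> {p..q}" for x y
  proof -
    have "norm (f x - f y) \<le> B' * norm (x - y)"
      by (rule field_differentiable_bound[of "{p..q}" f "deriv f"])
         (use that B' fc(3) in \<open>auto intro: has_field_derivative_at_within\<close>)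
    then show ?thesis by simp
  qed
  have dphi: "deriv (\<phi> n) x = (real (Suc n) * deriv smooth_step (real (Suc n) * (x - p) - 1) * smooth_step (real (Suc n) * (q - x) - 1)
      - real (Suc n) * deriv smooth_step (real (Suc n) * (q - x) - 1) * smooth_step (real (Suc n) * (x - p) - 1)) * f x
      + cutoff p q n x * deriv f x" for n x
  proof -
    have s: "(smooth_step has_real_derivative deriv smooth_step y) (at y)" for y
      by (rule smooth_alg_DERIV[OF smooth_step_smooth])
    have "((\<lambda>x. smooth_step (real (Suc n) * (x - p) - 1)) has_real_derivative deriv smooth_step (real (Suc n) * (x - p) - 1) * real (Suc n)) (at x)"
      by (rule DERIV_chain2[where f = smooth_step, OF s]) (auto intro!: derivative_eq_intros)
    moreover have "((\<lambda>x. smooth_step (real (Suc n) * (q - x) - 1)) has_real_derivative deriv smooth_step (real (Suc n) * (q - x) - 1) * (- real (Suc n))) (at x)"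
      by (rule DERIV_chain2[where f = smooth_step, OF s]) (auto intro!: derivative_eq_intros)
    ultimately have "(cutoff p q n has_real_derivative
        deriv smooth_step (real (Suc n) * (x - p) - 1) * real (Suc n) * smooth_step (real (Suc n) * (q - x) - 1)
        + deriv smooth_step (real (Suc n) * (q - x) - 1) * (- real (Suc n)) * smooth_step (real (Suc n) * (x - p) - 1)) (at x)"
      unfolding cutoff_def[abs_def] by (rule DERIV_mult)
    from DERIV_mult[OF this fc(3)[of x]]
    show ?thesis unfolding \<phi>_def[abs_def] by (intro DERIV_imp_deriv) (simp add: algebra_simps del: of_nat_Suc)
  qed
  \<comment> \<open>Each of the two ends contributes at most \<open>2 * C * B'\<close>, and the
    cutoff times the derivative of \<open>f\<close> at most \<open>B'\<close>.\<close>
  define D where "D = 4 * C * B' + B'"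
  \<comment> \<open>The derivative of the step vanishes unless
    \<open>real (Suc n) * y \<le> 2\<close>, and there \<open>\<bar>f x\<bar> \<le> B' * y\<close>
    absorbs the factor \<open>real (Suc n)\<close>.\<close>
  have edge: "real (Suc n) * \<bar>deriv smooth_step (real (Suc n) * y - 1)\<bar> * \<bar>f x\<bar> \<le> 2 * C * B'"
    if y: "\<bar>f x\<bar> \<le> B' * y" "y \<ge> 0" for n x y
  proof (cases "real (Suc n) * y \<le> 2")
    case True
    have "real (Suc n) * \<bar>deriv smooth_step (real (Suc n) * y - 1)\<bar> * \<bar>f x\<bar> \<le> real (Suc n) * C * (B' * y)"
      using C y B' by (intro mult_mono) auto
    also have "\<dots> = C * B' * (real (Suc n) * y)" by simp
    also have "\<dots> \<le> C * B' * 2" using C B' True by (intro mult_left_mono) auto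
    finally show ?thesis by (simp del: of_nat_Suc)
  next
    case False
    then have "deriv smooth_step (real (Suc n) * y - 1) = 0" by (intro deriv_smooth_step_eq_0) linarith
    then show ?thesis using C B' by simp
  qed
  have dbound: "\<bar>deriv (\<phi> n) x\<bar> \<le> D" if x: "x \<in> \<Omega>" for n x
  proof -
    let ?N = "real (Suc n)"
    let ?a = "?N * deriv smooth_step (?N * (x - p) - 1)" and ?b = "?N * deriv smooth_step (?N * (q - x) - 1)"
    let ?s = "smooth_step (?N * (q - x) - 1)" and ?t = "smooth_step (?N * (x - p) - 1)"
    have 1: "\<bar>?a\<bar> * \<bar>f x\<bar> \<le> 2 * C * B'"
      using edge[of x "x - p" n] lip[of x p] x fp by (simp add: abs_mult del: of_nat_Suc)
    have 2: "\<bar>?b\<bar> * \<bar>f x\<bar> \<le> 2 * C * B'"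
      using edge[of x "q - x" n] lip[of x q] x fq by (simp add: abs_mult abs_minus_commute[of x q] del: of_nat_Suc)
    have "\<bar>?a * ?s * f x\<bar> \<le> \<bar>?a\<bar> * \<bar>f x\<bar>" "\<bar>?b * ?t * f x\<bar> \<le> \<bar>?b\<bar> * \<bar>f x\<bar>"
      using smooth_step_bounds unfolding abs_mult[of _ "f x"]
      by (intro mult_right_mono; simp add: abs_mult mult_left_le del: of_nat_Suc)+
    moreover have "\<bar>cutoff p q n x * deriv f x\<bar> \<le> B'"
    proof -
      have "\<bar>cutoff p q n x * deriv f x\<bar> \<le> 1 * B'"
        unfolding abs_mult using cutoff_bounds[of p q n x] B'(1)[of x] x by (intro mult_mono) auto
      then show ?thesis by simp
    qed
    moreover have "deriv (\<phi> n) x = ?a * ?s * f x - ?b * ?t * f x + cutoff p q n x * deriv f x"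
      unfolding dphi by (simp only: left_diff_distrib)
    ultimately show ?thesis using 1 2 unfolding D_def by linarith
  qed
  have \<phi>s: "\<phi> n \<in> smooth_alg" for n unfolding \<phi>_def by (intro smooth_alg.mult cutoff_smooth f)
  have dm: "(\<lambda>x. deriv (\<phi> n) x - deriv f x) \<in> borel_measurable M" for n
    by (intro continuous_on_measurable_M continuous_intros smooth_alg_continuous smooth_alg_deriv f \<phi>s)
  have m: "(\<lambda>x. \<phi> n x - f x) \<in> borel_measurable M" for n
    by (intro continuous_on_measurable_M continuous_intros smooth_alg_continuous f \<phi>s)
  have ev: "\<forall>\<^sub>F n in sequentially. \<phi> n x = f x \<and> deriv (\<phi> n) x = deriv f x" if x: "x \<in> \<Omega>" for x
    using cutoff_tendsto_1[OF x]
  proof eventually_elim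
    case (elim n)
    then have e: "\<forall>\<^sub>F y in nhds x. \<phi> n y = f y" by eventually_elim (simp add: \<phi>_def)
    then show ?case using eventually_nhds_x_imp_x deriv_cong_ev[OF e refl] by blast
  qed
  have "(\<lambda>n. LINT x|M. (\<phi> n x - f x) * (\<phi> n x - f x)) \<longlonglongrightarrow> (LINT x|M. 0)"
  proof (rule integral_dominated_convergence[OF _ _ integrable_const_M[of "(2 * B)\<^sup>2"]])
    show "AE x in M. (\<lambda>n. (\<phi> n x - f x) * (\<phi> n x - f x)) \<longlonglongrightarrow> 0"
      by (intro AE_I2 tendsto_eventually eventually_mono[OF ev]) auto
    show "AE x in M. norm ((\<phi> n x - f x) * (\<phi> n x - f x)) \<le> (2 * B)\<^sup>2" for n
    proof (intro AE_I2)
      fix x assume x: "x \<in> space M"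
      have "\<bar>\<phi> n x\<bar> \<le> 1 * B"
        unfolding \<phi>_def abs_mult using cutoff_bounds[of p q n x] B(1)[of x] x by (intro mult_mono) auto
      then have "\<bar>\<phi> n x - f x\<bar> \<le> \<bar>2 * B\<bar>" using B(1)[of x] x by auto
      then have "(\<phi> n x - f x)\<^sup>2 \<le> (2 * B)\<^sup>2" by (simp only: abs_le_square_iff)
      then show "norm ((\<phi> n x - f x) * (\<phi> n x - f x)) \<le> (2 * B)\<^sup>2" by (simp add: power2_eq_square)
    qed
  qed (use m in measurable)
  moreover have "(\<lambda>n. LINT x|M. (deriv (\<phi> n) x - deriv f x) * (deriv (\<phi> n) x - deriv f x)) \<longlonglongrightarrow> (LINT x|M. 0)"
  proof (rule integral_dominated_convergence[OF _ _ integrable_const_M[of "(D + B')\<^sup>2"]])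
    show "AE x in M. (\<lambda>n. (deriv (\<phi> n) x - deriv f x) * (deriv (\<phi> n) x - deriv f x)) \<longlonglongrightarrow> 0"
      by (intro AE_I2 tendsto_eventually eventually_mono[OF ev]) auto
    show "AE x in M. norm ((deriv (\<phi> n) x - deriv f x) * (deriv (\<phi> n) x - deriv f x)) \<le> (D + B')\<^sup>2" for n
    proof (intro AE_I2)
      fix x assume x: "x \<in> space M"
      then have "\<bar>deriv (\<phi> n) x - deriv f x\<bar> \<le> \<bar>D + B'\<bar>" using B'(1)[of x] dbound[of x n] by auto
      then have "(deriv (\<phi> n) x - deriv f x)\<^sup>2 \<le> (D + B')\<^sup>2" by (simp only: abs_le_square_iff)
      then show "norm ((deriv (\<phi> n) x - deriv f x) * (deriv (\<phi> n) x - deriv f x)) \<le> (D + B')\<^sup>2"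
        by (simp add: power2_eq_square)
    qed
  qed (use dm in measurable)
  moreover have "(H1_norm \<Omega> (\<lambda>x. \<phi> n x - f x))\<^sup>2 = (LINT x|M. (\<phi> n x - f x) * (\<phi> n x - f x))
      + (LINT x|M. (deriv (\<phi> n) x - deriv f x) * (deriv (\<phi> n) x - deriv f x))" for n
    using H1_norm_diff[OF smooth_alg_H1(1)[OF \<phi>s] smooth_alg_H1(1)[OF smooth_alg_deriv[OF \<phi>s]] smooth_alg_H1(4)[OF \<phi>s]
        smooth_alg_H1(1)[OF f] smooth_alg_H1(1)[OF smooth_alg_deriv[OF f]] smooth_alg_H1(4)[OF f], of n]
    by (simp add: L2_inner_def)
  ultimately have "(\<lambda>n. (H1_norm \<Omega> (\<lambda>x. \<phi> n x - f x))\<^sup>2) \<longlonglongrightarrow> 0 + 0"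
    by (simp only:) (intro tendsto_add, simp_all)
  then have "(\<lambda>n. sqrt ((H1_norm \<Omega> (\<lambda>x. \<phi> n x - f x))\<^sup>2)) \<longlonglongrightarrow> sqrt (0 + 0)"
    by (rule tendsto_real_sqrt)
  moreover have "H1_norm \<Omega> v \<ge> 0" for v
    by (simp add: H1_norm_def L2_inner_self_nonneg)
  ultimately have "(\<lambda>n. H1_norm \<Omega> (\<lambda>x. \<phi> n x - f x)) \<longlonglongrightarrow> 0" by simp
  then show ?thesis using \<phi>t smooth_alg_H1(2)[OF f] unfolding H01_def by auto
qed

abbreviation "L \<equiv> q - p"

text \<open>Not normalized: the squared norm is \<open>L / 2\<close>, the origin of the factors
  \<open>2 / L\<close> below. \<open>Suc n\<close> skips the zero function while indices start at
  0.\<close>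

definition dirichlet_fun :: "nat \<Rightarrow> real \<Rightarrow> real" where
  "dirichlet_fun n x = sin (real (Suc n) * pi / L * (x - p))"

definition dirichlet_ev :: "nat \<Rightarrow> real" where
  "dirichlet_ev n = (real (Suc n) * pi / L)\<^sup>2"

lemma dirichlet_ev_strict_mono: "strict_mono dirichlet_ev"
  unfolding strict_mono_def dirichlet_ev_def using pq
  by (auto intro!: power_strict_mono divide_strict_right_mono mult_strict_right_mono)

lemma dirichlet_ev_pos: "dirichlet_ev n > 0"
  unfolding dirichlet_ev_def using pq by (intro zero_less_power divide_pos_pos mult_pos_pos) auto

lemma dirichlet_fun_smooth: "dirichlet_fun n \<in> smooth_alg"
proof -
  have "(\<lambda>x. sin (real (Suc n) * pi / L * x + (- (real (Suc n) * pi / L * p)))) \<in> smooth_alg"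
    by (rule smooth_alg.sin)
  then show ?thesis by (simp add: dirichlet_fun_def[abs_def] right_diff_distrib)
qed

lemma dirichlet_fun_H01: "(\<lambda>x. c * dirichlet_fun n x) \<in> H01 \<Omega>"
proof (rule smooth_alg_H01[OF smooth_alg_cmult[OF dirichlet_fun_smooth]])
  have "real (Suc n) * pi / L * (q - p) = real (Suc n) * pi" using pq by simp
  then show "c * dirichlet_fun n q = 0" unfolding dirichlet_fun_def by (simp only: sin_npi mult_zero_right)
qed (simp add: dirichlet_fun_def)

lemma dirichlet_fun_H01': "dirichlet_fun n \<in> H01 \<Omega>"
  using dirichlet_fun_H01[of 1] by simp

lemma dirichlet_fun_L2: "dirichlet_fun n \<in> L2 \<Omega>"
  by (rule smooth_alg_H1(1)[OF dirichlet_fun_smooth])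

lemma deriv_dirichlet_fun: "deriv (deriv (dirichlet_fun n)) x = - dirichlet_ev n * dirichlet_fun n x"
proof -
  define a where "a = real (Suc n) * pi / L"
  have "(dirichlet_fun n has_real_derivative a * cos (a * (x - p))) (at x)" for x
    unfolding dirichlet_fun_def a_def[symmetric] by (auto intro!: derivative_eq_intros)
  then have "deriv (dirichlet_fun n) = (\<lambda>x. a * cos (a * (x - p)))"
    by (auto simp: fun_eq_iff intro: DERIV_imp_deriv)
  moreover have "((\<lambda>x. a * cos (a * (x - p))) has_real_derivative - a\<^sup>2 * sin (a * (x - p))) (at x)"
    by (auto intro!: derivative_eq_intros simp: power2_eq_square)
  ultimately have "deriv (deriv (dirichlet_fun n)) x = - a\<^sup>2 * sin (a * (x - p))"
    by (simp only: DERIV_imp_deriv)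
  then show ?thesis unfolding dirichlet_fun_def dirichlet_ev_def a_def[symmetric] .
qed

lemma smooth_alg_H2:
  assumes "f \<in> smooth_alg"
  shows "f \<in> H2 \<Omega>" and "AE x in M. wderiv \<Omega> (wderiv \<Omega> f) x = deriv (deriv f) x"
proof -
  note f = smooth_alg_H1[OF assms]
  note f' = smooth_alg_H1[OF smooth_alg_deriv[OF assms]]
  have f''L: "deriv (deriv f) \<in> L2 \<Omega>"
    by (intro smooth_alg_H1 smooth_alg_deriv assms)
  note w = wderiv_H1[OF f(2)]
  have "is_weak_deriv \<Omega> (wderiv \<Omega> f) (deriv (deriv f))"
    by (rule is_weak_deriv_cong_AE[OF f'(4)]) (use f f' w f''L in \<open>auto simp: L2_measurable elim: eventually_mono\<close>)
  from wderiv_unique[OF w(2) f''L this]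
  show "f \<in> H2 \<Omega>" "AE x in M. wderiv \<Omega> (wderiv \<Omega> f) x = deriv (deriv f) x"
    using f(2) by (auto simp: H2_def)
qed

lemma dirichlet_fun_H2:
  shows "dirichlet_fun n \<in> H2 \<Omega>"
    and "AE x in M. wderiv \<Omega> (wderiv \<Omega> (dirichlet_fun n)) x = - dirichlet_ev n * dirichlet_fun n x"
  using smooth_alg_H2[OF dirichlet_fun_smooth[of n]] by (simp_all add: deriv_dirichlet_fun)

text \<open>Only first derivatives of \<open>v\<close> occur, as in the weak formulation:
  integration by parts puts the second derivative on the eigenfunction.\<close>

lemma wderiv_inner_dirichlet_fun:
  assumes "v \<in> H01 \<Omega>"
  shows "L2_inner \<Omega> (wderiv \<Omega> v) (wderiv \<Omega> (dirichlet_fun n)) = dirichlet_ev n * L2_inner \<Omega> v (dirichlet_fun n)"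
proof -
  have w: "wderiv \<Omega> (dirichlet_fun n) \<in> H1 \<Omega>" using dirichlet_fun_H2 by (simp add: H2_def)
  have "L2_inner \<Omega> (wderiv \<Omega> v) (wderiv \<Omega> (dirichlet_fun n)) = - L2_inner \<Omega> v (wderiv \<Omega> (wderiv \<Omega> (dirichlet_fun n)))"
    by (rule H01_integration_by_parts[OF assms w])
  also have "L2_inner \<Omega> v (wderiv \<Omega> (wderiv \<Omega> (dirichlet_fun n))) = L2_inner \<Omega> (\<lambda>x. - dirichlet_ev n * dirichlet_fun n x) v"
    unfolding L2_inner_commute[of _ v "wderiv \<Omega> (wderiv \<Omega> (dirichlet_fun n))"]
    by (intro L2_inner_cong_AE dirichlet_fun_H2(2) L2_measurable L2_cmult dirichlet_fun_L2 wderiv_H1 w H01_H1 assms)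
  also have "\<dots> = - dirichlet_ev n * L2_inner \<Omega> v (dirichlet_fun n)"
    unfolding L2_inner_cmult_left by (simp add: L2_inner_commute)
  finally show ?thesis by simp
qed

text \<open>Two integrations by parts: the eigenfunction supplies the zero boundary values for one
  of them and \<open>v\<close> for the other.\<close>

lemma wderiv2_inner_dirichlet_fun:
  assumes "v \<in> H2 \<Omega> \<inter> H01 \<Omega>"
  shows "L2_inner \<Omega> (wderiv \<Omega> (wderiv \<Omega> v)) (dirichlet_fun n) = - dirichlet_ev n * L2_inner \<Omega> v (dirichlet_fun n)"
proof -
  have "L2_inner \<Omega> (wderiv \<Omega> (dirichlet_fun n)) (wderiv \<Omega> v) = - L2_inner \<Omega> (dirichlet_fun n) (wderiv \<Omega> (wderiv \<Omega> v))"
    by (rule H01_integration_by_parts[OF dirichlet_fun_H01']) (use assms in \<open>simp add: H2_def\<close>)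
  then show ?thesis
    using wderiv_inner_dirichlet_fun[of v n] assms by (simp add: L2_inner_commute)
qed

text \<open>\<open>sin (n \<theta>)\<close> is \<open>sin \<theta>\<close> times a polynomial in \<open>cos \<theta>\<close>, so by Weierstrass the orthogonality
  extends from the sines to all products of \<open>sin \<theta>\<close> with a continuous function.\<close>

lemma dirichlet_fun_complete:
  assumes h: "integrable M h" and zero: "\<And>n. (LINT x|M. h x * dirichlet_fun n x) = 0"
  shows "AE x in M. h x = 0"
proof -
  define \<theta> where "\<theta> x = pi / L * (x - p)" for x
  have \<theta>c: "continuous_on UNIV \<theta>" unfolding \<theta>_def by (intro continuous_intros)
  have \<theta>0: "0 < \<theta> x" "\<theta> x < pi" if "x \<in> \<Omega>" for x
  proof -
    show "0 < \<theta> x" using that pq by (simp add: \<theta>_def)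
    have "pi * (x - p) < pi * L" using that by simp
    then show "\<theta> x < pi" using pq unfolding \<theta>_def by (simp add: field_simps)
  qed
  have span: "continuous_on UNIV w \<and> (LINT x|M. h x * w x) = 0" if "w \<in> sine_span \<theta>" for w
    using that
  proof induction
    case (sin m)
    show ?case
    proof (cases m)
      case (Suc n)
      have eq: "sin (real m * \<theta> x) = dirichlet_fun n x" for x
        unfolding Suc dirichlet_fun_def \<theta>_def by (intro arg_cong[where f = sin]) simp
      show ?thesis unfolding eq using zero smooth_alg_continuous[OF dirichlet_fun_smooth, of UNIV n] by simp
    qed simp
  next
    case (add f g)
    then show ?case
      using integrable_mult_continuous[OF h] by (auto intro!: continuous_intros simp: distrib_left)
  next
    case (cmult f c)
    then show ?case by (auto intro!: continuous_intros simp: mult.left_commute[of _ c])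
  qed
  have sc: "continuous_on UNIV (\<lambda>x. sin (\<theta> x))" by (intro continuous_intros \<theta>c)
  have "AE x in M. h x * sin (\<theta> x) = 0"
  proof (rule AE_eq_0_if_integral_mult_continuous_eq_0)
    show hs: "integrable M (\<lambda>x. h x * sin (\<theta> x))" by (rule integrable_mult_continuous[OF h sc])
    fix k :: "real \<Rightarrow> real" assume k: "continuous_on UNIV k"
    show "(LINT x|M. h x * sin (\<theta> x) * k x) = 0"
    proof (rule integral_mult_eq_0_if_approx[OF hs k])
      fix e :: real assume e: "e > 0"
      \<comment> \<open>On the interval, \<open>\<theta>\<close> takes values between 0 and
        \<open>pi\<close>, so \<open>arccos\<close> inverts the cosine there and \<open>k\<close>
        becomes a continuous function of \<open>cos (\<theta> x)\<close>, which Weierstrass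
        approximates.\<close>
      have "continuous_on {-1..1} (\<lambda>c. k (p + L / pi * arccos c))"
        by (intro continuous_on_compose2[OF k] continuous_intros) auto
      then obtain P where P: "real_polynomial_function P" "\<And>c. c \<in> {-1..1} \<Longrightarrow> \<bar>k (p + L / pi * arccos c) - P c\<bar> < e"
        using Stone_Weierstrass_real_polynomial_function[of "{-1..1}" "\<lambda>c. k (p + L / pi * arccos c)" e] e by auto
      have "\<bar>k x - P (cos (\<theta> x))\<bar> \<le> e" if x: "x \<in> \<Omega>" for x
      proof -
        have "arccos (cos (\<theta> x)) = \<theta> x" using \<theta>0[OF x] by (intro arccos_cos) auto
        moreover have "p + L / pi * \<theta> x = x" using pq by (simp add: \<theta>_def)
        ultimately show ?thesis using P(2)[of "cos (\<theta> x)"] by simp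
      qed
      moreover have "continuous_on UNIV (\<lambda>x. P (cos (\<theta> x)))"
        by (intro continuous_on_compose2[OF smooth_alg_continuous[OF real_polynomial_function_smooth_alg[OF P(1)], of UNIV]]
            continuous_intros \<theta>c) auto
      moreover have "(LINT x|M. h x * sin (\<theta> x) * P (cos (\<theta> x))) = 0"
        using span[OF sine_span_polynomial[OF P(1) sine_span.sin[of 1 \<theta>]]] by (simp add: mult_ac)
      ultimately show "\<exists>P. continuous_on UNIV P \<and> (\<forall>x\<in>\<Omega>. \<bar>k x - P x\<bar> \<le> e) \<and> (LINT x|M. h x * sin (\<theta> x) * P x) = 0"
        by (intro exI[of _ "\<lambda>x. P (cos (\<theta> x))"]) auto
    qed
  qed
  then show ?thesis
  proof (rule AE_mp, intro AE_I2 impI)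
    fix x assume "x \<in> space M" "h x * sin (\<theta> x) = 0"
    moreover have "sin (\<theta> x) > 0" using \<theta>0[of x] \<open>x \<in> space M\<close> by (intro sin_gt_zero) auto
    ultimately show "h x = 0" by simp
  qed
qed

end

section \<open>Eigenspaces and sine expansions\<close>

context bounded_interval
begin

lemma dirichlet_fun_orthogonal:
  assumes "n \<noteq> m"
  shows "L2_inner \<Omega> (dirichlet_fun n) (dirichlet_fun m) = 0"
proof -
  have "dirichlet_ev m * L2_inner \<Omega> (dirichlet_fun n) (dirichlet_fun m) = dirichlet_ev n * L2_inner \<Omega> (dirichlet_fun n) (dirichlet_fun m)"
    using wderiv_inner_dirichlet_fun[OF dirichlet_fun_H01', of n m] wderiv_inner_dirichlet_fun[OF dirichlet_fun_H01', of m n]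
    by (metis L2_inner_commute)
  moreover have "dirichlet_ev m \<noteq> dirichlet_ev n"
    using assms strict_mono_eq[OF dirichlet_ev_strict_mono] by auto
  ultimately show ?thesis by simp
qed

lemma dirichlet_fun_norm: "L2_inner \<Omega> (dirichlet_fun n) (dirichlet_fun n) = L / 2"
proof -
  define a where "a = real (Suc n) * pi / L"
  have a: "a > 0" unfolding a_def using pq by simp
  define F where "F x = x / 2 - sin (2 * a * (x - p)) / (4 * a)" for x
  have "((\<lambda>x. dirichlet_fun n x * dirichlet_fun n x) has_integral F q - F p) {p..q}"
  proof (rule fundamental_theorem_of_calculus)
    fix x
    have "(F has_real_derivative 1 / 2 - cos (2 * a * (x - p)) / 2) (at x)"
      unfolding F_def[abs_def] using a by (auto intro!: derivative_eq_intros)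
    moreover have "1 / 2 - cos (2 * a * (x - p)) / 2 = dirichlet_fun n x * dirichlet_fun n x"
      using cos_double_sin[of "a * (x - p)"]
      by (simp add: dirichlet_fun_def a_def[symmetric] power2_eq_square mult.assoc diff_divide_distrib del: of_nat_Suc)
    ultimately show "(F has_vector_derivative dirichlet_fun n x * dirichlet_fun n x) (at x within {p..q})"
      by (metis has_field_derivative_at_within has_real_derivative_iff_has_vector_derivative)
  qed (use pq in simp)
  moreover have "F q - F p = L / 2"
  proof -
    have "2 * a * (q - p) = real (2 * Suc n) * pi" using pq by (simp add: a_def)
    then have "sin (2 * a * (q - p)) = 0" by (simp only: sin_npi)
    then show ?thesis by (simp add: F_def diff_divide_distrib)
  qed
  ultimately have "((\<lambda>x. dirichlet_fun n x * dirichlet_fun n x) has_integral L / 2) \<Omega>"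
    by (simp add: has_integral_Icc_iff_Ioo)
  then show ?thesis
    unfolding L2_inner_def
    using lebesgue_integral_eq_integral[OF L2_mult_integrable[OF dirichlet_fun_L2[of n] dirichlet_fun_L2[of n]]]
    by (simp add: integral_unique)
qed

lemma L2_complete:
  assumes "h \<in> L2 \<Omega>" "\<And>n. L2_inner \<Omega> h (dirichlet_fun n) = 0"
  shows "AE x in M. h x = 0"
  using dirichlet_fun_complete[OF L2_integrable[OF assms(1)]] assms(2) by (simp add: L2_inner_def)

lemma eigenspace_inner_dirichlet_fun:
  assumes "v \<in> eigenspace \<Omega> lam" "dirichlet_ev n \<noteq> lam"
  shows "L2_inner \<Omega> v (dirichlet_fun n) = 0"
proof -
  have v: "v \<in> H2 \<Omega> \<inter> H01 \<Omega>" "AE x in M. wderiv \<Omega> (wderiv \<Omega> v) x = - lam * v x"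
    using assms(1) by (auto simp: eigenspace_def elim!: eventually_mono)
  have vL: "v \<in> L2 \<Omega>" "wderiv \<Omega> (wderiv \<Omega> v) \<in> L2 \<Omega>" using v(1) wderiv_H1 by (auto simp: H2_def)
  have "L2_inner \<Omega> (wderiv \<Omega> (wderiv \<Omega> v)) (dirichlet_fun n) = L2_inner \<Omega> (\<lambda>x. - lam * v x) (dirichlet_fun n)"
    using v vL by (intro L2_inner_cong_AE L2_measurable L2_cmult dirichlet_fun_L2) auto
  then have "dirichlet_ev n * L2_inner \<Omega> v (dirichlet_fun n) = lam * L2_inner \<Omega> v (dirichlet_fun n)"
    unfolding wderiv2_inner_dirichlet_fun[OF v(1)] L2_inner_cmult_left by simp
  then show ?thesis using assms(2) by simp
qed

lemma eigenspace_L2: "v \<in> eigenspace \<Omega> lam \<Longrightarrow> v \<in> L2 \<Omega>"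
  using wderiv_H1 by (auto simp: eigenspace_def H2_def)

text \<open>An eigenfunction for any other value would be orthogonal to every sine and hence zero by
  completeness.\<close>

lemma eigenvalue_imp_dirichlet_ev:
  assumes "lam \<in> eigenvalues \<Omega>"
  obtains m where "lam = dirichlet_ev m"
proof (rule ccontr)
  assume "\<not> thesis"
  then have ne: "dirichlet_ev n \<noteq> lam" for n using that by blast
  obtain v where v: "v \<in> eigenspace \<Omega> lam" "\<not> (AE x in M. v x = 0)"
    using assms by (auto simp: eigenvalues_def)
  then show False
    using L2_complete[OF eigenspace_L2[OF v(1)]] eigenspace_inner_dirichlet_fun[OF v(1) ne] by blast
qed

text \<open>The eigenspaces are one-dimensional: after subtracting the component along
  \<open>dirichlet_fun m\<close>, the remainder is orthogonal to all sines.\<close>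

lemma eigenspace_dirichlet_ev:
  assumes "v \<in> eigenspace \<Omega> (dirichlet_ev m)"
  shows "AE x in M. v x = 2 / L * L2_inner \<Omega> v (dirichlet_fun m) * dirichlet_fun m x"
proof -
  define k where "k = 2 / L * L2_inner \<Omega> v (dirichlet_fun m)"
  note vL = eigenspace_L2[OF assms]
  have fL: "(\<lambda>x. k * dirichlet_fun m x) \<in> L2 \<Omega>" by (rule L2_cmult[OF dirichlet_fun_L2])
  have "AE x in M. v x - k * dirichlet_fun m x = 0"
  proof (rule L2_complete)
    show "(\<lambda>x. v x - k * dirichlet_fun m x) \<in> L2 \<Omega>" by (rule L2_diff[OF vL fL])
    fix n
    have "L2_inner \<Omega> (\<lambda>x. v x - k * dirichlet_fun m x) (dirichlet_fun n) = L2_inner \<Omega> v (dirichlet_fun n) - k * L2_inner \<Omega> (dirichlet_fun m) (dirichlet_fun n)"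
      using L2_inner_diff_left[OF vL fL dirichlet_fun_L2] by (simp add: L2_inner_cmult_left)
    also have "\<dots> = 0"
    proof (cases "n = m")
      case True
      then show ?thesis using pq by (simp add: dirichlet_fun_norm k_def)
    next
      case False
      then have "dirichlet_ev n \<noteq> dirichlet_ev m"
        using strict_mono_eq[OF dirichlet_ev_strict_mono] by auto
      then show ?thesis
        using False eigenspace_inner_dirichlet_fun[OF assms] dirichlet_fun_orthogonal[of m n] by simp
    qed
    finally show "L2_inner \<Omega> (\<lambda>x. v x - k * dirichlet_fun m x) (dirichlet_fun n) = 0" .
  qed
  then show ?thesis unfolding k_def by eventually_elim simp
qed

lemma dirichlet_fun_eigenspace: "(\<lambda>x. c * dirichlet_fun m x) \<in> eigenspace \<Omega> (dirichlet_ev m)"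
proof -
  have s: "(\<lambda>x. c * dirichlet_fun m x) \<in> smooth_alg" by (rule smooth_alg_cmult[OF dirichlet_fun_smooth])
  have d: "deriv (\<lambda>x. c * f x) = (\<lambda>x. c * deriv f x)" if "f \<in> smooth_alg" for f
    using DERIV_cmult[OF smooth_alg_DERIV[OF that]] by (auto simp: fun_eq_iff intro: DERIV_imp_deriv)
  have "deriv (deriv (\<lambda>x. c * dirichlet_fun m x)) = (\<lambda>x. c * deriv (deriv (dirichlet_fun m)) x)"
    by (simp add: d smooth_alg_deriv dirichlet_fun_smooth)
  then have "AE x in M. - wderiv \<Omega> (wderiv \<Omega> (\<lambda>x. c * dirichlet_fun m x)) x = dirichlet_ev m * (c * dirichlet_fun m x)"
    using smooth_alg_H2(2)[OF s] by (auto simp: deriv_dirichlet_fun elim!: eventually_mono)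
  then show ?thesis
    using smooth_alg_H2(1)[OF s] dirichlet_fun_H01 by (simp add: eigenspace_def)
qed

text \<open>\<open>eigenprojection\<close> is a choice, so a witness is exhibited first. Whatever is
  chosen has the same \<open>m\<close>-th coefficient as \<open>u\<close>, which determines it
  almost everywhere on a one-dimensional space.\<close>

lemma eigenprojection_dirichlet_ev:
  assumes u: "u \<in> L2 \<Omega>"
  shows "AE x in M. eigenprojection \<Omega> (dirichlet_ev m) u x = 2 / L * L2_inner \<Omega> u (dirichlet_fun m) * dirichlet_fun m x"
proof -
  define c where "c = 2 / L * L2_inner \<Omega> u (dirichlet_fun m)"
  let ?P = "\<lambda>w. w \<in> eigenspace \<Omega> (dirichlet_ev m) \<and> (\<forall>z\<in>eigenspace \<Omega> (dirichlet_ev m). L2_inner \<Omega> (\<lambda>x. u x - w x) z = 0)"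
  have fL: "(\<lambda>x. k * dirichlet_fun m x) \<in> L2 \<Omega>" for k by (rule L2_cmult[OF dirichlet_fun_L2])
  have "?P (\<lambda>x. c * dirichlet_fun m x)"
  proof (intro conjI ballI dirichlet_fun_eigenspace)
    fix z assume z: "z \<in> eigenspace \<Omega> (dirichlet_ev m)"
    let ?d = "\<lambda>x. u x - c * dirichlet_fun m x"
    have dL: "?d \<in> L2 \<Omega>" by (rule L2_diff[OF u fL])
    define k where "k = 2 / L * L2_inner \<Omega> z (dirichlet_fun m)"
    have "L2_inner \<Omega> z ?d = L2_inner \<Omega> (\<lambda>x. k * dirichlet_fun m x) ?d"
      using eigenspace_dirichlet_ev[OF z] unfolding k_def
      by (rule L2_inner_cong_AE) (intro L2_measurable eigenspace_L2[OF z] fL dL)+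
    also have "\<dots> = k * L2_inner \<Omega> ?d (dirichlet_fun m)"
      by (simp add: L2_inner_cmult_left L2_inner_commute[of \<Omega> "dirichlet_fun m"])
    also have "L2_inner \<Omega> ?d (dirichlet_fun m) = 0"
    proof -
      have "L2_inner \<Omega> ?d (dirichlet_fun m) = L2_inner \<Omega> u (dirichlet_fun m) - c * (L / 2)"
        using L2_inner_diff_left[OF u fL dirichlet_fun_L2, of c m] by (simp add: L2_inner_cmult_left dirichlet_fun_norm)
      also have "\<dots> = 0" using pq by (simp add: c_def)
      finally show ?thesis .
    qed
    finally show "L2_inner \<Omega> ?d z = 0" by (simp add: L2_inner_commute)
  qed
  then have "?P (eigenprojection \<Omega> (dirichlet_ev m) u)"
    unfolding eigenprojection_def by (rule someI[of ?P])
  then obtain w where w: "w = eigenprojection \<Omega> (dirichlet_ev m) u" "?P w" by blast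
  have "L2_inner \<Omega> (\<lambda>x. u x - w x) (dirichlet_fun m) = 0"
    using w(2) dirichlet_fun_eigenspace[of 1 m] by simp
  then have "L2_inner \<Omega> w (dirichlet_fun m) = L2_inner \<Omega> u (dirichlet_fun m)"
    using L2_inner_diff_left[OF u eigenspace_L2 dirichlet_fun_L2] w(2) by auto
  then show ?thesis using eigenspace_dirichlet_ev[of w m] w by simp
qed

text \<open>The set where the two differ is open and null, hence empty.\<close>

lemma continuous_AE_eq_imp_eq:
  fixes f g :: "real \<Rightarrow> real"
  assumes "continuous_on (closure \<Omega>) f" "continuous_on (closure \<Omega>) g" "AE x in M. f x = g x" "x \<in> \<Omega>"
  shows "f x = g x"
proof -
  let ?h = "\<lambda>x. f x - g x"
  let ?S = "\<Omega> \<inter> ?h -` (- {0})"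
  have "continuous_on \<Omega> ?h"
    using assms(1,2) closure_subset by (intro continuous_intros) (auto intro: continuous_on_subset)
  then have o: "open ?S" by (intro continuous_open_preimage) auto
  have "AE x in lebesgue. x \<in> \<Omega> \<longrightarrow> f x = g x"
    using assms(3) by (subst (asm) AE_restrict_space_iff) auto
  moreover have "{x \<in> space lebesgue. \<not> (x \<in> \<Omega> \<longrightarrow> f x = g x)} = ?S" by auto
  ultimately have "?S \<in> null_sets lebesgue"
    using AE_iff_null[of lebesgue "\<lambda>x. x \<in> \<Omega> \<longrightarrow> f x = g x"] o by auto
  then have "?S = {}" using open_not_negligible[OF o] by (auto simp: negligible_iff_null_sets)
  then show ?thesis using assms(4) by auto
qed

lemma point_value_eq:
  assumes g: "continuous_on (closure \<Omega>) g" "AE x in M. v x = g x" and x: "x \<in> \<Omega>"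
  shows "point_value \<Omega> v x = g x"
  unfolding point_value_def
proof (rule the_equality)
  show "\<exists>f. continuous_on (closure \<Omega>) f \<and> (AE z in M. f z = v z) \<and> g x = f x"
    using g by (intro exI[of _ g]) (auto elim: eventually_mono)
  fix y assume "\<exists>f. continuous_on (closure \<Omega>) f \<and> (AE z in M. f z = v z) \<and> y = f x"
  then obtain f where f: "continuous_on (closure \<Omega>) f" "AE z in M. f z = v z" "y = f x" by blast
  have "AE z in M. f z = g z" using f(2) g(2) by eventually_elim simp
  then show "y = g x" using continuous_AE_eq_imp_eq[OF f(1) g(1) _ x] f(3) by simp
qed

text \<open>Absolute summability makes the sine series converge uniformly to a continuous function
  with the same coefficients as \<open>v\<close>. By completeness it is the continuous
  representative of \<open>v\<close>.\<close>

lemma point_value_series: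
  assumes v: "v \<in> L2 \<Omega>" and c: "\<And>n. L2_inner \<Omega> v (dirichlet_fun n) = c n"
    and sc: "summable (\<lambda>n. \<bar>c n\<bar>)" and x: "x \<in> \<Omega>"
  shows "point_value \<Omega> v x = (\<Sum>n. 2 / L * c n * dirichlet_fun n x)"
proof -
  define g where "g x = (\<Sum>n. 2 / L * c n * dirichlet_fun n x)" for x
  have bound: "norm (2 / L * c n * dirichlet_fun n x) \<le> 2 / L * \<bar>c n\<bar>" for n x
  proof -
    have "\<bar>2 / L * c n\<bar> * \<bar>dirichlet_fun n x\<bar> \<le> \<bar>2 / L * c n\<bar> * 1"
      unfolding dirichlet_fun_def by (intro mult_left_mono) auto
    then show ?thesis using pq by (simp add: abs_mult)
  qed
  have s2: "summable (\<lambda>n. 2 / L * \<bar>c n\<bar>)" by (rule summable_mult[OF sc])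
  have "uniform_limit UNIV (\<lambda>N x. \<Sum>n<N. 2 / L * c n * dirichlet_fun n x) g sequentially"
    unfolding g_def by (rule Weierstrass_m_test[OF _ s2]) (rule bound)
  then have gc: "continuous_on UNIV g"
    by (rule uniform_limit_theorem[rotated])
       (auto intro!: always_eventually continuous_on_sum continuous_on_mult[OF continuous_on_const] smooth_alg_continuous[OF dirichlet_fun_smooth] simp del: times_divide_eq_left)
  have gL: "g \<in> L2 \<Omega>" by (rule L2_continuous[OF gc])
  have gi: "L2_inner \<Omega> g (dirichlet_fun m) = c m" for m
  proof -
    have i: "integrable M (\<lambda>x. 2 / L * c n * dirichlet_fun n x * dirichlet_fun m x)" for n
      using L2_mult_integrable[OF L2_cmult[OF dirichlet_fun_L2] dirichlet_fun_L2] .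
    have b: "norm (2 / L * c n * dirichlet_fun n x * dirichlet_fun m x) \<le> 2 / L * \<bar>c n\<bar>" for n x
    proof -
      have "norm (2 / L * c n * dirichlet_fun n x) * \<bar>dirichlet_fun m x\<bar> \<le> 2 / L * \<bar>c n\<bar> * 1"
        using pq by (intro mult_mono bound) (auto simp: dirichlet_fun_def)
      then show ?thesis by (simp add: abs_mult)
    qed
    have one: "(LINT x|M. 2 / L * \<bar>c n\<bar>) = measure M (space M) * (2 / L * \<bar>c n\<bar>)" for n
      unfolding lebesgue_integral_const real_scaleR_def ..
    have "(\<lambda>n. LINT x|M. 2 / L * c n * dirichlet_fun n x * dirichlet_fun m x) sums (LINT x|M. (\<Sum>n. 2 / L * c n * dirichlet_fun n x * dirichlet_fun m x))"
    proof (rule sums_integral[OF i])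
      show "AE x in M. summable (\<lambda>n. norm (2 / L * c n * dirichlet_fun n x * dirichlet_fun m x))"
        by (intro AE_I2 summable_comparison_test'[OF s2, of 0]) (use b in simp)
      show "summable (\<lambda>n. LINT x|M. norm (2 / L * c n * dirichlet_fun n x * dirichlet_fun m x))"
      proof (rule summable_comparison_test'[OF summable_mult[OF s2], of 0])
        fix n
        have "(LINT x|M. norm (2 / L * c n * dirichlet_fun n x * dirichlet_fun m x)) \<le> (LINT x|M. 2 / L * \<bar>c n\<bar>)"
          by (rule integral_mono[OF integrable_norm[OF i] integrable_const_M b])
        then show "norm (LINT x|M. norm (2 / L * c n * dirichlet_fun n x * dirichlet_fun m x)) \<le> measure M (space M) * (2 / L * \<bar>c n\<bar>)"
          unfolding one by (simp only: real_norm_def abs_of_nonneg[OF Bochner_Integration.integral_nonneg] abs_ge_zero)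
      qed
    qed
    moreover have "(\<Sum>n. 2 / L * c n * dirichlet_fun n x * dirichlet_fun m x) = g x * dirichlet_fun m x" for x
      unfolding g_def
      by (rule suminf_mult2[symmetric], rule summable_comparison_test'[OF s2, of 0]) (use bound in simp)
    moreover have "(LINT x|M. 2 / L * c n * dirichlet_fun n x * dirichlet_fun m x) = (if n = m then c n else 0)" for n
    proof -
      have e: "(LINT x|M. 2 / L * c n * dirichlet_fun n x * dirichlet_fun m x) = 2 / L * c n * L2_inner \<Omega> (dirichlet_fun n) (dirichlet_fun m)"
        by (simp add: L2_inner_def mult.assoc)
      show ?thesis unfolding e using pq dirichlet_fun_orthogonal by (simp add: dirichlet_fun_norm)
    qed
    ultimately have "(\<lambda>n. if n = m then c n else 0) sums (LINT x|M. g x * dirichlet_fun m x)" by simp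
    from sums_unique2[OF this sums_single[of m c]] show ?thesis by (simp add: L2_inner_def)
  qed
  have "AE x in M. v x - g x = 0"
    by (rule L2_complete[OF L2_diff[OF v gL]]) (simp add: L2_inner_diff_left[OF v gL dirichlet_fun_L2] c gi)
  then have "AE x in M. v x = g x" by eventually_elim simp
  then have "point_value \<Omega> v x = g x"
    by (rule point_value_eq[OF continuous_on_subset[OF gc subset_UNIV] _ x])
  then show ?thesis by (simp add: g_def)
qed

text \<open>Moving the Laplacian onto \<open>u\<close> bounds \<open>dirichlet_ev n\<close> times
  the \<open>n\<close>-th coefficient by the integral of the absolute second derivative, and the
  reciprocal eigenvalues form a convergent inverse-square series.\<close>

lemma dirichlet_coeff_summable:
  assumes u: "u \<in> H2 \<Omega> \<inter> H01 \<Omega>"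
  shows "summable (\<lambda>n. \<bar>L2_inner \<Omega> u (dirichlet_fun n)\<bar>)"
proof -
  let ?w = "wderiv \<Omega> (wderiv \<Omega> u)"
  define C where "C = (LINT x|M. \<bar>?w x\<bar>)"
  have w: "?w \<in> L2 \<Omega>" using u wderiv_H1 by (auto simp: H2_def)
  have "dirichlet_ev n * \<bar>L2_inner \<Omega> u (dirichlet_fun n)\<bar> \<le> C" for n
  proof -
    have "dirichlet_ev n * \<bar>L2_inner \<Omega> u (dirichlet_fun n)\<bar> = \<bar>L2_inner \<Omega> ?w (dirichlet_fun n)\<bar>"
      unfolding wderiv2_inner_dirichlet_fun[OF u] using dirichlet_ev_pos[of n] by (simp add: abs_mult)
    also have "\<dots> \<le> (LINT x|M. \<bar>?w x * dirichlet_fun n x\<bar>)"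
      unfolding L2_inner_def by (rule integral_abs_bound)
    also have "\<dots> \<le> C"
      unfolding C_def
    proof (rule integral_mono)
      show "integrable M (\<lambda>x. \<bar>?w x * dirichlet_fun n x\<bar>)" by (intro integrable_abs L2_mult_integrable w dirichlet_fun_L2)
      show "integrable M (\<lambda>x. \<bar>?w x\<bar>)" by (intro integrable_abs L2_integrable w)
      show "\<bar>?w x * dirichlet_fun n x\<bar> \<le> \<bar>?w x\<bar>" for x
        by (simp add: abs_mult dirichlet_fun_def mult_left_le)
    qed
    finally show ?thesis .
  qed
  then have b: "\<bar>L2_inner \<Omega> u (dirichlet_fun n)\<bar> \<le> C / dirichlet_ev n" for n
    using dirichlet_ev_pos[of n] by (simp add: field_simps)
  have "summable (\<lambda>n. inverse (real (Suc n) ^ 2))"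
    using inverse_power_summable[of 2, where 'a = real] by (subst summable_Suc_iff) simp
  then have "summable (\<lambda>n. C * (L / pi)\<^sup>2 * inverse (real (Suc n) ^ 2))" by (rule summable_mult)
  moreover have "C * (L / pi)\<^sup>2 * inverse (real (Suc n) ^ 2) = C / dirichlet_ev n" for n
    unfolding dirichlet_ev_def using pq by (simp add: power_divide power_mult_distrib field_simps del: of_nat_Suc)
  ultimately have "summable (\<lambda>n. C / dirichlet_ev n)" by (simp only:)
  then show ?thesis
    by (rule summable_comparison_test'[where N = 0]) (use b in simp)
qed

end

section \<open>Weak solutions\<close>

text \<open>Rests on the completeness of Lebesgue measure; extension by 0 outside \<open>S\<close>
  transfers the question to the whole line.\<close>

lemma borel_measurable_lebesgue_on_AE_LIMSEQ:
  fixes f :: "real \<Rightarrow> real"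
  assumes S: "S \<in> sets lebesgue" and s: "\<And>n. s n \<in> borel_measurable (lebesgue_on S)"
    and lim: "AE t in lebesgue_on S. (\<lambda>n. s n t) \<longlonglongrightarrow> f t"
  shows "f \<in> borel_measurable (lebesgue_on S)"
proof -
  have "(\<lambda>t. lim (\<lambda>n. s n t)) \<in> borel_measurable (lebesgue_on S)"
    using s by (rule borel_measurable_lim_metric)
  then have "(\<lambda>t. if t \<in> S then lim (\<lambda>n. s n t) else 0) \<in> borel_measurable lebesgue"
    using S by (subst borel_measurable_if)
  moreover have "AE t in lebesgue. t \<in> S \<longrightarrow> (\<lambda>n. s n t) \<longlonglongrightarrow> f t"
    using lim S by (subst (asm) AE_restrict_space_iff) auto
  then have "AE t in lebesgue. (if t \<in> S then lim (\<lambda>n. s n t) else 0) = (if t \<in> S then f t else 0)"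
    by eventually_elim (auto intro: limI)
  ultimately have "(\<lambda>t. if t \<in> S then f t else 0) \<in> borel_measurable lebesgue"
    by (rule borel_measurable_AE)
  then show ?thesis using S by (subst (asm) borel_measurable_if)
qed

text \<open>Evaluation at \<open>\<Phi>\<close> is dominated by \<open>N\<close>, so it sends the
  approximating simple functions to scalar ones that converge almost everywhere.\<close>

lemma strongly_measurable_eval:
  fixes S :: "real set"
  assumes S: "S \<in> sets lebesgue" and f: "strongly_measurable (lebesgue_on S) X N f"
    and diff: "\<And>F G. F \<in> X \<Longrightarrow> G \<in> X \<Longrightarrow> F - G \<in> X" and bound: "\<And>F. F \<in> X \<Longrightarrow> \<bar>F \<Phi>\<bar> \<le> N F"
  shows "(\<lambda>t. f t \<Phi>) \<in> borel_measurable (lebesgue_on S)"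
proof -
  obtain s where fX: "AE t in lebesgue_on S. f t \<in> X" and s: "\<And>n. simple_into (lebesgue_on S) X (s n)"
    and lim: "AE t in lebesgue_on S. (\<lambda>n. N (f t - s n t)) \<longlonglongrightarrow> 0"
    using f by (auto simp: strongly_measurable_def)
  show ?thesis
  proof (rule borel_measurable_lebesgue_on_AE_LIMSEQ[OF S])
    show "(\<lambda>t. s n t \<Phi>) \<in> borel_measurable (lebesgue_on S)" for n
      using simple_function_compose1[of "lebesgue_on S" "s n" "\<lambda>F. F \<Phi>"] s[of n]
      by (auto simp: simple_into_def intro: borel_measurable_simple_function)
    show "AE t in lebesgue_on S. (\<lambda>n. s n t \<Phi>) \<longlonglongrightarrow> f t \<Phi>"
      using fX lim AE_space
    proof eventually_elim
      case (elim t)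
      have "\<bar>f t \<Phi> - s n t \<Phi>\<bar> \<le> N (f t - s n t)" for n
        using bound[OF diff[OF elim(1)], of "s n t"] s[of n] elim(3) by (auto simp: simple_into_def)
      then have "(\<lambda>n. f t \<Phi> - s n t \<Phi>) \<longlonglongrightarrow> 0"
        by (intro Lim_null_comparison[OF always_eventually elim(2)]) auto
      from tendsto_diff[OF tendsto_const[of "f t \<Phi>"] this] show ?case by simp
    qed
  qed
qed

lemma simple_bochner_integrable_eval:
  fixes s :: "'t \<Rightarrow> 'a \<Rightarrow> real"
  assumes "finite_measure M" "simple_function M s"
  shows "Bochner_Integration.simple_bochner_integrable M (\<lambda>t. s t \<Phi>)"
proof -
  have "simple_function M (\<lambda>t. s t \<Phi>)" by (rule simple_function_compose1[OF assms(2)])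
  moreover have "emeasure M {y \<in> space M. s y \<Phi> \<noteq> 0} \<noteq> \<infinity>"
    using finite_measure.emeasure_finite[OF assms(1)] by simp
  ultimately show ?thesis unfolding simple_bochner_integrable.simps by blast
qed

text \<open>A bounded functional commutes with the Bochner integral. The integrals of simple
  functions are formed pointwise in \<open>x\<close>, so the same sequence evaluated at
  \<open>\<Phi>\<close> witnesses the scalar integral.\<close>

lemma has_bochner_integral_in_eval:
  assumes fin: "finite_measure M" and f: "has_bochner_integral_in M X N f y"
    and diff: "\<And>F G. F \<in> X \<Longrightarrow> G \<in> X \<Longrightarrow> F - G \<in> X" and bound: "\<And>F. F \<in> X \<Longrightarrow> \<bar>F \<Phi>\<bar> \<le> N F"
    and int: "\<And>s. simple_into M X s \<Longrightarrow> (\<lambda>x. LINT t|M. s t x) \<in> X"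
    and meas: "(\<lambda>t. f t \<Phi>) \<in> borel_measurable M"
  shows "has_bochner_integral M (\<lambda>t. f t \<Phi>) (y \<Phi>)"
proof -
  obtain s where fX: "AE t in M. f t \<in> X" and yX: "y \<in> X" and s: "\<And>n. simple_into M X (s n)"
    and lim: "(\<lambda>n. \<integral>\<^sup>+t. ennreal (N (f t - s n t)) \<partial>M) \<longlonglongrightarrow> 0"
    and ylim: "(\<lambda>n. N ((\<lambda>x. LINT t|M. s n t x) - y)) \<longlonglongrightarrow> 0"
    using f by (auto simp: has_bochner_integral_in_def strongly_measurable_def)
  have si: "Bochner_Integration.simple_bochner_integrable M (\<lambda>t. s n t \<Phi>)" for n
    using s[of n] by (intro simple_bochner_integrable_eval fin) (simp add: simple_into_def)
  show ?thesis
  proof (rule has_bochner_integral.intros[where s = "\<lambda>n t. s n t \<Phi>", OF meas])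
    show "Bochner_Integration.simple_bochner_integrable M (\<lambda>t. s n t \<Phi>)" for n by (rule si)
    show "(\<lambda>n. \<integral>\<^sup>+t. ennreal (norm (f t \<Phi> - s n t \<Phi>)) \<partial>M) \<longlonglongrightarrow> 0"
    proof (rule tendsto_sandwich[OF _ _ tendsto_const lim])
      show "\<forall>\<^sub>F n in sequentially. (\<integral>\<^sup>+t. ennreal (norm (f t \<Phi> - s n t \<Phi>)) \<partial>M) \<le> (\<integral>\<^sup>+t. ennreal (N (f t - s n t)) \<partial>M)"
      proof (rule always_eventually, rule allI, rule nn_integral_mono_AE)
        fix n
        show "AE t in M. ennreal (norm (f t \<Phi> - s n t \<Phi>)) \<le> ennreal (N (f t - s n t))"
          using fX AE_space
        proof eventually_elim
          case (elim t)
          then show ?case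
            using bound[OF diff[OF elim(1)], of "s n t"] s[of n] by (auto simp: simple_into_def intro!: ennreal_leI)
        qed
      qed
    qed simp
    have "\<bar>(LINT t|M. s n t \<Phi>) - y \<Phi>\<bar> \<le> N ((\<lambda>x. LINT t|M. s n t x) - y)" for n
      using bound[OF diff[OF int[OF s[of n]] yX]] by simp
    then have "(\<lambda>n. (LINT t|M. s n t \<Phi>) - y \<Phi>) \<longlonglongrightarrow> 0"
      by (intro Lim_null_comparison[OF always_eventually ylim]) auto
    then show "(\<lambda>n. Bochner_Integration.simple_bochner_integral M (\<lambda>t. s n t \<Phi>)) \<longlonglongrightarrow> y \<Phi>"
      unfolding simple_bochner_integrable_eq_integral[OF si] by (simp add: LIM_zero_iff)
  qed
qed

section \<open>The dual space \<open>Hm1\<close>\<close>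

lemma Hm1_bounded: "F \<in> Hm1 S \<Longrightarrow> \<exists>C. \<forall>\<Phi>\<in>H01 S. \<bar>F \<Phi>\<bar> \<le> C * H1_norm S \<Phi>"
  by (simp add: Hm1_def)

lemma Hm1_diff:
  assumes "F \<in> Hm1 S" "G \<in> Hm1 S"
  shows "F - G \<in> Hm1 S"
proof -
  obtain C D where C: "\<And>\<Phi>. \<Phi> \<in> H01 S \<Longrightarrow> \<bar>F \<Phi>\<bar> \<le> C * H1_norm S \<Phi>"
    and D: "\<And>\<Phi>. \<Phi> \<in> H01 S \<Longrightarrow> \<bar>G \<Phi>\<bar> \<le> D * H1_norm S \<Phi>"
    using assms Hm1_bounded by metis
  have "\<bar>F \<Phi> - G \<Phi>\<bar> \<le> (C + D) * H1_norm S \<Phi>" if "\<Phi> \<in> H01 S" for \<Phi>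
    using C[OF that] D[OF that] by (simp add: distrib_right)
  then show ?thesis using assms unfolding Hm1_def by (auto simp: right_diff_distrib)
qed

lemma H1_norm_nonneg: "H1_norm S v \<ge> 0"
  by (simp add: H1_norm_def L2_inner_self_nonneg)

text \<open>Provides the hypothesis \<open>bound\<close> of the evaluation lemmas. The supremum is
  meaningful because a functional in \<open>Hm1\<close> is bounded on the unit ball.\<close>

lemma Hm1_apply_le:
  assumes F: "F \<in> Hm1 S" and \<Phi>: "\<Phi> \<in> H01 S" "H1_norm S \<Phi> \<le> 1"
  shows "\<bar>F \<Phi>\<bar> \<le> Hm1_norm S F"
  unfolding Hm1_norm_def
proof (rule cSUP_upper)
  obtain C where C: "\<And>\<Phi>. \<Phi> \<in> H01 S \<Longrightarrow> \<bar>F \<Phi>\<bar> \<le> C * H1_norm S \<Phi>"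
    using Hm1_bounded[OF F] by blast
  show "bdd_above ((\<lambda>\<Phi>. \<bar>F \<Phi>\<bar>) ` {\<Phi> \<in> H01 S. H1_norm S \<Phi> \<le> 1})"
  proof (rule bdd_aboveI2)
    fix \<Psi> assume *: "\<Psi> \<in> {\<Phi> \<in> H01 S. H1_norm S \<Phi> \<le> 1}"
    have "\<bar>F \<Psi>\<bar> \<le> C * H1_norm S \<Psi>" using C * by simp
    also have "\<dots> \<le> \<bar>C\<bar> * 1" using * H1_norm_nonneg by (intro mult_mono) auto
    finally show "\<bar>F \<Psi>\<bar> \<le> \<bar>C\<bar>" by simp
  qed
qed (use \<Phi> in simp)

text \<open>Provides the hypothesis \<open>int\<close> of
  \<open>has_bochner_integral_in_eval\<close>. A simple function has finitely many values, so a
  single constant bounds all of them.\<close>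

lemma Hm1_integral_simple:
  assumes fin: "finite_measure M" and s: "simple_into M (Hm1 S) s"
  shows "(\<lambda>\<Phi>. LINT t|M. s t \<Phi>) \<in> Hm1 S"
proof -
  have sX: "s t \<in> Hm1 S" if "t \<in> space M" for t using s that by (auto simp: simple_into_def)
  have fr: "finite (s ` space M)" using s by (simp add: simple_into_def simple_function_def)
  have i: "integrable M (\<lambda>t. s t \<Phi>)" for \<Phi>
    by (rule integrableI_simple_bochner_integrable[OF simple_bochner_integrable_eval[OF fin, of s \<Phi>]])
       (use s in \<open>simp add: simple_into_def\<close>)
  have "\<exists>C. \<forall>F\<in>s ` space M. \<forall>\<Phi>\<in>H01 S. \<bar>F \<Phi>\<bar> \<le> C * H1_norm S \<Phi>"
  proof -
    have "\<forall>F\<in>s ` space M. \<exists>C. \<forall>\<Phi>\<in>H01 S. \<bar>F \<Phi>\<bar> \<le> C * H1_norm S \<Phi>"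
      using sX by (auto simp: Hm1_def)
    then obtain C where C: "\<forall>F\<in>s ` space M. \<forall>\<Phi>\<in>H01 S. \<bar>F \<Phi>\<bar> \<le> C F * H1_norm S \<Phi>" by metis
    show ?thesis
    proof (intro exI ballI)
      fix F \<Phi> assume *: "F \<in> s ` space M" "\<Phi> \<in> H01 S"
      have "\<bar>F \<Phi>\<bar> \<le> C F * H1_norm S \<Phi>" using C * by blast
      also have "\<dots> \<le> (\<Sum>F\<in>s ` space M. \<bar>C F\<bar>) * H1_norm S \<Phi>"
        using member_le_sum[OF *(1), of "\<lambda>F. \<bar>C F\<bar>"] fr
        by (intro mult_right_mono H1_norm_nonneg) auto
      finally show "\<bar>F \<Phi>\<bar> \<le> (\<Sum>F\<in>s ` space M. \<bar>C F\<bar>) * H1_norm S \<Phi>" .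
    qed
  qed
  then obtain C where C: "\<And>t \<Phi>. t \<in> space M \<Longrightarrow> \<Phi> \<in> H01 S \<Longrightarrow> \<bar>s t \<Phi>\<bar> \<le> C * H1_norm S \<Phi>" by blast
  have b: "\<bar>LINT t|M. s t \<Phi>\<bar> \<le> (measure M (space M) * C) * H1_norm S \<Phi>" if "\<Phi> \<in> H01 S" for \<Phi>
  proof -
    have "\<bar>LINT t|M. s t \<Phi>\<bar> \<le> (LINT t|M. \<bar>s t \<Phi>\<bar>)" by (rule integral_abs_bound)
    also have "\<dots> \<le> (LINT t|M. C * H1_norm S \<Phi>)"
      by (rule integral_mono[OF integrable_abs[OF i] finite_measure.integrable_const[OF fin]]) (use C that in auto)
    finally show ?thesis by (simp add: mult_ac)
  qed
  have add: "(LINT t|M. s t (\<lambda>x. \<Phi> x + \<Psi> x)) = (LINT t|M. s t \<Phi>) + (LINT t|M. s t \<Psi>)"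
    if "\<Phi> \<in> H01 S" "\<Psi> \<in> H01 S" for \<Phi> \<Psi>
  proof -
    have "(LINT t|M. s t (\<lambda>x. \<Phi> x + \<Psi> x)) = (LINT t|M. s t \<Phi> + s t \<Psi>)"
      by (rule Bochner_Integration.integral_cong) (use sX that in \<open>auto simp: Hm1_def\<close>)
    then show ?thesis using i by simp
  qed
  have cm: "(LINT t|M. s t (\<lambda>x. c * \<Phi> x)) = c * (LINT t|M. s t \<Phi>)" if "\<Phi> \<in> H01 S" for \<Phi> c
  proof -
    have "(LINT t|M. s t (\<lambda>x. c * \<Phi> x)) = (LINT t|M. c * s t \<Phi>)"
      by (rule Bochner_Integration.integral_cong) (use sX that in \<open>auto simp: Hm1_def\<close>)
    then show ?thesis by simp
  qed
  show ?thesis unfolding Hm1_def using add cm b by blast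
qed

section \<open>The Volterra equation of the sine coefficients\<close>

context bounded_interval
begin

text \<open>\<open>Hm1_apply_le\<close> asks for a test function in the unit ball of
  \<open>H01\<close>; scaling brings the eigenfunction there.\<close>

lemma dirichlet_fun_scaled_unit:
  obtains k where "k > 0" "H1_norm \<Omega> (\<lambda>x. k * dirichlet_fun n x) \<le> 1"
proof -
  define B where "B = L2_inner \<Omega> (dirichlet_fun n) (dirichlet_fun n) + L2_inner \<Omega> (deriv (dirichlet_fun n)) (deriv (dirichlet_fun n))"
  have B: "B \<ge> 0" unfolding B_def by (simp add: L2_inner_self_nonneg)
  have norm: "(H1_norm \<Omega> (\<lambda>x. k * dirichlet_fun n x))\<^sup>2 = k\<^sup>2 * B" for k
  proof -
    have s: "(\<lambda>x. k * dirichlet_fun n x) \<in> smooth_alg" by (rule smooth_alg_cmult[OF dirichlet_fun_smooth])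
    have d: "deriv (\<lambda>x. k * dirichlet_fun n x) = (\<lambda>x. k * deriv (dirichlet_fun n) x)"
      using DERIV_cmult[OF smooth_alg_DERIV[OF dirichlet_fun_smooth[of n]]] by (auto simp: fun_eq_iff intro: DERIV_imp_deriv)
    have z: "deriv (\<lambda>x. 0 :: real) = (\<lambda>x. 0)" by (auto simp: fun_eq_iff)
    note S = smooth_alg_H1[OF s] and S' = smooth_alg_H1[OF smooth_alg_deriv[OF s]]
    note Z = smooth_alg_H1[OF smooth_alg_const[of 0]]
    \<comment> \<open>Written as a distance to 0 so that \<open>H1_norm_diff\<close> can replace the
      chosen weak derivative by the classical one.\<close>
    have "(H1_norm \<Omega> (\<lambda>x. k * dirichlet_fun n x - 0))\<^sup>2 = L2_inner \<Omega> (\<lambda>x. k * dirichlet_fun n x - 0) (\<lambda>x. k * dirichlet_fun n x - 0)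
        + L2_inner \<Omega> (\<lambda>x. k * deriv (dirichlet_fun n) x - 0) (\<lambda>x. k * deriv (dirichlet_fun n) x - 0)"
      by (rule H1_norm_diff) (use S S' Z in \<open>simp_all add: d z\<close>)
    then show ?thesis
      by (simp add: B_def L2_inner_cmult_left L2_inner_commute[of \<Omega> _ "\<lambda>x. k * _ x"] power2_eq_square algebra_simps)
  qed
  define k where "k = 1 / sqrt (B + 1)"
  have k: "k > 0" using B by (simp add: k_def)
  have "(H1_norm \<Omega> (\<lambda>x. k * dirichlet_fun n x))\<^sup>2 \<le> 1\<^sup>2"
    unfolding norm using B by (simp add: k_def power_divide field_simps)
  then have "H1_norm \<Omega> (\<lambda>x. k * dirichlet_fun n x) \<le> 1" by (rule power2_le_imp_le) simp
  with k show ?thesis by (rule that)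
qed

text \<open>Tested with an eigenfunction, the weak formulation becomes the scalar Volterra equation that
  characterizes the Mittag-Leffler function.\<close>

lemma weak_solution_coeff:
  assumes \<alpha>: "0 < \<alpha>" "\<alpha> < 1" and a: "a > 0" and T: "T > 0" and u0: "u0 \<in> L2 \<Omega>"
    and sol: "weak_solution \<alpha> T \<Omega> a u0 u"
  shows "AE t in lebesgue_on {0<..<T}. u t \<in> H01 \<Omega> \<and>
    L2_inner \<Omega> (u t) (dirichlet_fun n) = L2_inner \<Omega> u0 (dirichlet_fun n) * mittag_leffler \<alpha> (- (a * dirichlet_ev n) * t powr \<alpha>)"
proof -
  let ?I = "lebesgue_on {0<..<T}" and ?\<phi> = "dirichlet_fun n"
  define \<kappa> where "\<kappa> = a * dirichlet_ev n"
  have \<kappa>: "\<kappa> > 0" using a dirichlet_ev_pos by (simp add: \<kappa>_def)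
  have G: "Gamma \<alpha> > 0" using \<alpha> by (intro Gamma_real_pos)
  obtain w where cap: "has_caputo_derivative \<alpha> T (Hm1 \<Omega>) (Hm1_norm \<Omega>) (\<lambda>t. L2_inner \<Omega> (\<lambda>x. u t x - u0 x)) w"
    and eq: "AE t in ?I. \<forall>\<Phi>\<in>H01 \<Omega>. w t \<Phi> + a * L2_inner \<Omega> (wderiv \<Omega> (u t)) (wderiv \<Omega> \<Phi>) = 0"
    and uH: "AE t in ?I. u t \<in> H01 \<Omega>"
    using sol by (auto simp: weak_solution_def bochner_L2_def strongly_measurable_def)
  have wL2: "w \<in> bochner_L2 T (Hm1 \<Omega>) (Hm1_norm \<Omega>)"
    and frac: "AE t in ?I. has_bochner_integral_in (lebesgue_on {0<..<t}) (Hm1 \<Omega>) (Hm1_norm \<Omega>)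
          (\<lambda>s x. (1 / Gamma \<alpha>) * (t - s) powr (\<alpha> - 1) * w s x) (L2_inner \<Omega> (\<lambda>x. u t x - u0 x))"
    using cap by (auto simp: has_caputo_derivative_def has_frac_integral_def)
  have wH: "AE t in ?I. w t \<in> Hm1 \<Omega>" and wsm: "strongly_measurable ?I (Hm1 \<Omega>) (Hm1_norm \<Omega>) w"
    and wi: "integrable ?I (\<lambda>t. (Hm1_norm \<Omega> (w t))\<^sup>2)"
    using wL2 by (auto simp: bochner_L2_def strongly_measurable_def)
  obtain k where k: "k > 0" "H1_norm \<Omega> (\<lambda>x. k * ?\<phi> x) \<le> 1" by (rule dirichlet_fun_scaled_unit)
  define \<Phi> where "\<Phi> x = k * ?\<phi> x" for x
  have \<Phi>: "\<Phi> \<in> H01 \<Omega>" "H1_norm \<Omega> \<Phi> \<le> 1" using k(2) dirichlet_fun_H01 unfolding \<Phi>_def[abs_def] by auto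
  note bound = Hm1_apply_le[OF _ \<Phi>]
  define c where "c t = L2_inner \<Omega> (u t) \<Phi>" for t
  define c0 where "c0 = L2_inner \<Omega> u0 \<Phi>"
  have Wm: "(\<lambda>t. w t \<Phi>) \<in> borel_measurable ?I"
    by (rule strongly_measurable_eval[OF _ wsm Hm1_diff bound]) auto
  have finT: "finite_measure (lebesgue_on {0<..<t})" for t :: real
    by (rule finite_measure_lebesgue_on) auto
  have Wi: "integrable ?I (\<lambda>t. w t \<Phi>)"
  proof (rule Bochner_Integration.integrable_bound[OF _ Wm])
    \<comment> \<open>On a finite interval square integrability gives integrability, through
      \<open>y \<le> 1 + y\<^sup>2\<close>.\<close>
    show "integrable ?I (\<lambda>t. 1 + (Hm1_norm \<Omega> (w t))\<^sup>2)"
      by (intro Bochner_Integration.integrable_add wi finite_measure.integrable_const[OF finT])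
    show "AE t in ?I. norm (w t \<Phi>) \<le> norm (1 + (Hm1_norm \<Omega> (w t))\<^sup>2)"
      using wH
    proof eventually_elim
      case (elim t)
      have "y \<le> 1 + y\<^sup>2" for y :: real
        using sum_squares_bound[of y 1] by (cases "y \<ge> 0") (auto intro: order_trans[of _ "0"] add_nonneg_nonneg)
      from order_trans[OF bound[OF elim] this] show ?case by simp
    qed
  qed
  have W: "AE t in ?I. w t \<Phi> = - \<kappa> * c t"
    using eq uH wH
  proof eventually_elim
    case (elim t)
    have "w t ?\<phi> = - \<kappa> * L2_inner \<Omega> (u t) ?\<phi>"
      using elim(1)[rule_format, OF dirichlet_fun_H01'[of n]] wderiv_inner_dirichlet_fun[OF elim(2), of n]
      by (simp add: \<kappa>_def)
    moreover have "w t \<Phi> = k * w t ?\<phi>"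
      using elim(3) dirichlet_fun_H01'[of n] unfolding \<Phi>_def[abs_def] by (simp add: Hm1_def)
    moreover have "c t = k * L2_inner \<Omega> (u t) ?\<phi>"
      unfolding c_def \<Phi>_def[abs_def] L2_inner_commute[of \<Omega> "u t"] by (rule L2_inner_cmult_left)
    ultimately show ?case by simp
  qed
  have J: "AE t in ?I. has_bochner_integral (lebesgue_on {0<..<t}) (\<lambda>s. (1 / Gamma \<alpha>) * (t - s) powr (\<alpha> - 1) * w s \<Phi>) (c t - c0)"
    using frac uH
  proof eventually_elim
    case (elim t)
    have "has_bochner_integral (lebesgue_on {0<..<t}) (\<lambda>s. (1 / Gamma \<alpha>) * (t - s) powr (\<alpha> - 1) * w s \<Phi>) (L2_inner \<Omega> (\<lambda>x. u t x - u0 x) \<Phi>)"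
    proof (rule has_bochner_integral_in_eval[OF finT elim(1) Hm1_diff bound Hm1_integral_simple[OF finT]])
      show "(\<lambda>s. 1 / Gamma \<alpha> * (t - s) powr (\<alpha> - 1) * w s \<Phi>) \<in> borel_measurable (lebesgue_on {0<..<t})"
        by (rule strongly_measurable_eval[where f = "\<lambda>s x. (1 / Gamma \<alpha>) * (t - s) powr (\<alpha> - 1) * w s x", OF _ _ Hm1_diff bound])
           (use elim(1) in \<open>auto simp: has_bochner_integral_in_def\<close>)
    qed
    moreover have "L2_inner \<Omega> (\<lambda>x. u t x - u0 x) \<Phi> = c t - c0"
      unfolding c_def c0_def
      by (rule L2_inner_diff_left) (use u0 \<Phi>(1) elim(2) H01_H1 wderiv_H1(1) in blast)+
    ultimately show ?case by simp
  qed
  define e where "e t = c0 * mittag_leffler \<alpha> (- \<kappa> * t powr \<alpha>)" for t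
  \<comment> \<open>Almost everywhere this is \<open>- \<kappa> * (c t - e t)\<close>, the scaled
    deviation from the expected solution. It is written with \<open>w\<close> because the
    measurability and integrability of \<open>w t \<Phi>\<close> have just been obtained.\<close>
  define d where "d t = w t \<Phi> + \<kappa> * e t" for t
  have em: "e \<in> borel_measurable ?I"
  proof -
    have [measurable]: "mittag_leffler \<alpha> \<in> borel_measurable (borel :: real measure)"
      by (intro borel_measurable_continuous_onI continuous_on_mittag_leffler \<alpha> continuous_on_id)
    have "e \<in> borel_measurable borel" unfolding e_def[abs_def] by measurable
    then show ?thesis by (intro measurable_restrict_space1 measurable_completion) simp
  qed
  have eb: "\<bar>e t\<bar> \<le> \<bar>c0\<bar>" for t
    using abs_mittag_leffler_le_1[OF \<alpha>, of "\<kappa> * t powr \<alpha>"] \<kappa> by (simp add: e_def abs_mult mult_left_le)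
  have ei: "integrable ?I e"
    by (rule Bochner_Integration.integrable_bound[OF finite_measure.integrable_const[OF finT[of T]] em, of c0]) (use eb in simp)
  have "AE t in ?I. d t = 0"
  proof (rule frac_integral_equation_unique[OF \<alpha>(1)])
    show "integrable ?I d" unfolding d_def by (intro Bochner_Integration.integrable_add integrable_mult_right Wi ei)
    have "AE t in ?I. t \<in> {0<..<T}" using AE_space[of ?I] by simp
    \<comment> \<open>Subtracting the Volterra equations of \<open>c\<close> and \<open>e\<close>
      shows that the kernel integral of \<open>d\<close> is
      \<open>Gamma \<alpha> * (c t - e t)\<close>, which closes the equation for
      \<open>d\<close>.\<close>
    with W J show "AE t in ?I. d t = (- \<kappa> / Gamma \<alpha>) * (LINT s|lebesgue_on {0<..<t}. (t - s) powr (\<alpha> - 1) * d s)"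
    proof eventually_elim
      case (elim t)
      let ?It = "lebesgue_on {0<..<t}"
      have t: "t > 0" using elim(3) by simp
      note V = mittag_leffler_volterra[OF \<alpha>(1) t, of \<kappa>]
      have 1: "has_bochner_integral ?It (\<lambda>s. (t - s) powr (\<alpha> - 1) * w s \<Phi>) (Gamma \<alpha> * (c t - c0))"
        using has_bochner_integral_mult_right[OF elim(2), of "Gamma \<alpha>"] G by (simp add: mult.assoc)
      have "has_bochner_integral ?It (\<lambda>s. (\<kappa> * c0) * ((t - s) powr (\<alpha> - 1) * mittag_leffler \<alpha> (- \<kappa> * s powr \<alpha>)))
          ((\<kappa> * c0) * (LINT s|?It. (t - s) powr (\<alpha> - 1) * mittag_leffler \<alpha> (- \<kappa> * s powr \<alpha>)))"
        by (rule has_bochner_integral_mult_right) (use V(1) in \<open>simp add: has_bochner_integral_iff\<close>)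
      moreover have "(\<kappa> * c0) * (LINT s|?It. (t - s) powr (\<alpha> - 1) * mittag_leffler \<alpha> (- \<kappa> * s powr \<alpha>)) = c0 * (Gamma \<alpha> * (1 - mittag_leffler \<alpha> (- \<kappa> * t powr \<alpha>)))"
        unfolding V(2)[symmetric] by simp
      moreover have "c0 * (Gamma \<alpha> * (1 - mittag_leffler \<alpha> (- \<kappa> * t powr \<alpha>))) = Gamma \<alpha> * (c0 - e t)"
        by (simp add: e_def algebra_simps)
      moreover have "(\<kappa> * c0) * ((t - s) powr (\<alpha> - 1) * mittag_leffler \<alpha> (- \<kappa> * s powr \<alpha>)) = (t - s) powr (\<alpha> - 1) * (\<kappa> * e s)" for s
        by (simp add: e_def)
      ultimately have 2: "has_bochner_integral ?It (\<lambda>s. (t - s) powr (\<alpha> - 1) * (\<kappa> * e s)) (Gamma \<alpha> * (c0 - e t))"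
        by (simp only:)
      from has_bochner_integral_add[OF 1 2]
      have "has_bochner_integral ?It (\<lambda>s. (t - s) powr (\<alpha> - 1) * d s) (Gamma \<alpha> * (c t - e t))"
        by (simp add: d_def algebra_simps)
      then have I: "(LINT s|?It. (t - s) powr (\<alpha> - 1) * d s) = Gamma \<alpha> * (c t - e t)"
        by (rule has_bochner_integral_integral_eq)
      show ?case unfolding I using elim(1) G by (simp add: d_def algebra_simps)
    qed
  qed
  with W uH show ?thesis
  proof eventually_elim
    case (elim t)
    have "\<kappa> * c t = \<kappa> * e t" using elim(1,3) unfolding d_def by linarith
    then have "c t = e t" using \<kappa> by simp
    moreover have "c t = k * L2_inner \<Omega> (u t) ?\<phi>" "c0 = k * L2_inner \<Omega> u0 ?\<phi>"
      unfolding c_def c0_def \<Phi>_def[abs_def] L2_inner_commute[of \<Omega> "u t"] L2_inner_commute[of \<Omega> u0] by (rule L2_inner_cmult_left)+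
    ultimately show ?case using k(1) elim(2) by (simp add: e_def \<kappa>_def)
  qed
qed

end

section \<open>Recovering the diffusion coefficient from one observation point\<close>

context bounded_interval
begin

text \<open>The exceptional null sets of countably many coefficients unite to one null set. Off it,
  the Mittag-Leffler factors are at most 1 in modulus, so summability is inherited from
  \<open>u0\<close>.\<close>

lemma weak_solution_point_value:
  assumes \<alpha>: "0 < \<alpha>" "\<alpha> < 1" and a: "a > 0" and T: "T > 0" and u0: "u0 \<in> H2 \<Omega> \<inter> H01 \<Omega>"
    and sol: "weak_solution \<alpha> T \<Omega> a u0 u" and x: "x \<in> \<Omega>"
  shows "AE t in lebesgue_on {0<..<T}. point_value \<Omega> (u t) x =
    (\<Sum>n. 2 / L * L2_inner \<Omega> u0 (dirichlet_fun n) * dirichlet_fun n x * mittag_leffler \<alpha> (- (a * dirichlet_ev n) * t powr \<alpha>))"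
proof -
  let ?c = "\<lambda>n. L2_inner \<Omega> u0 (dirichlet_fun n)"
  let ?E = "\<lambda>n t. mittag_leffler \<alpha> (- (a * dirichlet_ev n) * t powr \<alpha>)"
  have u0L: "u0 \<in> L2 \<Omega>" using u0 H01_H1 wderiv_H1(1) by blast
  have "AE t in lebesgue_on {0<..<T}. \<forall>n. u t \<in> H01 \<Omega> \<and> L2_inner \<Omega> (u t) (dirichlet_fun n) = ?c n * ?E n t"
    using weak_solution_coeff[OF \<alpha> a T u0L sol] by (simp add: AE_all_countable)
  then show ?thesis
  proof eventually_elim
    case (elim t)
    have "\<bar>?c n * ?E n t\<bar> \<le> \<bar>?c n\<bar>" for n
      using abs_mittag_leffler_le_1[OF \<alpha>, of "a * dirichlet_ev n * t powr \<alpha>"] a dirichlet_ev_pos[of n]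
      by (simp add: abs_mult mult_left_le)
    then have "summable (\<lambda>n. \<bar>?c n * ?E n t\<bar>)"
      by (intro summable_comparison_test'[OF dirichlet_coeff_summable[OF u0], of 0]) simp
    moreover have "u t \<in> L2 \<Omega>" using elim H01_H1 wderiv_H1(1) by blast
    ultimately have "point_value \<Omega> (u t) x = (\<Sum>n. 2 / L * (?c n * ?E n t) * dirichlet_fun n x)"
      using elim x by (intro point_value_series) auto
    then show ?case by (simp add: mult_ac)
  qed
qed

lemma point_value_eigenprojection:
  assumes u: "u \<in> L2 \<Omega>" and lam: "lam \<in> eigenvalues \<Omega>" and x: "x \<in> \<Omega>"
  obtains m where "point_value \<Omega> (eigenprojection \<Omega> lam u) x = 2 / L * L2_inner \<Omega> u (dirichlet_fun m) * dirichlet_fun m x"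
proof -
  obtain m where m: "lam = dirichlet_ev m" using eigenvalue_imp_dirichlet_ev[OF lam] .
  have "continuous_on (closure \<Omega>) (\<lambda>x. 2 / L * L2_inner \<Omega> u (dirichlet_fun m) * dirichlet_fun m x)"
    by (rule smooth_alg_continuous[OF smooth_alg_cmult[OF dirichlet_fun_smooth]])
  from point_value_eq[OF this eigenprojection_dirichlet_ev[OF u] x] show ?thesis
    using that m by blast
qed

lemma diffusion_coefficient_unique:
  assumes \<alpha>: "0 < \<alpha>" "\<alpha> < 1" and a: "0 < a2" "a2 \<le> a1" and T: "T > 0" and t1: "0 < t1" "t1 < T"
    and u0: "u0 \<in> H2 \<Omega> \<inter> H01 \<Omega>" and x: "x \<in> \<Omega>"
    and sol: "weak_solution \<alpha> T \<Omega> a1 u0 u1" "weak_solution \<alpha> T \<Omega> a2 u0 u2"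
    and lam: "lam \<in> eigenvalues \<Omega>" "point_value \<Omega> (eigenprojection \<Omega> lam u0) x \<noteq> 0"
    and eq: "\<And>t. 0 < t \<Longrightarrow> t < t1 \<Longrightarrow> point_value \<Omega> (u1 t) x = point_value \<Omega> (u2 t) x"
  shows "a1 = a2"
proof (rule ccontr)
  assume "a1 \<noteq> a2"
  then have a12: "a2 < a1" using a by simp
  define b where "b n = 2 / L * L2_inner \<Omega> u0 (dirichlet_fun n) * dirichlet_fun n x" for n
  have sb: "summable (\<lambda>n. \<bar>b n\<bar>)"
  proof (rule summable_comparison_test'[where N = 0])
    show "summable (\<lambda>n. 2 / L * \<bar>L2_inner \<Omega> u0 (dirichlet_fun n)\<bar>)"
      by (rule summable_mult[OF dirichlet_coeff_summable[OF u0]])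
    fix n
    have "\<bar>2 / L * L2_inner \<Omega> u0 (dirichlet_fun n)\<bar> * \<bar>dirichlet_fun n x\<bar> \<le> \<bar>2 / L * L2_inner \<Omega> u0 (dirichlet_fun n)\<bar> * 1"
      by (intro mult_left_mono) (auto simp: dirichlet_fun_def)
    then show "norm \<bar>b n\<bar> \<le> 2 / L * \<bar>L2_inner \<Omega> u0 (dirichlet_fun n)\<bar>"
      using pq by (simp add: b_def abs_mult)
  qed
  define f where "f a t = (\<Sum>n. b n * mittag_leffler \<alpha> (- (a * dirichlet_ev n) * t powr \<alpha>))" for a t
  have pv: "AE t in lebesgue_on {0<..<t1}. point_value \<Omega> (u t) x = f a t"
    if "a > 0" "weak_solution \<alpha> T \<Omega> a u0 u" for a u
  proof -
    have "AE t in lebesgue_on {0<..<T}. point_value \<Omega> (u t) x = f a t"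
      using weak_solution_point_value[OF \<alpha> that(1) T u0 that(2) x] by (simp add: f_def b_def)
    then have "AE t in lebesgue. t \<in> {0<..<T} \<longrightarrow> point_value \<Omega> (u t) x = f a t"
      by (subst (asm) AE_restrict_space_iff) auto
    then have "AE t in lebesgue. t \<in> {0<..<t1} \<longrightarrow> point_value \<Omega> (u t) x = f a t"
      by eventually_elim (use t1 in auto)
    then show ?thesis by (subst AE_restrict_space_iff) auto
  qed
  have cont: "continuous_on {0..} (\<lambda>y. \<Sum>n. b n * mittag_leffler \<alpha> (- (a * dirichlet_ev n) * y))" if "a > 0" for a
    using continuous_on_mittag_leffler_series[OF \<alpha> sb, of "\<lambda>n. a * dirichlet_ev n"] that dirichlet_ev_pos by simp
  have fc: "continuous_on (closure {0<..<t1}) (f a)" if "a > 0" for a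
    unfolding f_def using \<alpha> t1
    by (intro continuous_on_compose2[OF cont[OF that], of _ "\<lambda>t. t powr \<alpha>"] continuous_on_powr' continuous_on_id continuous_on_const) auto
  \<comment> \<open>The series formula holds only for almost every time. Reading the time interval
    as a second instance of the locale lets continuity upgrade the equality to every
    \<open>t\<close>.\<close>
  interpret time: bounded_interval 0 t1 by standard (use t1 in simp)
  have "AE t in lebesgue_on {0<..<t1}. t \<in> {0<..<t1}" using AE_space[of "lebesgue_on {0<..<t1}"] by simp
  with pv[OF _ sol(1)] pv[OF _ sol(2)] a have ae: "AE t in lebesgue_on {0<..<t1}. f a1 t = f a2 t"
    by (auto simp: eq elim!: eventually_elim2)
  have ft: "f a1 t = f a2 t" if "t \<in> {0<..<t1}" for t
    by (rule time.continuous_AE_eq_imp_eq[OF fc fc ae that]) (use a in auto)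
  have "b n = 0" for n
  proof (rule mittag_leffler_series_scaling_imp_eq_0[OF \<alpha> sb dirichlet_ev_strict_mono dirichlet_ev_pos a(1) a12])
    show "t1 powr \<alpha> > 0" using t1 by simp
    fix y assume y: "0 < y" "y < t1 powr \<alpha>"
    \<comment> \<open>The inverse of \<open>y = t powr \<alpha>\<close>, which absorbs the
      fractional power of time into the argument of the series.\<close>
    define t where "t = y powr (1 / \<alpha>)"
    have yt: "y = t powr \<alpha>" using y \<alpha> by (simp add: t_def powr_powr)
    have "t > 0" using y by (simp add: t_def)
    moreover have "t < t1"
    proof (rule ccontr)
      assume "\<not> t < t1"
      then have "t1 powr \<alpha> \<le> t powr \<alpha>" using t1 \<alpha> by (intro powr_mono2) auto
      then show False using y yt by simp
    qed
    ultimately show "(\<Sum>n. b n * mittag_leffler \<alpha> (- (a1 * dirichlet_ev n) * y)) = (\<Sum>n. b n * mittag_leffler \<alpha> (- (a2 * dirichlet_ev n) * y))"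
      using ft[of t] unfolding yt f_def by simp
  qed
  moreover obtain m where "point_value \<Omega> (eigenprojection \<Omega> lam u0) x = b m"
    using point_value_eigenprojection[OF _ lam(1) x, of u0] u0 H01_H1 wderiv_H1(1) unfolding b_def by blast
  ultimately show False using lam(2) by simp
qed

end

section \<open>Harmonic means as homogenized coefficients\<close>

lemma hom_coeff_mono:
  fixes l1 :: real
  assumes l1: "l1 > 0" and \<nu>: "0 < \<nu>"
    and a1: "a1 \<in> borel_measurable (lebesgue_on {0<..<l1})" "\<And>y. y \<in> {0<..<l1} \<Longrightarrow> \<nu> \<le> a1 y \<and> a1 y \<le> \<mu>"
    and a2: "a2 \<in> borel_measurable (lebesgue_on {0<..<l1})" "\<And>y. y \<in> {0<..<l1} \<Longrightarrow> \<nu> \<le> a2 y \<and> a2 y \<le> \<mu>"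
    and le: "\<And>y. y \<in> {0<..<l1} \<Longrightarrow> a2 y \<le> a1 y"
  shows "0 < hom_coeff {0<..<l1} a2" and "hom_coeff {0<..<l1} a2 \<le> hom_coeff {0<..<l1} a1"
    and "hom_coeff {0<..<l1} a1 = hom_coeff {0<..<l1} a2 \<Longrightarrow> AE y in lebesgue_on {0<..<l1}. a1 y = a2 y"
proof -
  let ?M = "lebesgue_on {0<..<l1}"
  have fin: "finite_measure ?M" by (rule finite_measure_lebesgue_on) auto
  have hc: "hom_coeff {0<..<l1} a = l1 / (LINT y|?M. 1 / a y)" for a
    using l1 by (simp add: hom_coeff_def mean_value_def)
  have int: "integrable ?M (\<lambda>y. 1 / a y)"
    if [measurable]: "a \<in> borel_measurable ?M" and b: "\<And>y. y \<in> {0<..<l1} \<Longrightarrow> \<nu> \<le> a y \<and> a y \<le> \<mu>" for a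
  proof (rule Bochner_Integration.integrable_bound[OF finite_measure.integrable_const[OF fin, of "1 / \<nu>"]])
    show "AE y in ?M. norm (1 / a y) \<le> norm (1 / \<nu>)"
    proof (intro AE_I2)
      fix y assume "y \<in> space ?M"
      then have "\<nu> \<le> a y" using b by simp
      then have "1 / a y \<le> 1 / \<nu>" "0 \<le> 1 / a y" using \<nu> by (auto intro: divide_left_mono)
      then show "norm (1 / a y) \<le> norm (1 / \<nu>)" using \<nu> by simp
    qed
  qed measurable
  \<comment> \<open>The upper bound \<open>\<mu>\<close> keeps the integrals of the reciprocals away
    from 0, so dividing by them is order reversing.\<close>
  have lower: "l1 / \<mu> \<le> (LINT y|?M. 1 / a y)"
    if a: "a \<in> borel_measurable ?M" "\<And>y. y \<in> {0<..<l1} \<Longrightarrow> \<nu> \<le> a y \<and> a y \<le> \<mu>" for a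
  proof -
    have "(LINT y|?M. 1 / \<mu>) \<le> (LINT y|?M. 1 / a y)"
    proof (rule integral_mono[OF finite_measure.integrable_const[OF fin] int[OF a]])
      fix y assume "y \<in> space ?M"
      then have "\<nu> \<le> a y" "a y \<le> \<mu>" using a(2)[of y] by auto
      then show "1 / \<mu> \<le> 1 / a y" using \<nu> by (intro divide_left_mono) auto
    qed
    then show ?thesis using l1 by (simp add: measure_restrict_space)
  qed
  have \<mu>: "\<mu> > 0" using a1(2)[of "l1 / 2"] \<nu> l1 by auto
  then have "0 < l1 / \<mu>" using l1 by simp
  then have pos: "0 < (LINT y|?M. 1 / a1 y)" "0 < (LINT y|?M. 1 / a2 y)"
    using lower[OF a1] lower[OF a2] by linarith+
  have inv: "1 / a1 y \<le> 1 / a2 y" if "y \<in> {0<..<l1}" for y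
    using that le[OF that] a1(2)[OF that] a2(2)[OF that] \<nu> by (intro divide_left_mono mult_pos_pos) auto
  have mono: "(LINT y|?M. 1 / a1 y) \<le> (LINT y|?M. 1 / a2 y)"
    by (rule integral_mono[OF int[OF a1] int[OF a2]]) (use inv in auto)
  show "0 < hom_coeff {0<..<l1} a2" unfolding hc using pos l1 by simp
  show "hom_coeff {0<..<l1} a2 \<le> hom_coeff {0<..<l1} a1"
    unfolding hc using pos mono l1 by (intro divide_left_mono) auto
  show "AE y in ?M. a1 y = a2 y" if e: "hom_coeff {0<..<l1} a1 = hom_coeff {0<..<l1} a2"
  proof -
    have "(LINT y|?M. 1 / a1 y) = (LINT y|?M. 1 / a2 y)"
      using e pos l1 unfolding hc by (simp add: field_simps)
    then have "(LINT y|?M. 1 / a2 y - 1 / a1 y) = 0"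
      using int[OF a1] int[OF a2] by simp
    then have "AE y in ?M. 1 / a2 y - 1 / a1 y = 0"
      using inv int[OF a1] int[OF a2] by (subst (asm) integral_nonneg_eq_0_iff_AE) auto
    then show ?thesis using AE_space
    proof eventually_elim
      case (elim y)
      then have "a1 y > 0" "a2 y > 0" using a1(2)[of y] a2(2)[of y] \<nu> by auto
      then show ?case using elim(1) by (simp add: field_simps)
    qed
  qed
qed

theorem proposition3p15:
  fixes \<alpha> T \<nu> \<mu> l1 p q x0 t1 :: real
    and Y \<Omega> :: "real set"
    and u0 a1 a2 :: "real \<Rightarrow> real"
    and u1 u2 :: "real \<Rightarrow> real \<Rightarrow> real"
    and lam :: "nat \<Rightarrow> real"
  assumes "0 < \<alpha>" "\<alpha> < 1" and "0 < T" and "0 < \<nu>" "\<nu> < \<mu>"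
    and "0 < l1" "Y = {0<..<l1}"
    and "p < q" "\<Omega> = {p<..<q}"
    and "x0 \<in> \<Omega>" and "t1 \<in> {0<..<T}"
    and "u0 \<in> H2 \<Omega> \<inter> H01 \<Omega>"
    and "a1 \<in> L_infty Y" "a2 \<in> L_infty Y"
    and "\<forall>y. a1 (y + l1) = a1 y" "\<forall>y. a2 (y + l1) = a2 y"
    and "\<forall>y\<in>closure Y. \<nu> \<le> a1 y \<and> a1 y \<le> \<mu>" "\<forall>y\<in>closure Y. \<nu> \<le> a2 y \<and> a2 y \<le> \<mu>"
    and "\<forall>y\<in>closure Y. a1 y \<ge> a2 y"
    and "weak_solution \<alpha> T \<Omega> (hom_coeff Y a1) u0 u1"
    and "weak_solution \<alpha> T \<Omega> (hom_coeff Y a2) u0 u2"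
    and "strict_mono_on {1..} lam" "lam ` {1..} = eigenvalues \<Omega>"
    and "\<exists>n0\<ge>1. point_value \<Omega> (eigenprojection \<Omega> (lam n0) u0) x0 \<noteq> 0"
    and "\<forall>t. 0 < t \<and> t < t1 \<longrightarrow> point_value \<Omega> (u1 t) x0 = point_value \<Omega> (u2 t) x0"
  shows "AE y in lebesgue_on Y. a1 y = a2 y"
proof -
  have Y: "y \<in> closure Y" if "y \<in> {0<..<l1}" for y
    using that closure_subset[of Y] \<open>Y = _\<close> by auto
  have meas: "a1 \<in> borel_measurable (lebesgue_on {0<..<l1})" "a2 \<in> borel_measurable (lebesgue_on {0<..<l1})"
    using \<open>a1 \<in> L_infty Y\<close> \<open>a2 \<in> L_infty Y\<close> \<open>Y = _\<close> by (auto simp: L_infty_def)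
  have b1: "\<nu> \<le> a1 y \<and> a1 y \<le> \<mu>" and b2: "\<nu> \<le> a2 y \<and> a2 y \<le> \<mu>" and le: "a2 y \<le> a1 y"
    if "y \<in> {0<..<l1}" for y
    by (rule bspec[OF assms(17) Y[OF that]], rule bspec[OF assms(18) Y[OF that]], rule bspec[OF assms(19) Y[OF that]])
  note h = hom_coeff_mono[OF assms(6,4) meas(1) b1 meas(2) b2 le]
  have eq: "point_value {p<..<q} (u1 t) x0 = point_value {p<..<q} (u2 t) x0" if "0 < t" "t < t1" for t
    using assms(25) that by (simp add: assms(9))
  interpret bounded_interval p q by standard (rule \<open>p < q\<close>)
  obtain n0 where n0: "n0 \<ge> 1" "point_value \<Omega> (eigenprojection \<Omega> (lam n0) u0) x0 \<noteq> 0"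
    using assms(24) by blast
  have ev: "lam n0 \<in> eigenvalues \<Omega>" using n0(1) assms(23) by auto
  have t1: "0 < t1" "t1 < T" using assms(11) by auto
  have eq_hom: "hom_coeff {0<..<l1} a1 = hom_coeff {0<..<l1} a2"
    by (rule diffusion_coefficient_unique[OF assms(1,2) h(1,2) assms(3) t1 assms(12,10,20,21)[unfolded assms(7,9)]
        ev[unfolded assms(9)] n0(2)[unfolded assms(9)] eq])
  show ?thesis unfolding assms(7) by (rule h(3)) (simp_all add: eq_hom)
qed

end
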